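(* Let $G$ be an additive abelian group and let $(R,\mathfrak m,k)$ be a local $G$-graded ring such that the canonical map $R_0\to k$, $r\mapsto r+\mathfrak m$, is an isomorphism. Let $M$ be a $G$-graded $R$-module. Then the associated flat-injective presentation $\varphi_M\colon F_M\to E_M$ of $M$ is a flat-injective presentation for $M$; that is, $\varphi_M$ is a graded homomorphism of degree $0$, $F_M$ is graded flat, $E_M$ is graded injective, and $\operatorname{Im}\varphi_M\cong M$.
   Context: Rings are commutative and unital; all modules are $G$-graded $R$-modules. A local graded ring $(R,\mathfrak m,k)$ is a graded ring with a unique maximal homogeneous ideal $\mathfrak m$, and $k=R/\mathfrak m$. The shift $\Sigma^gM$ is the graded module with $(\Sigma^gM)_a=M_{a-g}$. $\operatorname{Hom}_R(M,N)$ is the set of graded $R$-homomorphisms of degree $0$, and $\hom_R(M,N)=\bigoplus_{a\in G}\operatorname{Hom}_R(\Sigma^aM,N)$, a graded module. $E(k)$ is the graded injective hull of $k$, and the Matlis dual of $M$ is $M^\vee=\hom_R(M,E(k))$. The evaluation homomorphism is $u_M\colon M\to M^{\vee\vee}$, $u_M(m)(f')=f'(m)$. Graded flat and graded injective mean flat and injective in the category of graded modules. Identify $R_0$ with the field $k$, so graded components are $k$-vector spaces. For a $k$-vector space $V$ (placed in degree $0$) and a graded module $N$, $N\otimes_kV$ and $\operatorname{Hom}_k(V,N)$ are the graded $R$-modules with degree-$a$ components $N_a\otimes_kV$ and $\operatorname{Hom}_k(V,N_a)$; products are taken in the category of graded modules (degreewise). The associated flat module is $F_M=\bigoplus_{g\in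 G}\Sigma^gR\otimes_kM_g$ and the associated injective module is $E_M=\prod_{h\in G}\operatorname{Hom}_k(M^\vee_h,\Sigma^{-h}R^\vee)$, where $M^\vee_h$ is the degree-$h$ component of $M^\vee$. Let $\hat\varphi_M\colon F_M\to M$ be the graded homomorphism induced by $\Sigma^gR\otimes_kM_g\to M$, $r\otimes m\mapsto rm$. Let $\check\varphi_M\colon M^{\vee\vee}\to E_M$ be the graded homomorphism induced by the maps $M^{\vee\vee}\to\operatorname{Hom}_k(M^\vee_h,\Sigma^{-h}R^\vee)$, $f''\mapsto(f'\mapsto(r\mapsto r\cdot f''(f')))$, for $f''\in M^{\vee\vee}$, $f'\in M^\vee_h$, and $r\in R$ (viewed in $\Sigma^hR$; note $(\Sigma^hR)^\vee\cong\Sigma^{-h}R^\vee$). The associated flat-injective presentation of $M$ is $\varphi_M=\check\varphi_M\circ u_M\circ\hat\varphi_M\colon F_M\to E_M$. *)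

theory Defs
  imports "HOL-Algebra.Free_Abelian_Groups" "HOL-Algebra.Generated_Groups" "HOL-Algebra.QuotRing" "HOL-Algebra.Module"
begin

section \<open>Graded rings and graded modules\<close>

text \<open>The grading group is a type of class \<^class>\<open>ab_group_add\<close>.
  Gradings are internal: a family of additive subgroups of the carrier.\<close>

record ('g, 'r) graded_ring = "'r ring" +
  rpart :: "'g \<Rightarrow> 'r set"

record ('g, 'r, 'm) graded_module = "('r, 'm) module" +
  mpart :: "'g \<Rightarrow> 'm set"

definition internal_direct_sum :: "('m, 'x) ring_scheme \<Rightarrow> ('g \<Rightarrow> 'm set) \<Rightarrow> bool" where
  "internal_direct_sum M C \<longleftrightarrow>
     (\<forall>a. additive_subgroup (C a) M) \<and>
     (\<forall>x\<in>carrier M. \<exists>!f. (\<forall>a. f a \<in> C a) \<and> finite {a. f a \<noteq> \<zero>\<^bsub>M\<^esub>} \<and>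
        x = (\<Oplus>\<^bsub>M\<^esub>a\<in>{a. f a \<noteq> \<zero>\<^bsub>M\<^esub>}. f a))"

locale graded_ring = cring R
  for R :: "('g::ab_group_add, 'r) graded_ring" (structure) +
  assumes ring_decomposition: "internal_direct_sum R (rpart R)"
    and mult_degree: "\<lbrakk>r \<in> rpart R a; s \<in> rpart R b\<rbrakk> \<Longrightarrow> r \<otimes> s \<in> rpart R (a + b)"

locale graded_module = graded_ring R + module R M
  for R :: "('g::ab_group_add, 'r) graded_ring" (structure)
    and M :: "('g, 'r, 'm) graded_module" (structure) +
  assumes module_decomposition: "internal_direct_sum M (mpart M)"
    and smult_degree: "\<lbrakk>r \<in> rpart R a; x \<in> mpart M b\<rbrakk> \<Longrightarrow> r \<odot>\<^bsub>M\<^esub> x \<in> mpart M (a + b)"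

text \<open>The set of all finite sums of elements of the sets \<open>C a\<close>.\<close>

definition part_sums :: "('m, 'x) ring_scheme \<Rightarrow> ('g \<Rightarrow> 'm set) \<Rightarrow> 'm set" where
  "part_sums M C = {finsum M f A | f A. finite A \<and> f \<in> Pi A C}"

definition homogeneous_ideal :: "('g, 'r) graded_ring \<Rightarrow> 'r set \<Rightarrow> bool" where
  "homogeneous_ideal R I \<longleftrightarrow> ideal I R \<and> I = part_sums R (\<lambda>a. I \<inter> rpart R a)"

definition maximal_homogeneous_ideal :: "('g, 'r) graded_ring \<Rightarrow> 'r set \<Rightarrow> bool" where
  "maximal_homogeneous_ideal R I \<longleftrightarrow> homogeneous_ideal R I \<and> I \<noteq> carrier R \<and>
     (\<forall>J. homogeneous_ideal R J \<and> I \<subseteq> J \<and> J \<noteq> carrier R \<longrightarrow> J = I)"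

locale local_graded_ring = graded_ring R
  for R :: "('g::ab_group_add, 'r) graded_ring" (structure) and \<mm> :: "'r set" +
  assumes maximal: "maximal_homogeneous_ideal R \<mm>"
    and unique: "maximal_homogeneous_ideal R J \<Longrightarrow> J = \<mm>"

definition degree_zero_ring :: "('g::ab_group_add, 'r) graded_ring \<Rightarrow> ('g, 'r) graded_ring" where
  "degree_zero_ring R = R\<lparr>carrier := rpart R 0\<rparr>"

definition regular_module :: "('g, 'r) graded_ring \<Rightarrow> ('g, 'r, 'r) graded_module" where
  "regular_module R =
     \<lparr>carrier = carrier R, monoid.mult = monoid.mult R, one = one R, ring.zero = ring.zero R, ring.add = ring.add R,
      smult = monoid.mult R, mpart = rpart R\<rparr>"

text \<open>The residue ring \<open>k = R/\<mm>\<close> as a graded \<open>R\<close>-module.\<close>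

definition residue_module ::
  "('g, 'r) graded_ring \<Rightarrow> 'r set \<Rightarrow> ('g, 'r, 'r set) graded_module" where
  "residue_module R \<mm> =
     \<lparr>carrier = carrier (R Quot \<mm>), monoid.mult = monoid.mult (R Quot \<mm>), one = one (R Quot \<mm>),
      ring.zero = ring.zero (R Quot \<mm>), ring.add = ring.add (R Quot \<mm>),
      smult = (\<lambda>r X. (\<mm> +>\<^bsub>R\<^esub> r) \<otimes>\<^bsub>R Quot \<mm>\<^esub> X),
      mpart = (\<lambda>a. (\<lambda>r. \<mm> +>\<^bsub>R\<^esub> r) ` rpart R a)\<rparr>"

definition shift ::
  "'g::ab_group_add \<Rightarrow> ('g, 'r, 'm) graded_module \<Rightarrow> ('g, 'r, 'm) graded_module" where
  "shift g M = M\<lparr>mpart := \<lambda>a. mpart M (a - g)\<rparr>"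

definition graded_submodule ::
  "('g, 'r) graded_ring \<Rightarrow> ('g, 'r, 'm) graded_module \<Rightarrow> 'm set \<Rightarrow> bool" where
  "graded_submodule R M N \<longleftrightarrow> submodule N R M \<and> N = part_sums M (\<lambda>a. N \<inter> mpart M a)"

section \<open>Homomorphisms\<close>

text \<open>Maps are extensional, so that the sets below contain each map once. The scalars \<open>K\<close> may be
  any ring whose elements act on both modules, in particular \<open>R\<close> or \<open>R\<^sub>0\<close>.\<close>

definition linear_maps ::
  "('r, 'z) ring_scheme \<Rightarrow> ('r, 'm, 'x) module_scheme \<Rightarrow> ('r, 'n, 'y) module_scheme
     \<Rightarrow> ('m \<Rightarrow> 'n) set" where
  "linear_maps K V N = {f \<in> carrier V \<rightarrow>\<^sub>E carrier N.
     (\<forall>x\<in>carrier V. \<forall>y\<in>carrier V. f (x \<oplus>\<^bsub>V\<^esub> y) = f x \<oplus>\<^bsub>N\<^esub> f y) \<and>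
     (\<forall>c\<in>carrier K. \<forall>x\<in>carrier V. f (c \<odot>\<^bsub>V\<^esub> x) = c \<odot>\<^bsub>N\<^esub> f x)}"

text \<open>\<open>Hom\<^sub>R(M, N)\<close>: graded homomorphisms of degree \<open>0\<close>.\<close>

definition graded_Hom ::
  "('g, 'r) graded_ring \<Rightarrow> ('g, 'r, 'm) graded_module \<Rightarrow> ('g, 'r, 'n) graded_module
     \<Rightarrow> ('m \<Rightarrow> 'n) set" where
  "graded_Hom R M N = {f \<in> linear_maps R M N. \<forall>a. f ` mpart M a \<subseteq> mpart N a}"

definition graded_isomorphic ::
  "('g, 'r) graded_ring \<Rightarrow> ('g, 'r, 'm) graded_module \<Rightarrow> ('g, 'r, 'n) graded_module \<Rightarrow> bool" where
  "graded_isomorphic R M N \<longleftrightarrow> (\<exists>f\<in>graded_Hom R M N. \<exists>g\<in>graded_Hom R N M.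
     (\<forall>x\<in>carrier M. g (f x) = x) \<and> (\<forall>y\<in>carrier N. f (g y) = y))"

definition image_module ::
  "('g, 'r, 'm) graded_module \<Rightarrow> ('g, 'r, 'n) graded_module \<Rightarrow> ('m \<Rightarrow> 'n)
     \<Rightarrow> ('g, 'r, 'n) graded_module" where
  "image_module M N f = N\<lparr>carrier := f ` carrier M, mpart := \<lambda>a. f ` mpart M a\<rparr>"

text \<open>Ungraded product of the modules \<open>N i\<close>, \<open>i \<in> I\<close>, with pointwise operations. The ring
  multiplication fields of a module record carry no meaning.\<close>

definition prod_module ::
  "'i set \<Rightarrow> ('i \<Rightarrow> ('r, 'n, 'x) module_scheme) \<Rightarrow> ('r, 'i \<Rightarrow> 'n) module" where
  "prod_module I N =
     \<lparr>carrier = (\<Pi>\<^sub>E i\<in>I. carrier (N i)), monoid.mult = undefined, one = undefined,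
      ring.zero = (\<lambda>i\<in>I. \<zero>\<^bsub>N i\<^esub>), ring.add = (\<lambda>x y. \<lambda>i\<in>I. x i \<oplus>\<^bsub>N i\<^esub> y i),
      smult = (\<lambda>r x. \<lambda>i\<in>I. r \<odot>\<^bsub>N i\<^esub> x i)\<rparr>"

text \<open>The graded module with components \<open>C a\<close>, given inside an ambient ungraded module \<open>M\<close> in
  which the sum of the \<open>C a\<close> is direct.\<close>

definition module_of_parts ::
  "('r, 'm) module \<Rightarrow> ('g \<Rightarrow> 'm set) \<Rightarrow> ('g, 'r, 'm) graded_module" where
  "module_of_parts M C =
     \<lparr>carrier = part_sums M C, monoid.mult = monoid.mult M, one = one M, ring.zero = ring.zero M, ring.add = ring.add M,
      smult = smult M, mpart = C\<rparr>"

text \<open>\<open>hom\<^sub>R(M, N) = \<Oplus>\<^sub>a Hom\<^sub>R(\<Sigma>\<^sup>a M, N)\<close>. All \<open>\<Sigma>\<^sup>a M\<close> have the same underlying module, so the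
  summands are independent subgroups of the group of functions from \<open>M\<close> to \<open>N\<close>, and the direct
  sum is taken there.\<close>

definition hom_module ::
  "('g::ab_group_add, 'r) graded_ring \<Rightarrow> ('g, 'r, 'm) graded_module \<Rightarrow> ('g, 'r, 'n) graded_module
     \<Rightarrow> ('g, 'r, 'm \<Rightarrow> 'n) graded_module" where
  "hom_module R M N =
     module_of_parts (prod_module (carrier M) (\<lambda>_. N)) (\<lambda>a. graded_Hom R (shift a M) N)"

section \<open>Direct sums and products of graded modules\<close>

definition direct_sum ::
  "('i \<Rightarrow> ('g, 'r, 'm) graded_module) \<Rightarrow> ('g, 'r, 'i \<Rightarrow> 'm) graded_module" where
  "direct_sum N =
     \<lparr>carrier = {x. (\<forall>i. x i \<in> carrier (N i)) \<and> finite {i. x i \<noteq> \<zero>\<^bsub>N i\<^esub>}},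
      monoid.mult = undefined, one = undefined,
      ring.zero = (\<lambda>i. \<zero>\<^bsub>N i\<^esub>), ring.add = (\<lambda>x y i. x i \<oplus>\<^bsub>N i\<^esub> y i),
      smult = (\<lambda>r x i. r \<odot>\<^bsub>N i\<^esub> x i),
      mpart = (\<lambda>a. {x. (\<forall>i. x i \<in> mpart (N i) a) \<and> finite {i. x i \<noteq> \<zero>\<^bsub>N i\<^esub>}})\<rparr>"

text \<open>The product in the category of graded modules: its degree-\<open>a\<close> component is the product of
  the degree-\<open>a\<close> components.\<close>

definition graded_product ::
  "('i \<Rightarrow> ('g, 'r, 'm) graded_module) \<Rightarrow> ('g, 'r, 'i \<Rightarrow> 'm) graded_module" where
  "graded_product N =
     module_of_parts (prod_module UNIV N) (\<lambda>a. {x. \<forall>i. x i \<in> mpart (N i) a})"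

section \<open>Tensor products\<close>

text \<open>The tensor product \<open>N \<otimes>\<^sub>K V\<close> is the quotient of the free abelian group on pairs by the usual
  relations. Scalars of the result act on the left factor, so \<open>N \<otimes>\<^sub>K V\<close> is an \<open>R\<close>-module whenever
  \<open>N\<close> is one and \<open>K\<close> is a subring of \<open>R\<close>.\<close>

definition tensor_relations ::
  "('r, 'z) ring_scheme \<Rightarrow> ('r, 'n, 'x) module_scheme \<Rightarrow> ('r, 'v, 'y) module_scheme
     \<Rightarrow> ('n \<times> 'v \<Rightarrow>\<^sub>0 int) set" where
  "tensor_relations K N V =
     {frag_of (x \<oplus>\<^bsub>N\<^esub> y, v) - frag_of (x, v) - frag_of (y, v) | x y v.
        x \<in> carrier N \<and> y \<in> carrier N \<and> v \<in> carrier V} \<union>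
     {frag_of (x, v \<oplus>\<^bsub>V\<^esub> w) - frag_of (x, v) - frag_of (x, w) | x v w.
        x \<in> carrier N \<and> v \<in> carrier V \<and> w \<in> carrier V} \<union>
     {frag_of (c \<odot>\<^bsub>N\<^esub> x, v) - frag_of (x, c \<odot>\<^bsub>V\<^esub> v) | c x v.
        c \<in> carrier K \<and> x \<in> carrier N \<and> v \<in> carrier V}"

abbreviation tensor_free ::
  "('r, 'n, 'x) module_scheme \<Rightarrow> ('r, 'v, 'y) module_scheme \<Rightarrow> ('n \<times> 'v \<Rightarrow>\<^sub>0 int) monoid" where
  "tensor_free N V \<equiv> free_Abelian_group (carrier N \<times> carrier V)"

definition tensor_kernel ::
  "('r, 'z) ring_scheme \<Rightarrow> ('r, 'n, 'x) module_scheme \<Rightarrow> ('r, 'v, 'y) module_scheme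
     \<Rightarrow> ('n \<times> 'v \<Rightarrow>\<^sub>0 int) set" where
  "tensor_kernel K N V = generate (tensor_free N V) (tensor_relations K N V)"

definition tensor_class ::
  "('r, 'z) ring_scheme \<Rightarrow> ('r, 'n, 'x) module_scheme \<Rightarrow> ('r, 'v, 'y) module_scheme
     \<Rightarrow> ('n \<times> 'v \<Rightarrow>\<^sub>0 int) \<Rightarrow> ('n \<times> 'v \<Rightarrow>\<^sub>0 int) set" where
  "tensor_class K N V x = tensor_kernel K N V #>\<^bsub>tensor_free N V\<^esub> x"

definition tensor ::
  "('r, 'z) ring_scheme \<Rightarrow> ('r, 'n, 'x) module_scheme \<Rightarrow> ('r, 'v, 'y) module_scheme
     \<Rightarrow> ('r, ('n \<times> 'v \<Rightarrow>\<^sub>0 int) set) module" where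
  "tensor K N V = (let Q = tensor_free N V Mod tensor_kernel K N V in
     \<lparr>carrier = carrier Q, monoid.mult = undefined, one = undefined,
      ring.zero = one Q, ring.add = monoid.mult Q,
      smult = (\<lambda>r X. \<Union>x\<in>X. tensor_class K N V (frag_extend (\<lambda>(n, v). frag_of (r \<odot>\<^bsub>N\<^esub> n, v)) x))\<rparr>)"

text \<open>For a graded module \<open>N\<close> and an \<open>R\<^sub>0\<close>-module \<open>V\<close> placed in degree \<open>0\<close>, the degree-\<open>a\<close> component
  of \<open>N \<otimes> V\<close> is \<open>N\<^sub>a \<otimes> V\<close>, identified with its image in \<open>N \<otimes> V\<close>.\<close>

definition graded_tensor ::
  "('r, 'z) ring_scheme \<Rightarrow> ('g, 'r, 'n) graded_module \<Rightarrow> ('r, 'v, 'y) module_scheme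
     \<Rightarrow> ('g, 'r, ('n \<times> 'v \<Rightarrow>\<^sub>0 int) set) graded_module" where
  "graded_tensor K N V = module.extend (tensor K N V)
     (graded_module.fields (\<lambda>a. tensor_class K N V `
        carrier (free_Abelian_group (mpart N a \<times> carrier V))))"

text \<open>The additive map out of a tensor product induced by a balanced biadditive map \<open>b\<close>; it is
  constant on classes.\<close>

definition tensor_lift ::
  "('m, 'z) ring_scheme \<Rightarrow> ('n \<times> 'v \<Rightarrow> 'm) \<Rightarrow> ('n \<times> 'v \<Rightarrow>\<^sub>0 int) set \<Rightarrow> 'm" where
  "tensor_lift M b X = the_elem ((\<lambda>x. \<Oplus>\<^bsub>M\<^esub>p\<in>Poly_Mapping.keys x.
     add_pow M (Poly_Mapping.lookup x p) (b p)) ` X)"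

definition tensor_map ::
  "('r, 'z) ring_scheme \<Rightarrow> ('r, 'n, 'x) module_scheme \<Rightarrow> ('r, 'w, 'y) module_scheme
     \<Rightarrow> ('v \<Rightarrow> 'w) \<Rightarrow> ('n \<times> 'v \<Rightarrow>\<^sub>0 int) set \<Rightarrow> ('n \<times> 'w \<Rightarrow>\<^sub>0 int) set" where
  "tensor_map K N W f = tensor_lift (tensor K N W) (\<lambda>(n, v). tensor_class K N W (frag_of (n, f v)))"

section \<open>Graded flat and graded injective modules\<close>

text \<open>HOL cannot quantify over types inside a formula, so the carrier types of the graded modules
  \<open>A\<close> and \<open>B\<close> which are tested are parameters. In the conclusion of a theorem they can be left as
  free type variables, which gives the unrestricted notion. The underlying \<open>R\<close>-module of the tensor
  product of graded modules is the ordinary tensor product, so its grading plays no role in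
  flatness.\<close>

definition graded_flat ::
  "'a itself \<Rightarrow> 'b itself \<Rightarrow> ('g::ab_group_add, 'r) graded_ring
     \<Rightarrow> ('g, 'r, 'm) graded_module \<Rightarrow> bool" where
  "graded_flat TA TB R F \<longleftrightarrow> graded_module R F \<and>
     (\<forall>(A :: ('g, 'r, 'a) graded_module) (B :: ('g, 'r, 'b) graded_module) f.
        graded_module R A \<and> graded_module R B \<and> f \<in> graded_Hom R A B \<and> inj_on f (carrier A) \<longrightarrow>
        inj_on (tensor_map R F B f) (carrier (tensor R F A)))"

definition graded_injective ::
  "'a itself \<Rightarrow> 'b itself \<Rightarrow> ('g::ab_group_add, 'r) graded_ring
     \<Rightarrow> ('g, 'r, 'm) graded_module \<Rightarrow> bool" where
  "graded_injective TA TB R E \<longleftrightarrow> graded_module R E \<and>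
     (\<forall>(A :: ('g, 'r, 'a) graded_module) (B :: ('g, 'r, 'b) graded_module) i f.
        graded_module R A \<and> graded_module R B \<and> i \<in> graded_Hom R A B \<and> inj_on i (carrier A) \<and>
        f \<in> graded_Hom R A E \<longrightarrow>
        (\<exists>h\<in>graded_Hom R B E. \<forall>x\<in>carrier A. h (i x) = f x))"

text \<open>An injective hull of \<open>N\<close> is an essential extension of \<open>N\<close> that is graded injective.
  Injectivity is a hypothesis wherever this is assumed. It is tested on modules over the carrier
  type of \<open>R\<close> only: that includes the inclusions of homogeneous ideals into shifts of \<open>R\<close>, so by
  the graded Baer criterion nothing is lost.\<close>

definition graded_injective_hull ::
  "('g::ab_group_add, 'r) graded_ring \<Rightarrow> ('g, 'r, 'n) graded_module
     \<Rightarrow> ('g, 'r, 'm) graded_module \<Rightarrow> bool" where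
  "graded_injective_hull R N E \<longleftrightarrow> graded_injective TYPE('r) TYPE('r) R E \<and>
     (\<exists>\<iota>\<in>graded_Hom R N E. inj_on \<iota> (carrier N) \<and>
        (\<forall>U. graded_submodule R E U \<and> U \<noteq> {\<zero>\<^bsub>E\<^esub>} \<longrightarrow> U \<inter> \<iota> ` carrier N \<noteq> {\<zero>\<^bsub>E\<^esub>}))"

section \<open>The associated flat-injective presentation\<close>

text \<open>Throughout, \<open>E\<close> is the graded injective hull of \<open>k\<close>.\<close>

definition matlis_dual ::
  "('g::ab_group_add, 'r) graded_ring \<Rightarrow> ('g, 'r, 'e) graded_module \<Rightarrow> ('g, 'r, 'm) graded_module
     \<Rightarrow> ('g, 'r, 'm \<Rightarrow> 'e) graded_module" where
  "matlis_dual R E M = hom_module R M E"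

definition evaluation ::
  "('g::ab_group_add, 'r) graded_ring \<Rightarrow> ('g, 'r, 'e) graded_module \<Rightarrow> ('g, 'r, 'm) graded_module
     \<Rightarrow> 'm \<Rightarrow> ('m \<Rightarrow> 'e) \<Rightarrow> 'e" where
  "evaluation R E M = (\<lambda>m\<in>carrier M. \<lambda>f'\<in>carrier (matlis_dual R E M). f' m)"

text \<open>The component \<open>M\<^sub>g\<close> as a module over \<open>R\<^sub>0\<close>, that is, as a \<open>k\<close>-vector space.\<close>

definition component ::
  "('g, 'r, 'm) graded_module \<Rightarrow> 'g \<Rightarrow> ('g, 'r, 'm) graded_module" where
  "component M g = M\<lparr>carrier := mpart M g\<rparr>"

definition graded_vector_hom ::
  "('r, 'z) ring_scheme \<Rightarrow> ('r, 'v, 'y) module_scheme \<Rightarrow> ('g, 'r, 'n) graded_module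
     \<Rightarrow> ('g, 'r, 'v \<Rightarrow> 'n) graded_module" where
  "graded_vector_hom K V N =
     module_of_parts (prod_module (carrier V) (\<lambda>_. N)) (\<lambda>a. linear_maps K V (component N a))"

definition associated_flat ::
  "('g::ab_group_add, 'r) graded_ring \<Rightarrow> ('g, 'r, 'm) graded_module
     \<Rightarrow> ('g, 'r, 'g \<Rightarrow> ('r \<times> 'm \<Rightarrow>\<^sub>0 int) set) graded_module" where
  "associated_flat R M = direct_sum (\<lambda>g.
     graded_tensor (degree_zero_ring R) (shift g (regular_module R)) (component M g))"

definition associated_injective ::
  "('g::ab_group_add, 'r) graded_ring \<Rightarrow> ('g, 'r, 'e) graded_module \<Rightarrow> ('g, 'r, 'm) graded_module
     \<Rightarrow> ('g, 'r, 'g \<Rightarrow> ('m \<Rightarrow> 'e) \<Rightarrow> 'r \<Rightarrow> 'e) graded_module" where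
  "associated_injective R E M = graded_product (\<lambda>h.
     graded_vector_hom (degree_zero_ring R) (component (matlis_dual R E M) h)
       (shift (- h) (matlis_dual R E (regular_module R))))"

definition phi_hat ::
  "('g::ab_group_add, 'r) graded_ring \<Rightarrow> ('g, 'r, 'm) graded_module
     \<Rightarrow> ('g \<Rightarrow> ('r \<times> 'm \<Rightarrow>\<^sub>0 int) set) \<Rightarrow> 'm" where
  "phi_hat R M = (\<lambda>x\<in>carrier (associated_flat R M).
     \<Oplus>\<^bsub>M\<^esub>g\<in>{g. x g \<noteq> \<zero>\<^bsub>associated_flat R M\<^esub> g}. tensor_lift M (\<lambda>(r, m). r \<odot>\<^bsub>M\<^esub> m) (x g))"

definition phi_check ::
  "('g::ab_group_add, 'r) graded_ring \<Rightarrow> ('g, 'r, 'e) graded_module \<Rightarrow> ('g, 'r, 'm) graded_module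
     \<Rightarrow> (('m \<Rightarrow> 'e) \<Rightarrow> 'e) \<Rightarrow> 'g \<Rightarrow> ('m \<Rightarrow> 'e) \<Rightarrow> 'r \<Rightarrow> 'e" where
  "phi_check R E M = (\<lambda>f''\<in>carrier (matlis_dual R E (matlis_dual R E M)).
     \<lambda>h. \<lambda>f'\<in>mpart (matlis_dual R E M) h. \<lambda>r\<in>carrier R. r \<odot>\<^bsub>E\<^esub> f'' f')"

definition associated_presentation ::
  "('g::ab_group_add, 'r) graded_ring \<Rightarrow> ('g, 'r, 'e) graded_module \<Rightarrow> ('g, 'r, 'm) graded_module
     \<Rightarrow> ('g \<Rightarrow> ('r \<times> 'm \<Rightarrow>\<^sub>0 int) set) \<Rightarrow> 'g \<Rightarrow> ('m \<Rightarrow> 'e) \<Rightarrow> 'r \<Rightarrow> 'e" where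
  "associated_presentation R E M = compose (carrier (associated_flat R M)) (phi_check R E M)
     (compose (carrier (associated_flat R M)) (evaluation R E M) (phi_hat R M))"

text \<open>\<open>\<phi> : F \<rightarrow> I\<close> is a flat-injective presentation for \<open>M\<close>.\<close>

definition flat_injective_presentation ::
  "'a itself \<Rightarrow> 'b itself \<Rightarrow> ('g::ab_group_add, 'r) graded_ring \<Rightarrow> ('g, 'r, 'm) graded_module
     \<Rightarrow> ('g, 'r, 'f) graded_module \<Rightarrow> ('g, 'r, 'i) graded_module \<Rightarrow> ('f \<Rightarrow> 'i) \<Rightarrow> bool" where
  "flat_injective_presentation TA TB R M F I \<phi> \<longleftrightarrow>
     \<phi> \<in> graded_Hom R F I \<and> graded_flat TA TB R F \<and> graded_injective TA TB R I \<and>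
     graded_isomorphic R (image_module F I \<phi>) M"

end

theory Submission
  imports Defs
begin

text \<open>Why the theorem holds. The hypothesis on \<open>R\<^sub>0\<close> splits the residue map: the maximal ideal is the sum of
  all components of nonzero degree (\<open>nonzero_degree_in_\<mm>\<close>) and \<open>R\<^sub>0\<close> is a field
  (\<open>degree_zero_inverse\<close>). Every graded \<open>R\<close>-module is thus a graded vector space over \<open>R\<^sub>0\<close>, and all
  graded vector spaces are injective (\<open>graded_field_Baer\<close>).

  Flatness of \<open>F\<^sub>M\<close>. Let \<open>f : A \<rightarrow> B\<close> be injective, with \<open>R\<^sub>0\<close>-linear left inverse \<open>s\<close>. Since \<open>F\<^sub>M \<otimes> A\<close> is a sum
  of modules \<open>A \<otimes>\<^sub>k M\<^sub>g\<close>, naturally in \<open>A\<close>, the map \<open>s\<close> induces a left inverse of \<open>F\<^sub>M \<otimes> f\<close>; explicitly it is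
  \<open>(r \<otimes> m) \<otimes> b \<mapsto> (1 \<otimes> m) \<otimes> s(r b)\<close> (\<open>graded_flat_associated_flat\<close>).

  Injectivity of \<open>E\<^sub>M\<close>. By the graded Baer criterion (\<open>graded_Baer_imp_injective\<close>) it is enough to extend maps
  from shifted homogeneous ideals. An element of \<open>R\<^sup>\<or>\<close> is determined by its value at one, so a
  homogeneous element of \<open>E\<^sub>M\<close> amounts to an \<open>R\<^sub>0\<close>-linear map from \<open>M\<^sup>\<or>\<close> to \<open>E\<close>. Injectivity of \<open>E\<close> yields
  a value of the extension for each single \<open>v\<close> in \<open>M\<^sup>\<or>\<close>. The possible values depend linearly on \<open>v\<close>, as a relation, and over a field a total
  linear relation contains a linear map (\<open>graded_Baer_associated_injective\<close>). This choice and the Baer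
  criterion come from the same application of Zorn's lemma (\<open>Hom_extension\<close>), in which a partial
  homomorphism is extended subject to a constraint on its graph.

  The image. The map \<open>F\<^sub>M \<rightarrow> M\<close> is surjective in each degree because \<open>1 \<otimes> m\<close> is mapped to \<open>m\<close>. The composite
  \<open>M \<rightarrow> E\<^sub>M\<close> of the other two maps is injective because homomorphisms to \<open>E\<close> detect nonzero homogeneous
  elements \<open>n\<close> (\<open>dual_detects\<close>): \<open>E\<close> contains a nonzero \<open>e\<close> annihilated by the maximal ideal, and \<open>n \<mapsto> e\<close>
  extends to a homomorphism. So the image of the composite \<open>F\<^sub>M \<rightarrow> E\<^sub>M\<close> is a copy of \<open>M\<close>
  (\<open>image_of_factorization\<close>).\<close>

section \<open>Additive maps and internal direct sums\<close>

abbreviation additive_maps ::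
  "('m, 'x) ring_scheme \<Rightarrow> ('n, 'y) ring_scheme \<Rightarrow> ('m \<Rightarrow> 'n) set" where
  "additive_maps M N \<equiv> hom (add_monoid M) (add_monoid N)"

lemma additive_mapsI:
  assumes "\<And>x. x \<in> carrier M \<Longrightarrow> f x \<in> carrier N"
    and "\<And>x y. x \<in> carrier M \<Longrightarrow> y \<in> carrier M \<Longrightarrow> f (x \<oplus>\<^bsub>M\<^esub> y) = f x \<oplus>\<^bsub>N\<^esub> f y"
  shows "f \<in> additive_maps M N"
  using assms by (auto simp: hom_def)

lemma additive_closed: "f \<in> additive_maps M N \<Longrightarrow> x \<in> carrier M \<Longrightarrow> f x \<in> carrier N"
  by (auto simp: hom_def)

lemma additive_add:
  "f \<in> additive_maps M N \<Longrightarrow> x \<in> carrier M \<Longrightarrow> y \<in> carrier M \<Longrightarrow> f (x \<oplus>\<^bsub>M\<^esub> y) = f x \<oplus>\<^bsub>N\<^esub> f y"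
  by (auto simp: hom_def)

lemma additive_zero:
  assumes "abelian_group M" "abelian_group N" "f \<in> additive_maps M N"
  shows "f \<zero>\<^bsub>M\<^esub> = \<zero>\<^bsub>N\<^esub>"
  using hom_one[OF assms(3) abelian_group.a_group[OF assms(1)] abelian_group.a_group[OF assms(2)]]
  by simp

lemma additive_minus:
  assumes "abelian_group M" "abelian_group N" "f \<in> additive_maps M N" "x \<in> carrier M"
  shows "f (\<ominus>\<^bsub>M\<^esub> x) = \<ominus>\<^bsub>N\<^esub> f x"
proof -
  interpret group_hom "add_monoid M" "add_monoid N" f
    using assms by (simp add: group_hom_def group_hom_axioms_def abelian_group.a_group)
  show ?thesis using hom_inv assms(4) by (simp add: a_inv_def)
qed

lemma additive_finsum:
  assumes M: "abelian_group M" and N: "abelian_group N" and f: "f \<in> additive_maps M N"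
    and g: "g \<in> A \<rightarrow> carrier M"
  shows "f (finsum M g A) = (\<Oplus>\<^bsub>N\<^esub>a\<in>A. f (g a))"
proof -
  interpret M: abelian_group M by fact
  interpret N: abelian_group N by fact
  show ?thesis
    using g
  proof (induction A rule: infinite_finite_induct)
    case (insert a A)
    have "(\<lambda>a. f (g a)) \<in> A \<rightarrow> carrier N" "f (g a) \<in> carrier N"
      using insert.prems additive_closed[OF f] by auto
    then show ?case
      using insert by (simp add: M.finsum_insert N.finsum_insert additive_add[OF f] M.finsum_closed)
  qed (simp_all add: additive_zero[OF M N f])
qed

lemma additive_comp:
  "f \<in> additive_maps M N \<Longrightarrow> g \<in> additive_maps N P \<Longrightarrow> (\<lambda>x. g (f x)) \<in> additive_maps M P"
  by (auto simp: hom_def Pi_iff)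

lemma (in abelian_group) finsum_mono_neutral:
  assumes "finite B" "A \<subseteq> B" "\<And>i. i \<in> B - A \<Longrightarrow> f i = \<zero>" "f \<in> B \<rightarrow> carrier G"
  shows "finsum G f A = finsum G f B"
  using assms by (intro add.finprod_mono_neutral_cong_left) auto

lemma (in abelian_group) finsum_minus:
  assumes "f \<in> A \<rightarrow> carrier G"
  shows "(\<Oplus>i\<in>A. \<ominus> f i) = \<ominus> finsum G f A"
  using assms
proof (induction A rule: infinite_finite_induct)
  case (insert a A)
  then have "f a \<in> carrier G" "f \<in> A \<rightarrow> carrier G" "(\<lambda>i. \<ominus> f i) \<in> A \<rightarrow> carrier G"
    by auto
  with insert show ?case by (simp add: finsum_insert minus_add finsum_closed)
qed (simp_all add: minus_equality[of \<zero> \<zero>])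

locale direct_decomposition = abelian_group M for M (structure) +
  fixes C :: "'g \<Rightarrow> 'm set"
  assumes decomposition: "internal_direct_sum M C"
begin

lemma part_subgroup: "additive_subgroup (C a) M"
  using decomposition by (simp add: internal_direct_sum_def)

lemma part_zero [simp]: "\<zero> \<in> C a"
  using additive_subgroup.zero_closed[OF part_subgroup] .

lemma part_add: "x \<in> C a \<Longrightarrow> y \<in> C a \<Longrightarrow> x \<oplus> y \<in> C a"
  using additive_subgroup.a_closed[OF part_subgroup] .

lemma part_carrier: "x \<in> C a \<Longrightarrow> x \<in> carrier M"
  using additive_subgroup.a_Hcarr[OF part_subgroup] .

lemma part_minus: "x \<in> C a \<Longrightarrow> \<ominus> x \<in> C a"
  by (simp add: additive_subgroup.a_subgroup part_subgroup subgroup.m_inv_closed a_inv_def)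

text \<open>The component of \<open>x\<close> in the part with the given index.\<close>

definition hcomp :: "'m \<Rightarrow> 'g \<Rightarrow> 'm" where
  "hcomp x = (THE f. (\<forall>a. f a \<in> C a) \<and> finite {a. f a \<noteq> \<zero>} \<and> x = (\<Oplus>a\<in>{a. f a \<noteq> \<zero>}. f a))"

lemma hcomp_spec:
  assumes "x \<in> carrier M"
  shows "(\<forall>a. hcomp x a \<in> C a) \<and> finite {a. hcomp x a \<noteq> \<zero>} \<and>
    x = (\<Oplus>a\<in>{a. hcomp x a \<noteq> \<zero>}. hcomp x a)"
proof -
  have "\<exists>!f. (\<forall>a. f a \<in> C a) \<and> finite {a. f a \<noteq> \<zero>} \<and> x = (\<Oplus>a\<in>{a. f a \<noteq> \<zero>}. f a)"
    using decomposition assms by (simp add: internal_direct_sum_def)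
  from theI'[OF this] show ?thesis unfolding hcomp_def .
qed

lemma hcomp_part: "x \<in> carrier M \<Longrightarrow> hcomp x a \<in> C a"
  and hcomp_finite: "x \<in> carrier M \<Longrightarrow> finite {a. hcomp x a \<noteq> \<zero>}"
  and hcomp_sum: "x \<in> carrier M \<Longrightarrow> (\<Oplus>a\<in>{a. hcomp x a \<noteq> \<zero>}. hcomp x a) = x"
  using hcomp_spec by auto

lemma hcomp_sum_superset:
  assumes "x \<in> carrier M" "finite A" "{a. hcomp x a \<noteq> \<zero>} \<subseteq> A"
  shows "finsum M (hcomp x) A = x"
proof -
  have "hcomp x \<in> A \<rightarrow> carrier M" using hcomp_part[OF assms(1)] part_carrier by blast
  then have "finsum M (hcomp x) {a. hcomp x a \<noteq> \<zero>} = finsum M (hcomp x) A"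
    using assms by (intro finsum_mono_neutral) auto
  then show ?thesis using hcomp_sum[OF assms(1)] by simp
qed

lemma hcomp_carrier [simp]: "x \<in> carrier M \<Longrightarrow> hcomp x a \<in> carrier M"
  using hcomp_part part_carrier by blast

lemma hcomp_unique:
  assumes A: "finite A" "\<And>a. f a \<in> C a" "\<And>a. a \<notin> A \<Longrightarrow> f a = \<zero>" and x: "x = (\<Oplus>a\<in>A. f a)"
  shows "hcomp x = f"
proof -
  have fc: "f \<in> A \<rightarrow> carrier M" using A(2) part_carrier by blast
  have sub: "{a. f a \<noteq> \<zero>} \<subseteq> A" using A(3) by blast
  have "x \<in> carrier M" using fc x by simp
  then have ex1: "\<exists>!f. (\<forall>a. f a \<in> C a) \<and> finite {a. f a \<noteq> \<zero>} \<and> x = (\<Oplus>a\<in>{a. f a \<noteq> \<zero>}. f a)"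
    using decomposition by (simp add: internal_direct_sum_def)
  have "x = (\<Oplus>a\<in>{a. f a \<noteq> \<zero>}. f a)"
    using finsum_mono_neutral[OF A(1) sub _ fc] x by simp
  then show ?thesis
    unfolding hcomp_def using ex1 A sub finite_subset by (intro the1_equality) auto
qed

lemma hcomp_homogeneous:
  assumes "x \<in> C a"
  shows "hcomp x = (\<lambda>b. if b = a then x else \<zero>)"
proof (rule hcomp_unique)
  show "x = (\<Oplus>b\<in>{a}. if b = a then x else \<zero>)"
    using assms part_carrier by (subst finsum_insert) auto
qed (use assms in auto)

lemma hcomp_add:
  assumes x: "x \<in> carrier M" and y: "y \<in> carrier M"
  shows "hcomp (x \<oplus> y) = (\<lambda>a. hcomp x a \<oplus> hcomp y a)"
proof (rule hcomp_unique)
  let ?A = "{a. hcomp x a \<noteq> \<zero>} \<union> {a. hcomp y a \<noteq> \<zero>}"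
  show fin: "finite ?A" using x y hcomp_finite by simp
  have "finsum M (hcomp x) ?A = x" "finsum M (hcomp y) ?A = y"
    by (rule hcomp_sum_superset[OF x fin], blast) (rule hcomp_sum_superset[OF y fin], blast)
  then show "x \<oplus> y = (\<Oplus>a\<in>?A. hcomp x a \<oplus> hcomp y a)"
    using x y by (subst finsum_addf) auto
qed (use x y in \<open>auto intro: part_add hcomp_part\<close>)

lemma hcomp_eqI:
  assumes "x \<in> carrier M" "y \<in> carrier M" "\<And>a. hcomp x a = hcomp y a"
  shows "x = y"
  using assms hcomp_sum ext[of "hcomp x" "hcomp y"] by metis

lemma homogeneous_induct [consumes 1, case_names homogeneous add]:
  assumes x: "x \<in> carrier M"
    and homogeneous: "\<And>a x. x \<in> C a \<Longrightarrow> P x"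
    and add: "\<And>x y. x \<in> carrier M \<Longrightarrow> y \<in> carrier M \<Longrightarrow> P x \<Longrightarrow> P y \<Longrightarrow> P (x \<oplus> y)"
  shows "P x"
proof -
  have "P (\<Oplus>a\<in>A. hcomp x a)" if "finite A" for A
    using that
  proof (induction A)
    case (insert a A)
    have "P (hcomp x a \<oplus> (\<Oplus>a\<in>A. hcomp x a))"
      using x insert.IH by (intro add homogeneous[OF hcomp_part]) auto
    then show ?case using x insert.hyps by (subst finsum_insert) auto
  qed (use homogeneous[OF part_zero] in simp)
  with hcomp_finite[OF x] hcomp_sum[OF x] show ?thesis by metis
qed

lemma independent:
  assumes "finite A" "f \<in> Pi A C" "finsum M f A = \<zero>" "a \<in> A"
  shows "f a = \<zero>"
proof -
  let ?f = "\<lambda>a. if a \<in> A then f a else \<zero>"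
  have "f \<in> A \<rightarrow> carrier M" using assms(2) part_carrier by blast
  then have "finsum M ?f A = \<zero>" using assms(3) by (subst finsum_cong'[of A A f]) auto
  then have "hcomp \<zero> = ?f" using assms by (intro hcomp_unique[of A]) auto
  moreover have "hcomp \<zero> = (\<lambda>_. \<zero>)" using hcomp_homogeneous[OF part_zero] by simp
  ultimately show ?thesis using assms(4) by metis
qed

lemma additive_eqI:
  assumes "f \<in> additive_maps M N" "g \<in> additive_maps M N"
    and "\<And>a x. x \<in> C a \<Longrightarrow> f x = g x" and "x \<in> carrier M"
  shows "f x = g x"
  using assms(4)
  by (induction x rule: homogeneous_induct)
    (simp_all add: assms(3) additive_add[OF assms(1)] additive_add[OF assms(2)])

end

lemma (in abelian_group) internal_direct_sumI:
  assumes sub: "\<And>a. additive_subgroup (C a) G"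
    and span: "carrier G \<subseteq> part_sums G C"
    and indep: "\<And>A f a. finite A \<Longrightarrow> f \<in> Pi A C \<Longrightarrow> finsum G f A = \<zero> \<Longrightarrow> a \<in> A \<Longrightarrow> f a = \<zero>"
  shows "internal_direct_sum G C"
proof -
  have car: "x \<in> carrier G" if "x \<in> C a" for x a
    using additive_subgroup.a_Hcarr[OF sub that] .
  have zero: "\<zero> \<in> C a" for a using additive_subgroup.zero_closed[OF sub] .
  have "\<exists>!f. (\<forall>a. f a \<in> C a) \<and> finite {a. f a \<noteq> \<zero>} \<and> x = (\<Oplus>a\<in>{a. f a \<noteq> \<zero>}. f a)"
    if "x \<in> carrier G" for x
  proof -
    have "x \<in> part_sums G C" using span that by blast
    then obtain f A where A: "finite A" "f \<in> Pi A C" "x = finsum G f A"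
      unfolding part_sums_def by auto
    let ?f = "\<lambda>a. if a \<in> A then f a else \<zero>"
    have f: "f \<in> A \<rightarrow> carrier G" using A(2) car by blast
    then have fc: "?f \<in> A \<rightarrow> carrier G" by auto
    from f have "finsum G ?f A = x" unfolding A(3) by (intro finsum_cong') simp_all
    moreover have "finsum G ?f {a. ?f a \<noteq> \<zero>} = finsum G ?f A"
      using A(1) fc by (intro finsum_mono_neutral) auto
    moreover have "finite {a. ?f a \<noteq> \<zero>}" using A(1) by simp
    moreover have "\<forall>a. ?f a \<in> C a" using A(2) zero by auto
    moreover have "g = h"
      if g: "\<forall>a. g a \<in> C a" "finite {a. g a \<noteq> \<zero>}" "x = (\<Oplus>a\<in>{a. g a \<noteq> \<zero>}. g a)"
        and h: "\<forall>a. h a \<in> C a" "finite {a. h a \<noteq> \<zero>}" "x = (\<Oplus>a\<in>{a. h a \<noteq> \<zero>}. h a)" for g h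
    proof
      fix a
      let ?B = "insert a ({a. g a \<noteq> \<zero>} \<union> {a. h a \<noteq> \<zero>})"
      have fin: "finite ?B" using g h by simp
      have gc: "g \<in> ?B \<rightarrow> carrier G" "h \<in> ?B \<rightarrow> carrier G" "g a \<in> carrier G" "h a \<in> carrier G"
        using g(1) h(1) car by blast+
      have "finsum G g {a. g a \<noteq> \<zero>} = finsum G g ?B" "finsum G h {a. h a \<noteq> \<zero>} = finsum G h ?B"
        by (rule finsum_mono_neutral[OF fin _ _ gc(1)], blast, blast)
          (rule finsum_mono_neutral[OF fin _ _ gc(2)], blast, blast)
      then have "finsum G g ?B = x" "finsum G h ?B = x" using g(3) h(3) by simp_all
      then have "(\<Oplus>b\<in>?B. g b \<oplus> \<ominus> h b) = \<zero>"
        using gc \<open>x \<in> carrier G\<close>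
        by (subst finsum_addf, blast, blast, subst finsum_minus) (simp_all add: r_neg)
      moreover have "(\<lambda>b. g b \<oplus> \<ominus> h b) \<in> Pi ?B C"
        using g(1) h(1) sub
        by (auto intro!: additive_subgroup.a_closed[OF sub] 
            simp: additive_subgroup.a_subgroup subgroup.m_inv_closed a_inv_def)
      ultimately have "g a \<oplus> \<ominus> h a = \<zero>" using indep[OF fin] by blast
      then show "g a = h a"
        using gc by (metis minus_equality minus_minus a_comm a_inv_closed)
    qed
    ultimately show ?thesis by (intro ex1I[of _ ?f]) auto
  qed
  with sub show ?thesis unfolding internal_direct_sum_def by blast
qed

text \<open>A vanishing sum of elements of different parts is mapped to a sum of the same kind in every group \<open>T j\<close>,
  where its terms vanish. Coordinates of products and evaluations of homomorphisms are used as \<open>\<pi> j\<close>.\<close>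

lemma independent_by_maps:
  fixes T :: "'j \<Rightarrow> ('t, 'u) ring_scheme" and C :: "'g::group_add \<Rightarrow> 'm set"
  assumes M: "abelian_group M" and T: "\<And>j. j \<in> J \<Longrightarrow> direct_decomposition (T j) (D j)"
    and \<pi>: "\<And>j. j \<in> J \<Longrightarrow> \<pi> j \<in> additive_maps M (T j)"
    and deg: "\<And>j a x. j \<in> J \<Longrightarrow> x \<in> C a \<Longrightarrow> \<pi> j x \<in> D j (a + s j)"
    and inj: "\<And>a x. x \<in> C a \<Longrightarrow> (\<And>j. j \<in> J \<Longrightarrow> \<pi> j x = \<zero>\<^bsub>T j\<^esub>) \<Longrightarrow> x = \<zero>\<^bsub>M\<^esub>"
    and C: "\<And>a. C a \<subseteq> carrier M"
    and A: "finite A" "f \<in> Pi A C" "finsum M f A = \<zero>\<^bsub>M\<^esub>" "a \<in> A"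
  shows "f a = \<zero>\<^bsub>M\<^esub>"
proof (rule inj)
  show "f a \<in> C a" using A by blast
  fix j assume j: "j \<in> J"
  interpret T: direct_decomposition "T j" "D j" by (rule T[OF j])
  have fc: "f \<in> A \<rightarrow> carrier M" using A(2) C by blast
  have c: "\<pi> j (f i) \<in> carrier (T j)" if "i \<in> A" for i
    using additive_closed[OF \<pi>[OF j]] fc that by blast
  let ?g = "\<lambda>b. \<pi> j (f (b - s j))"
  have "finsum (T j) ?g ((\<lambda>i. i + s j) ` A) = (\<Oplus>\<^bsub>T j\<^esub>i\<in>A. \<pi> j (f i))"
    using c by (subst T.finsum_reindex) (auto simp: inj_on_def)
  also have "\<dots> = \<zero>\<^bsub>T j\<^esub>"
    using additive_finsum[OF M T.abelian_group_axioms \<pi>[OF j] fc] A(3)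
      additive_zero[OF M T.abelian_group_axioms \<pi>[OF j]] by simp
  finally have sum: "finsum (T j) ?g ((\<lambda>i. i + s j) ` A) = \<zero>\<^bsub>T j\<^esub>" .
  have "?g \<in> Pi ((\<lambda>i. i + s j) ` A) (D j)"
    using deg[OF j] A(2) by (force simp: Pi_def)
  then have "?g (a + s j) = \<zero>\<^bsub>T j\<^esub>"
    using A(1,4) sum T.independent[of "(\<lambda>i. i + s j) ` A" ?g "a + s j"] by blast
  then show "\<pi> j (f a) = \<zero>\<^bsub>T j\<^esub>" by simp
qed

section \<open>Graded modules and their homomorphisms\<close>

sublocale graded_ring \<subseteq> R_parts: direct_decomposition R "rpart R"
  using ring_decomposition by unfold_locales

sublocale graded_module \<subseteq> M_parts: direct_decomposition M "mpart M"
  using module_decomposition by unfold_locales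

lemma graded_module_abelian_group: "graded_module R M \<Longrightarrow> abelian_group M"
  by (simp add: graded_module_def module_def)

lemma linear_maps_additive: "f \<in> linear_maps K V N \<Longrightarrow> f \<in> additive_maps V N"
  by (auto simp: linear_maps_def hom_def)

lemma linear_maps_smult:
  "f \<in> linear_maps K V N \<Longrightarrow> c \<in> carrier K \<Longrightarrow> x \<in> carrier V \<Longrightarrow> f (c \<odot>\<^bsub>V\<^esub> x) = c \<odot>\<^bsub>N\<^esub> f x"
  by (auto simp: linear_maps_def)

lemma linear_mapsI:
  assumes "f \<in> additive_maps V N" "f \<in> extensional (carrier V)"
    and "\<And>c x. c \<in> carrier K \<Longrightarrow> x \<in> carrier V \<Longrightarrow> f (c \<odot>\<^bsub>V\<^esub> x) = c \<odot>\<^bsub>N\<^esub> f x"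
  shows "f \<in> linear_maps K V N"
  using assms by (auto simp: linear_maps_def hom_def PiE_def)

lemma linear_maps_eqI:
  assumes "f \<in> linear_maps K V N" "g \<in> linear_maps K V N" "\<And>x. x \<in> carrier V \<Longrightarrow> f x = g x"
  shows "f = g"
  using assms by (auto simp: linear_maps_def intro: PiE_ext)

lemma graded_Hom_linear: "f \<in> graded_Hom R M N \<Longrightarrow> f \<in> linear_maps R M N"
  by (simp add: graded_Hom_def)

lemma graded_Hom_additive: "f \<in> graded_Hom R M N \<Longrightarrow> f \<in> additive_maps M N"
  by (rule linear_maps_additive[OF graded_Hom_linear])

lemma graded_Hom_smult:
  "f \<in> graded_Hom R M N \<Longrightarrow> r \<in> carrier R \<Longrightarrow> x \<in> carrier M \<Longrightarrow> f (r \<odot>\<^bsub>M\<^esub> x) = r \<odot>\<^bsub>N\<^esub> f x"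
  by (rule linear_maps_smult[OF graded_Hom_linear])

lemma graded_Hom_part: "f \<in> graded_Hom R M N \<Longrightarrow> x \<in> mpart M a \<Longrightarrow> f x \<in> mpart N a"
  by (auto simp: graded_Hom_def)

lemma graded_Hom_closed: "f \<in> graded_Hom R M N \<Longrightarrow> x \<in> carrier M \<Longrightarrow> f x \<in> carrier N"
  by (rule additive_closed[OF graded_Hom_additive])

lemma graded_Hom_add:
  "f \<in> graded_Hom R M N \<Longrightarrow> x \<in> carrier M \<Longrightarrow> y \<in> carrier M \<Longrightarrow> f (x \<oplus>\<^bsub>M\<^esub> y) = f x \<oplus>\<^bsub>N\<^esub> f y"
  by (rule additive_add[OF graded_Hom_additive])

lemma graded_Hom_extensional: "f \<in> graded_Hom R M N \<Longrightarrow> f \<in> extensional (carrier M)"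
  by (auto simp: graded_Hom_def linear_maps_def PiE_def)

text \<open>Linearity needs to be checked for homogeneous scalars and vectors only, because both sides of the
  law are additive in either argument.\<close>

lemma graded_HomI:
  assumes M: "graded_module R M" and N: "graded_module R N"
    and f: "f \<in> additive_maps M N" "f \<in> extensional (carrier M)"
    and deg: "\<And>a x. x \<in> mpart M a \<Longrightarrow> f x \<in> mpart N a"
    and smult: "\<And>a b r x. r \<in> rpart R b \<Longrightarrow> x \<in> mpart M a \<Longrightarrow> f (r \<odot>\<^bsub>M\<^esub> x) = r \<odot>\<^bsub>N\<^esub> f x"
  shows "f \<in> graded_Hom R M N"
proof -
  interpret M: graded_module R M by fact
  interpret N: graded_module R N by fact
  have fc: "f x \<in> carrier N" if "x \<in> carrier M" for x using additive_closed[OF f(1) that] .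
  have *: "f (r \<odot>\<^bsub>M\<^esub> x) = r \<odot>\<^bsub>N\<^esub> f x" if r: "r \<in> carrier R" and x: "x \<in> mpart M a" for r x a
    using r
  proof (induction r rule: M.R_parts.homogeneous_induct)
    case (add r s)
    then show ?case using M.M_parts.part_carrier[OF x] fc
      by (simp add: M.smult_l_distr N.smult_l_distr additive_add[OF f(1)])
  qed (use smult x in blast)
  have "f (r \<odot>\<^bsub>M\<^esub> x) = r \<odot>\<^bsub>N\<^esub> f x" if r: "r \<in> carrier R" and x: "x \<in> carrier M" for r x
    using x
  proof (induction x rule: M.M_parts.homogeneous_induct)
    case (add x y)
    then show ?case using r fc
      by (simp add: M.smult_r_distr N.smult_r_distr additive_add[OF f(1)])
  qed (use * r in blast)
  with f deg show ?thesis unfolding graded_Hom_def by (auto intro: linear_mapsI)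
qed

text \<open>Homomorphisms are constructed degree by degree; summing over the components of an element turns such a
  family into one map.\<close>

lemma graded_Hom_from_parts:
  assumes M: "graded_module R M" and N: "graded_module R N"
    and deg: "\<And>a x. x \<in> mpart M a \<Longrightarrow> h a x \<in> mpart N a"
    and add: "\<And>a x y. x \<in> mpart M a \<Longrightarrow> y \<in> mpart M a \<Longrightarrow> h a (x \<oplus>\<^bsub>M\<^esub> y) = h a x \<oplus>\<^bsub>N\<^esub> h a y"
    and smult: "\<And>a b r x. r \<in> rpart R b \<Longrightarrow> x \<in> mpart M a \<Longrightarrow>
      h (b + a) (r \<odot>\<^bsub>M\<^esub> x) = r \<odot>\<^bsub>N\<^esub> h a x"
  shows "\<exists>f \<in> graded_Hom R M N. \<forall>a. \<forall>x \<in> mpart M a. f x = h a x"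
proof -
  interpret M: graded_module R M by fact
  interpret N: graded_module R N by fact
  let ?S = "\<lambda>x. {a. M.M_parts.hcomp x a \<noteq> \<zero>\<^bsub>M\<^esub>}"
  let ?h = "\<lambda>x a. h a (M.M_parts.hcomp x a)"
  define f where "f = (\<lambda>x\<in>carrier M. \<Oplus>\<^bsub>N\<^esub>a\<in>?S x. ?h x a)"
  have h0: "h a \<zero>\<^bsub>M\<^esub> = \<zero>\<^bsub>N\<^esub>" for a
  proof -
    have "h a \<zero>\<^bsub>M\<^esub> \<in> carrier N" using deg N.M_parts.part_carrier M.M_parts.part_zero by blast
    moreover have "h a \<zero>\<^bsub>M\<^esub> = h a \<zero>\<^bsub>M\<^esub> \<oplus>\<^bsub>N\<^esub> h a \<zero>\<^bsub>M\<^esub>"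
      using add[of "\<zero>\<^bsub>M\<^esub>" a "\<zero>\<^bsub>M\<^esub>"] by simp
    ultimately show ?thesis using N.add.l_cancel_one' by metis
  qed
  have hc: "?h x a \<in> carrier N" if "x \<in> carrier M" for x a
    using deg N.M_parts.part_carrier M.M_parts.hcomp_part that by blast
  have f_sum: "f x = (\<Oplus>\<^bsub>N\<^esub>a\<in>A. ?h x a)" if "x \<in> carrier M" "finite A" "?S x \<subseteq> A" for x A
    unfolding f_def using that hc by (simp, intro N.finsum_mono_neutral) (auto simp: h0)
  have f_add: "f (x \<oplus>\<^bsub>M\<^esub> y) = f x \<oplus>\<^bsub>N\<^esub> f y" if x: "x \<in> carrier M" and y: "y \<in> carrier M" for x y
  proof -
    let ?A = "?S x \<union> ?S y \<union> ?S (x \<oplus>\<^bsub>M\<^esub> y)"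
    have fin: "finite ?A" using x y M.M_parts.hcomp_finite by simp
    have "f (x \<oplus>\<^bsub>M\<^esub> y) = (\<Oplus>\<^bsub>N\<^esub>a\<in>?A. ?h (x \<oplus>\<^bsub>M\<^esub> y) a)"
      using x y fin by (intro f_sum) auto
    also have "\<dots> = (\<Oplus>\<^bsub>N\<^esub>a\<in>?A. ?h x a \<oplus>\<^bsub>N\<^esub> ?h y a)"
      by (rule N.finsum_cong') (use x y hc add M.M_parts.hcomp_part in \<open>auto simp: M.M_parts.hcomp_add\<close>)
    also have "\<dots> = (\<Oplus>\<^bsub>N\<^esub>a\<in>?A. ?h x a) \<oplus>\<^bsub>N\<^esub> (\<Oplus>\<^bsub>N\<^esub>a\<in>?A. ?h y a)"
      using x y hc by (intro N.finsum_addf) auto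
    also have "\<dots> = f x \<oplus>\<^bsub>N\<^esub> f y"
    proof -
      have "?S x \<subseteq> ?A" "?S y \<subseteq> ?A" by blast+
      then show ?thesis using f_sum[OF x fin] f_sum[OF y fin] by simp
    qed
    finally show ?thesis .
  qed
  have f_hom: "f x = h a x" if x: "x \<in> mpart M a" for a x
  proof -
    have "f x = (\<Oplus>\<^bsub>N\<^esub>b\<in>{a}. ?h x b)"
      using M.M_parts.part_carrier[OF x] M.M_parts.hcomp_homogeneous[OF x] by (intro f_sum) auto
    then show ?thesis
      using M.M_parts.hcomp_homogeneous[OF x] N.M_parts.part_carrier[OF deg[OF x]] by simp
  qed
  have "f \<in> graded_Hom R M N"
  proof (rule graded_HomI[OF M N])
    show "f \<in> additive_maps M N"
      using hc f_add by (intro additive_mapsI) (auto simp: f_def)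
    show "f \<in> extensional (carrier M)" by (simp add: f_def)
    show "f (r \<odot>\<^bsub>M\<^esub> x) = r \<odot>\<^bsub>N\<^esub> f x" if "r \<in> rpart R b" "x \<in> mpart M a" for a b r x
      using f_hom[OF M.smult_degree[OF that]] f_hom[OF that(2)] smult[OF that] by simp
  qed (use f_hom deg in auto)
  with f_hom show ?thesis by blast
qed

lemma (in graded_ring) one_part: "\<one> \<in> rpart R 0"
proof -
  let ?e = "R_parts.hcomp \<one> 0"
  have e: "?e \<in> rpart R 0" "?e \<in> carrier R" by (simp_all add: R_parts.hcomp_part)
  \<comment> \<open>Comparing degrees in x = 1 x shows that the degree-0 part of 1 is also a unit element.\<close>
  have *: "?e \<otimes> x = x" if x: "x \<in> rpart R a" for a x
  proof -
    have xc: "x \<in> carrier R" using x R_parts.part_carrier by blast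
    have fin: "finite {b. R_parts.hcomp \<one> b \<noteq> \<zero>}" by (simp add: R_parts.hcomp_finite)
    let ?A = "(\<lambda>b. b + a) ` {b. R_parts.hcomp \<one> b \<noteq> \<zero>}"
    let ?f = "\<lambda>b. R_parts.hcomp \<one> (b - a) \<otimes> x"
    have "R_parts.hcomp x = ?f"
    proof (rule R_parts.hcomp_unique[of ?A])
      show "finite ?A" using fin by simp
      show "?f b \<in> rpart R b" for b
        using mult_degree[OF R_parts.hcomp_part x, of \<one> "b - a"] by simp
      show "?f b = \<zero>" if "b \<notin> ?A" for b
      proof -
        have "R_parts.hcomp \<one> (b - a) = \<zero>" using that by (auto simp: image_iff)
        then show ?thesis using xc by simp
      qed
      have "x = (\<Oplus>b\<in>{b. R_parts.hcomp \<one> b \<noteq> \<zero>}. R_parts.hcomp \<one> b) \<otimes> x"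
        using xc by (simp add: R_parts.hcomp_sum)
      also have "\<dots> = (\<Oplus>b\<in>{b. R_parts.hcomp \<one> b \<noteq> \<zero>}. R_parts.hcomp \<one> b \<otimes> x)"
        using xc fin by (intro finsum_ldistr) auto
      also have "\<dots> = (\<Oplus>b\<in>(\<lambda>b. b + a) ` {b. R_parts.hcomp \<one> b \<noteq> \<zero>}. ?f b)"
        using xc by (subst finsum_reindex) (auto simp: inj_on_def)
      finally show "x = (\<Oplus>b\<in>?A. ?f b)" .
    qed
    then have "x = ?f a" using R_parts.hcomp_homogeneous[OF x] by metis
    then show ?thesis by simp
  qed
  have "?e \<otimes> x = x" if "x \<in> carrier R" for x
    using that e by (induction x rule: R_parts.homogeneous_induct) (simp_all add: * r_distr)
  then have "?e = \<one>" using e by (metis one_closed r_one)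
  with e show ?thesis by simp
qed

section \<open>Extension of graded homomorphisms\<close>

text \<open>A degree-preserving relation between \<open>B\<close> and \<open>E\<close> is recorded by its homogeneous elements only;
  the graph of a partially defined graded homomorphism is the typical example. This spares the
  construction of graded submodules as modules of their own.\<close>

definition homogeneous_relation ::
  "('g::ab_group_add, 'r) graded_ring \<Rightarrow> ('g, 'r, 'b) graded_module \<Rightarrow> ('g, 'r, 'e) graded_module
     \<Rightarrow> ('g \<times> 'b \<times> 'e) set \<Rightarrow> bool" where
  "homogeneous_relation R B E \<Gamma> \<longleftrightarrow>
     (\<forall>a b e. (a, b, e) \<in> \<Gamma> \<longrightarrow> b \<in> mpart B a \<and> e \<in> mpart E a) \<and>
     (\<forall>a. (a, \<zero>\<^bsub>B\<^esub>, \<zero>\<^bsub>E\<^esub>) \<in> \<Gamma>) \<and>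
     (\<forall>a b e b' e'. (a, b, e) \<in> \<Gamma> \<longrightarrow> (a, b', e') \<in> \<Gamma> \<longrightarrow> (a, b \<oplus>\<^bsub>B\<^esub> b', e \<oplus>\<^bsub>E\<^esub> e') \<in> \<Gamma>) \<and>
     (\<forall>c r a b e. r \<in> rpart R c \<longrightarrow> (a, b, e) \<in> \<Gamma> \<longrightarrow> (c + a, r \<odot>\<^bsub>B\<^esub> b, r \<odot>\<^bsub>E\<^esub> e) \<in> \<Gamma>)"

text \<open>A relation closed under addition and negation is single-valued as soon as it is so at zero.\<close>

definition functional_relation ::
  "('g, 'r, 'b) graded_module \<Rightarrow> ('g, 'r, 'e) graded_module \<Rightarrow> ('g \<times> 'b \<times> 'e) set \<Rightarrow> bool" where
  "functional_relation B E \<Gamma> \<longleftrightarrow> (\<forall>a e. (a, \<zero>\<^bsub>B\<^esub>, e) \<in> \<Gamma> \<longrightarrow> e = \<zero>\<^bsub>E\<^esub>)"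

lemma homogeneous_relationD:
  assumes "homogeneous_relation R B E \<Gamma>"
  shows "(a, b, e) \<in> \<Gamma> \<Longrightarrow> b \<in> mpart B a" "(a, b, e) \<in> \<Gamma> \<Longrightarrow> e \<in> mpart E a"
    "(a, \<zero>\<^bsub>B\<^esub>, \<zero>\<^bsub>E\<^esub>) \<in> \<Gamma>"
    "(a, b, e) \<in> \<Gamma> \<Longrightarrow> (a, b', e') \<in> \<Gamma> \<Longrightarrow> (a, b \<oplus>\<^bsub>B\<^esub> b', e \<oplus>\<^bsub>E\<^esub> e') \<in> \<Gamma>"
    "r \<in> rpart R c \<Longrightarrow> (a, b, e) \<in> \<Gamma> \<Longrightarrow> (c + a, r \<odot>\<^bsub>B\<^esub> b, r \<odot>\<^bsub>E\<^esub> e) \<in> \<Gamma>"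
  using assms unfolding homogeneous_relation_def by blast+

locale graded_module_pair = B: graded_module R B + E: graded_module R E
  for R :: "('g::ab_group_add, 'r) graded_ring" and B :: "('g, 'r, 'b) graded_module"
    and E :: "('g, 'r, 'e) graded_module"
begin

lemma relation_minus:
  assumes "homogeneous_relation R B E \<Gamma>" "(a, b, e) \<in> \<Gamma>"
  shows "(a, \<ominus>\<^bsub>B\<^esub> b, \<ominus>\<^bsub>E\<^esub> e) \<in> \<Gamma>"
proof -
  have "(0 + a, (\<ominus>\<^bsub>R\<^esub> \<one>\<^bsub>R\<^esub>) \<odot>\<^bsub>B\<^esub> b, (\<ominus>\<^bsub>R\<^esub> \<one>\<^bsub>R\<^esub>) \<odot>\<^bsub>E\<^esub> e) \<in> \<Gamma>"
    by (intro homogeneous_relationD(5)[OF assms(1)] assms(2) B.R_parts.part_minus B.one_part)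
  moreover have "b \<in> carrier B" "e \<in> carrier E"
    using homogeneous_relationD(1,2)[OF assms] B.M_parts.part_carrier E.M_parts.part_carrier by auto
  ultimately show ?thesis by (simp add: B.smult_l_minus E.smult_l_minus)
qed

lemma relation_unique:
  assumes \<Gamma>: "homogeneous_relation R B E \<Gamma>" "functional_relation B E \<Gamma>"
    and e: "(a, b, e) \<in> \<Gamma>" and e': "(a, b, e') \<in> \<Gamma>"
  shows "e = e'"
proof -
  have c: "b \<in> carrier B" "e \<in> carrier E" "e' \<in> carrier E"
    using homogeneous_relationD(1,2)[OF \<Gamma>(1)] e e' B.M_parts.part_carrier E.M_parts.part_carrier
    by blast+
  have "(a, b \<oplus>\<^bsub>B\<^esub> \<ominus>\<^bsub>B\<^esub> b, e \<oplus>\<^bsub>E\<^esub> \<ominus>\<^bsub>E\<^esub> e') \<in> \<Gamma>"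
    by (intro homogeneous_relationD(4)[OF \<Gamma>(1)] e relation_minus[OF \<Gamma>(1)] e')
  then have "e \<oplus>\<^bsub>E\<^esub> \<ominus>\<^bsub>E\<^esub> e' = \<zero>\<^bsub>E\<^esub>"
    using \<Gamma>(2) c by (simp add: B.M.r_neg functional_relation_def)
  then show ?thesis using c by (metis E.M.minus_equality E.M.minus_minus E.M.a_comm E.M.a_inv_closed)
qed

text \<open>If \<open>x + r b = 0\<close> for some \<open>x\<close> in the domain, then \<open>r b\<close> lies in the domain and has the value \<open>r e\<close> by
  assumption. So the adjoined pair leaves the relation single-valued.\<close>

lemma relation_adjoin:
  assumes \<Gamma>: "homogeneous_relation R B E \<Gamma>" "functional_relation B E \<Gamma>"
    and b: "b \<in> mpart B a" and e: "e \<in> mpart E a"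
    and fit: "\<And>c r y. r \<in> rpart R c \<Longrightarrow> (c + a, r \<odot>\<^bsub>B\<^esub> b, y) \<in> \<Gamma> \<Longrightarrow> y = r \<odot>\<^bsub>E\<^esub> e"
  defines "\<Gamma>' \<equiv> {(d, x \<oplus>\<^bsub>B\<^esub> r \<odot>\<^bsub>B\<^esub> b, y \<oplus>\<^bsub>E\<^esub> r \<odot>\<^bsub>E\<^esub> e) | d x y r.
    (d, x, y) \<in> \<Gamma> \<and> r \<in> rpart R (d - a)}"
  shows "homogeneous_relation R B E \<Gamma>'" "functional_relation B E \<Gamma>'" "\<Gamma> \<subseteq> \<Gamma>'" "(a, b, e) \<in> \<Gamma>'"
proof -
  note rel = homogeneous_relationD[OF \<Gamma>(1)]
  have bc: "b \<in> carrier B" and ec: "e \<in> carrier E"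
    using b e B.M_parts.part_carrier E.M_parts.part_carrier by auto
  have car: "x \<in> carrier B" "y \<in> carrier E" if "(d, x, y) \<in> \<Gamma>" for d x y
    using rel(1,2)[OF that] B.M_parts.part_carrier E.M_parts.part_carrier by auto
  have rc: "r \<in> carrier R" if "r \<in> rpart R d" for r d
    using that B.R_parts.part_carrier by blast
  have mem: "(d, x \<oplus>\<^bsub>B\<^esub> r \<odot>\<^bsub>B\<^esub> b, y \<oplus>\<^bsub>E\<^esub> r \<odot>\<^bsub>E\<^esub> e) \<in> \<Gamma>'"
    if "(d, x, y) \<in> \<Gamma>" "r \<in> rpart R (d - a)" for d x y r
    unfolding \<Gamma>'_def using that by blast
  show sub: "\<Gamma> \<subseteq> \<Gamma>'"
  proof
    fix t assume t: "t \<in> \<Gamma>"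
    obtain d x y where dxy: "t = (d, x, y)" by (cases t) auto
    from t dxy have "(d, x \<oplus>\<^bsub>B\<^esub> \<zero>\<^bsub>R\<^esub> \<odot>\<^bsub>B\<^esub> b, y \<oplus>\<^bsub>E\<^esub> \<zero>\<^bsub>R\<^esub> \<odot>\<^bsub>E\<^esub> e) \<in> \<Gamma>'" by (intro mem) auto
    then show "t \<in> \<Gamma>'" using t car bc ec dxy by simp
  qed
  have "(a, \<zero>\<^bsub>B\<^esub> \<oplus>\<^bsub>B\<^esub> \<one>\<^bsub>R\<^esub> \<odot>\<^bsub>B\<^esub> b, \<zero>\<^bsub>E\<^esub> \<oplus>\<^bsub>E\<^esub> \<one>\<^bsub>R\<^esub> \<odot>\<^bsub>E\<^esub> e) \<in> \<Gamma>'"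
    by (rule mem) (use rel(3) B.one_part in auto)
  then show "(a, b, e) \<in> \<Gamma>'" using bc ec by simp
  show "functional_relation B E \<Gamma>'"
    unfolding functional_relation_def
  proof (intro allI impI)
    fix d f assume "(d, \<zero>\<^bsub>B\<^esub>, f) \<in> \<Gamma>'"
    then obtain x y r where *: "(d, x, y) \<in> \<Gamma>" "r \<in> rpart R (d - a)"
      and eq: "\<zero>\<^bsub>B\<^esub> = x \<oplus>\<^bsub>B\<^esub> r \<odot>\<^bsub>B\<^esub> b" and f: "f = y \<oplus>\<^bsub>E\<^esub> r \<odot>\<^bsub>E\<^esub> e"
      unfolding \<Gamma>'_def by blast
    have "\<ominus>\<^bsub>B\<^esub> x = r \<odot>\<^bsub>B\<^esub> b"
      using eq car[OF *(1)] rc[OF *(2)] bc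
      by (metis B.M.minus_equality B.M.a_comm B.smult_closed)
    then have "(d - a + a, r \<odot>\<^bsub>B\<^esub> b, \<ominus>\<^bsub>E\<^esub> y) \<in> \<Gamma>"
      using relation_minus[OF \<Gamma>(1) *(1)] by simp
    then have "\<ominus>\<^bsub>E\<^esub> y = r \<odot>\<^bsub>E\<^esub> e" by (rule fit[OF *(2)])
    then show "f = \<zero>\<^bsub>E\<^esub>" using f car[OF *(1)] by (metis E.M.r_neg)
  qed
  show "homogeneous_relation R B E \<Gamma>'"
    unfolding homogeneous_relation_def
  proof (intro conjI allI impI)
    fix d f g assume "(d, f, g) \<in> \<Gamma>'"
    then obtain x y r where *: "(d, x, y) \<in> \<Gamma>" "r \<in> rpart R (d - a)"
      and fg: "f = x \<oplus>\<^bsub>B\<^esub> r \<odot>\<^bsub>B\<^esub> b" "g = y \<oplus>\<^bsub>E\<^esub> r \<odot>\<^bsub>E\<^esub> e"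
      unfolding \<Gamma>'_def by blast
    show "f \<in> mpart B d" "g \<in> mpart E d"
      using B.smult_degree[OF *(2) b] E.smult_degree[OF *(2) e] rel(1,2)[OF *(1)]
      unfolding fg by (auto intro: B.M_parts.part_add E.M_parts.part_add)
  next
    fix d show "(d, \<zero>\<^bsub>B\<^esub>, \<zero>\<^bsub>E\<^esub>) \<in> \<Gamma>'" using sub rel(3) by blast
  next
    fix d f g f' g' assume "(d, f, g) \<in> \<Gamma>'" "(d, f', g') \<in> \<Gamma>'"
    then obtain x y r x' y' r' where
        *: "(d, x, y) \<in> \<Gamma>" "r \<in> rpart R (d - a)" "(d, x', y') \<in> \<Gamma>" "r' \<in> rpart R (d - a)"
      and fg: "f = x \<oplus>\<^bsub>B\<^esub> r \<odot>\<^bsub>B\<^esub> b" "g = y \<oplus>\<^bsub>E\<^esub> r \<odot>\<^bsub>E\<^esub> e"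
        "f' = x' \<oplus>\<^bsub>B\<^esub> r' \<odot>\<^bsub>B\<^esub> b" "g' = y' \<oplus>\<^bsub>E\<^esub> r' \<odot>\<^bsub>E\<^esub> e"
      unfolding \<Gamma>'_def by blast
    note c = car[OF *(1)] car[OF *(3)] rc[OF *(2)] rc[OF *(4)] bc ec
    have "f \<oplus>\<^bsub>B\<^esub> f' = (x \<oplus>\<^bsub>B\<^esub> x') \<oplus>\<^bsub>B\<^esub> (r \<oplus>\<^bsub>R\<^esub> r') \<odot>\<^bsub>B\<^esub> b"
      "g \<oplus>\<^bsub>E\<^esub> g' = (y \<oplus>\<^bsub>E\<^esub> y') \<oplus>\<^bsub>E\<^esub> (r \<oplus>\<^bsub>R\<^esub> r') \<odot>\<^bsub>E\<^esub> e"
      using c unfolding fg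
      by (simp_all add: B.smult_l_distr E.smult_l_distr B.M.a_ac E.M.a_ac)
    then show "(d, f \<oplus>\<^bsub>B\<^esub> f', g \<oplus>\<^bsub>E\<^esub> g') \<in> \<Gamma>'"
      using mem[OF rel(4)[OF *(1,3)] B.R_parts.part_add[OF *(2,4)]] by simp
  next
    fix c s d f g assume s: "s \<in> rpart R c" and "(d, f, g) \<in> \<Gamma>'"
    then obtain x y r where *: "(d, x, y) \<in> \<Gamma>" "r \<in> rpart R (d - a)"
      and fg: "f = x \<oplus>\<^bsub>B\<^esub> r \<odot>\<^bsub>B\<^esub> b" "g = y \<oplus>\<^bsub>E\<^esub> r \<odot>\<^bsub>E\<^esub> e"
      unfolding \<Gamma>'_def by blast
    note c = car[OF *(1)] rc[OF *(2)] rc[OF s] bc ec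
    have "s \<odot>\<^bsub>B\<^esub> f = s \<odot>\<^bsub>B\<^esub> x \<oplus>\<^bsub>B\<^esub> (s \<otimes>\<^bsub>R\<^esub> r) \<odot>\<^bsub>B\<^esub> b"
      "s \<odot>\<^bsub>E\<^esub> g = s \<odot>\<^bsub>E\<^esub> y \<oplus>\<^bsub>E\<^esub> (s \<otimes>\<^bsub>R\<^esub> r) \<odot>\<^bsub>E\<^esub> e"
      using c unfolding fg
      by (simp_all add: B.smult_r_distr E.smult_r_distr B.smult_assoc1 E.smult_assoc1)
    moreover have "s \<otimes>\<^bsub>R\<^esub> r \<in> rpart R (c + d - a)"
      using B.mult_degree[OF s *(2)] by (simp add: add_diff_eq)
    ultimately show "(c + d, s \<odot>\<^bsub>B\<^esub> f, s \<odot>\<^bsub>E\<^esub> g) \<in> \<Gamma>'"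
      using mem[OF rel(5)[OF s *(1)]] by simp
  qed
qed

lemma relation_total_imp_Hom:
  assumes \<Gamma>: "homogeneous_relation R B E \<Gamma>" "functional_relation B E \<Gamma>"
    and total: "\<And>a b. b \<in> mpart B a \<Longrightarrow> \<exists>e. (a, b, e) \<in> \<Gamma>"
  shows "\<exists>h \<in> graded_Hom R B E. \<forall>a b. b \<in> mpart B a \<longrightarrow> (a, b, h b) \<in> \<Gamma>"
proof -
  define h where "h a b = (SOME e. (a, b, e) \<in> \<Gamma>)" for a b
  have h: "(a, b, h a b) \<in> \<Gamma>" if "b \<in> mpart B a" for a b
    unfolding h_def using total[OF that] by (rule someI_ex)
  have h_eq: "h a b = e" if "(a, b, e) \<in> \<Gamma>" for a b e
    using relation_unique[OF \<Gamma> h that] homogeneous_relationD(1)[OF \<Gamma>(1) that] by blast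
  have "\<exists>f \<in> graded_Hom R B E. \<forall>a. \<forall>x \<in> mpart B a. f x = h a x"
  proof (rule graded_Hom_from_parts[OF B.graded_module_axioms E.graded_module_axioms])
    show "h a x \<in> mpart E a" if "x \<in> mpart B a" for a x
      using homogeneous_relationD(2)[OF \<Gamma>(1) h[OF that]] .
    show "h a (x \<oplus>\<^bsub>B\<^esub> y) = h a x \<oplus>\<^bsub>E\<^esub> h a y" if "x \<in> mpart B a" "y \<in> mpart B a" for a x y
      by (intro h_eq homogeneous_relationD(4)[OF \<Gamma>(1)] h that)
    show "h (c + a) (r \<odot>\<^bsub>B\<^esub> x) = r \<odot>\<^bsub>E\<^esub> h a x" if "r \<in> rpart R c" "x \<in> mpart B a" for a c r x
      by (intro h_eq homogeneous_relationD(5)[OF \<Gamma>(1)] h that)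
  qed
  then show ?thesis using h by metis
qed

text \<open>The one use of Zorn's lemma. A maximal functional relation between the given one and the
  constraint \<open>\<Lambda>\<close> is total, because otherwise an element could be adjoined.\<close>

theorem Hom_extension:
  assumes \<Gamma>\<^sub>0: "homogeneous_relation R B E \<Gamma>\<^sub>0" "functional_relation B E \<Gamma>\<^sub>0" "\<Gamma>\<^sub>0 \<subseteq> \<Lambda>"
    and \<Lambda>: "homogeneous_relation R B E \<Lambda>"
    and step: "\<And>\<Gamma> a b. homogeneous_relation R B E \<Gamma> \<Longrightarrow> functional_relation B E \<Gamma> \<Longrightarrow> \<Gamma> \<subseteq> \<Lambda> \<Longrightarrow>
      b \<in> mpart B a \<Longrightarrow> \<exists>e. (a, b, e) \<in> \<Lambda> \<and>
        (\<forall>c r y. r \<in> rpart R c \<longrightarrow> (c + a, r \<odot>\<^bsub>B\<^esub> b, y) \<in> \<Gamma> \<longrightarrow> y = r \<odot>\<^bsub>E\<^esub> e)"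
  shows "\<exists>h \<in> graded_Hom R B E. (\<forall>a b. b \<in> mpart B a \<longrightarrow> (a, b, h b) \<in> \<Lambda>) \<and>
    (\<forall>a b e. (a, b, e) \<in> \<Gamma>\<^sub>0 \<longrightarrow> h b = e)"
proof -
  let ?S = "{\<Gamma>. homogeneous_relation R B E \<Gamma> \<and> functional_relation B E \<Gamma> \<and> \<Gamma>\<^sub>0 \<subseteq> \<Gamma> \<and> \<Gamma> \<subseteq> \<Lambda>}"
  have "\<exists>\<Gamma>\<in>?S. \<forall>X\<in>?S. \<Gamma> \<subseteq> X \<longrightarrow> X = \<Gamma>"
  proof (rule subset_Zorn_nonempty)
    show "?S \<noteq> {}" using \<Gamma>\<^sub>0 by blast
    fix \<C> assume ne: "\<C> \<noteq> {}" and chain: "subset.chain ?S \<C>"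
    have S: "\<Gamma> \<in> ?S" if "\<Gamma> \<in> \<C>" for \<Gamma> using chain that unfolding subset_chain_def by blast
    have rel: "homogeneous_relation R B E \<Gamma>" if "\<Gamma> \<in> \<C>" for \<Gamma> using S[OF that] by blast
    have pair: "\<exists>\<Gamma>\<in>\<C>. s \<in> \<Gamma> \<and> t \<in> \<Gamma>" if st: "s \<in> \<Union>\<C>" "t \<in> \<Union>\<C>" for s t
    proof -
      obtain X Y where XY: "X \<in> \<C>" "Y \<in> \<C>" "s \<in> X" "t \<in> Y" using st by blast
      then have "X \<subseteq> Y \<or> Y \<subseteq> X" using chain unfolding subset_chain_def by blast
      with XY show ?thesis by blast
    qed
    have "homogeneous_relation R B E (\<Union>\<C>)"
      unfolding homogeneous_relation_def
    proof (intro conjI allI impI)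
      fix a b e assume "(a, b, e) \<in> \<Union>\<C>"
      then obtain \<Gamma> where "\<Gamma> \<in> \<C>" "(a, b, e) \<in> \<Gamma>" by blast
      then show "b \<in> mpart B a" "e \<in> mpart E a" using homogeneous_relationD(1,2)[OF rel] by blast+
    next
      fix a show "(a, \<zero>\<^bsub>B\<^esub>, \<zero>\<^bsub>E\<^esub>) \<in> \<Union>\<C>" using ne homogeneous_relationD(3)[OF rel] by blast
    next
      fix a b e b' e' assume "(a, b, e) \<in> \<Union>\<C>" "(a, b', e') \<in> \<Union>\<C>"
      from pair[OF this] show "(a, b \<oplus>\<^bsub>B\<^esub> b', e \<oplus>\<^bsub>E\<^esub> e') \<in> \<Union>\<C>"
        using homogeneous_relationD(4)[OF rel] by blast
    next
      fix c r a b e assume "r \<in> rpart R c" "(a, b, e) \<in> \<Union>\<C>"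
      then show "(c + a, r \<odot>\<^bsub>B\<^esub> b, r \<odot>\<^bsub>E\<^esub> e) \<in> \<Union>\<C>"
        using homogeneous_relationD(5)[OF rel] by blast
    qed
    moreover have "functional_relation B E (\<Union>\<C>)"
      using S unfolding functional_relation_def by blast
    ultimately show "\<Union>\<C> \<in> ?S" using S ne by blast
  qed
  then obtain \<Gamma> where \<Gamma>_in: "\<Gamma> \<in> ?S" and max: "\<forall>X\<in>?S. \<Gamma> \<subseteq> X \<longrightarrow> X = \<Gamma>"
    by (rule bexE)
  from \<Gamma>_in have \<Gamma>: "homogeneous_relation R B E \<Gamma>" "functional_relation B E \<Gamma>" "\<Gamma>\<^sub>0 \<subseteq> \<Gamma>" "\<Gamma> \<subseteq> \<Lambda>"
    by simp_all
  have total: "\<exists>e. (a, b, e) \<in> \<Gamma>" if b: "b \<in> mpart B a" for a b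
  proof -
    obtain e where e: "(a, b, e) \<in> \<Lambda>"
      and fit: "\<And>c r y. r \<in> rpart R c \<Longrightarrow> (c + a, r \<odot>\<^bsub>B\<^esub> b, y) \<in> \<Gamma> \<Longrightarrow> y = r \<odot>\<^bsub>E\<^esub> e"
      using step[OF \<Gamma>(1,2,4) b] by blast
    let ?\<Gamma> = "{(d, x \<oplus>\<^bsub>B\<^esub> r \<odot>\<^bsub>B\<^esub> b, y \<oplus>\<^bsub>E\<^esub> r \<odot>\<^bsub>E\<^esub> e) | d x y r. (d, x, y) \<in> \<Gamma> \<and> r \<in> rpart R (d - a)}"
    note adjoin = relation_adjoin[OF \<Gamma>(1,2) b homogeneous_relationD(2)[OF \<Lambda> e] fit]
    have "?\<Gamma> \<subseteq> \<Lambda>"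
    proof
      fix t assume "t \<in> ?\<Gamma>"
      then obtain d x y r where t: "t = (d, x \<oplus>\<^bsub>B\<^esub> r \<odot>\<^bsub>B\<^esub> b, y \<oplus>\<^bsub>E\<^esub> r \<odot>\<^bsub>E\<^esub> e)"
        and *: "(d, x, y) \<in> \<Gamma>" "r \<in> rpart R (d - a)" by blast
      have "(d - a + a, r \<odot>\<^bsub>B\<^esub> b, r \<odot>\<^bsub>E\<^esub> e) \<in> \<Lambda>"
        by (rule homogeneous_relationD(5)[OF \<Lambda> *(2) e])
      then show "t \<in> \<Lambda>"
        unfolding t using * \<Gamma>(4) by (intro homogeneous_relationD(4)[OF \<Lambda>]) auto
    qed
    then have "?\<Gamma> \<in> ?S" using adjoin(1,2) subset_trans[OF \<Gamma>(3) adjoin(3)] by simp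
    from bspec[OF max this] have "?\<Gamma> = \<Gamma>" using adjoin(3) by (rule mp)
    with adjoin(4) have "(a, b, e) \<in> \<Gamma>" by (simp only:)
    then show ?thesis ..
  qed
  obtain h where h: "h \<in> graded_Hom R B E" "\<And>a b. b \<in> mpart B a \<Longrightarrow> (a, b, h b) \<in> \<Gamma>"
    using relation_total_imp_Hom[OF \<Gamma>(1,2) total] by blast
  have "h b = e" if "(a, b, e) \<in> \<Gamma>\<^sub>0" for a b e
    using relation_unique[OF \<Gamma>(1,2)] h(2) homogeneous_relationD(1)[OF \<Gamma>\<^sub>0(1) that] that \<Gamma>(3) by blast
  with h \<Gamma>(4) show ?thesis by blast
qed

lemma homogeneous_relation_all: "homogeneous_relation R B E {(a, b, e). b \<in> mpart B a \<and> e \<in> mpart E a}"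
  unfolding homogeneous_relation_def
  by (auto intro: B.M_parts.part_add E.M_parts.part_add B.smult_degree E.smult_degree)

lemma zero_relation:
  "homogeneous_relation R B E {(a, \<zero>\<^bsub>B\<^esub>, \<zero>\<^bsub>E\<^esub>) | a. True}"
  "functional_relation B E {(a, \<zero>\<^bsub>B\<^esub>, \<zero>\<^bsub>E\<^esub>) | a. True}"
  unfolding homogeneous_relation_def functional_relation_def
  using B.R_parts.part_carrier by auto

text \<open>Over a graded field every constraint that can be met pointwise can be met by a homomorphism:
  an element either has a nonzero multiple in the domain, which forces the value and makes it
  legitimate, or it is independent of the domain.\<close>

lemma graded_field_Hom_extension:
  assumes field: "\<And>c r. r \<in> rpart R c \<Longrightarrow> r \<noteq> \<zero>\<^bsub>R\<^esub> \<Longrightarrow> \<exists>s \<in> rpart R (- c). s \<otimes>\<^bsub>R\<^esub> r = \<one>\<^bsub>R\<^esub>"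
    and \<Gamma>\<^sub>0: "homogeneous_relation R B E \<Gamma>\<^sub>0" "functional_relation B E \<Gamma>\<^sub>0" "\<Gamma>\<^sub>0 \<subseteq> \<Lambda>"
    and \<Lambda>: "homogeneous_relation R B E \<Lambda>" "\<And>a b. b \<in> mpart B a \<Longrightarrow> \<exists>e. (a, b, e) \<in> \<Lambda>"
  shows "\<exists>h \<in> graded_Hom R B E. (\<forall>a b. b \<in> mpart B a \<longrightarrow> (a, b, h b) \<in> \<Lambda>) \<and>
    (\<forall>a b e. (a, b, e) \<in> \<Gamma>\<^sub>0 \<longrightarrow> h b = e)"
proof (rule Hom_extension[OF \<Gamma>\<^sub>0 \<Lambda>(1)])
  fix \<Gamma> a b
  assume \<Gamma>: "homogeneous_relation R B E \<Gamma>" "functional_relation B E \<Gamma>" "\<Gamma> \<subseteq> \<Lambda>" and b: "b \<in> mpart B a"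
  have bc: "b \<in> carrier B" using b B.M_parts.part_carrier by blast
  show "\<exists>e. (a, b, e) \<in> \<Lambda> \<and>
    (\<forall>c r y. r \<in> rpart R c \<longrightarrow> (c + a, r \<odot>\<^bsub>B\<^esub> b, y) \<in> \<Gamma> \<longrightarrow> y = r \<odot>\<^bsub>E\<^esub> e)"
  proof (cases "\<exists>c r y. r \<in> rpart R c \<and> r \<noteq> \<zero>\<^bsub>R\<^esub> \<and> (c + a, r \<odot>\<^bsub>B\<^esub> b, y) \<in> \<Gamma>")
    case True
    then obtain c r y where r: "r \<in> rpart R c" "r \<noteq> \<zero>\<^bsub>R\<^esub>" and y: "(c + a, r \<odot>\<^bsub>B\<^esub> b, y) \<in> \<Gamma>" by blast
    obtain s where s: "s \<in> rpart R (- c)" "s \<otimes>\<^bsub>R\<^esub> r = \<one>\<^bsub>R\<^esub>" using field[OF r] by blast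
    have "(- c + (c + a), s \<odot>\<^bsub>B\<^esub> (r \<odot>\<^bsub>B\<^esub> b), s \<odot>\<^bsub>E\<^esub> y) \<in> \<Gamma>"
      by (rule homogeneous_relationD(5)[OF \<Gamma>(1) s(1) y])
    moreover have "s \<odot>\<^bsub>B\<^esub> (r \<odot>\<^bsub>B\<^esub> b) = b"
      using B.smult_assoc1[of s r b] r s bc B.R_parts.part_carrier by simp
    ultimately have e: "(a, b, s \<odot>\<^bsub>E\<^esub> y) \<in> \<Gamma>" by (simp add: add.assoc[symmetric])
    have "y' = r' \<odot>\<^bsub>E\<^esub> (s \<odot>\<^bsub>E\<^esub> y)" if "r' \<in> rpart R c'" "(c' + a, r' \<odot>\<^bsub>B\<^esub> b, y') \<in> \<Gamma>" for c' r' y'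
      using relation_unique[OF \<Gamma>(1,2) that(2)] homogeneous_relationD(5)[OF \<Gamma>(1) that(1) e] by blast
    with e \<Gamma>(3) show ?thesis by blast
  next
    case False
    obtain e where e: "(a, b, e) \<in> \<Lambda>" using \<Lambda>(2)[OF b] by blast
    have "e \<in> carrier E" using homogeneous_relationD(2)[OF \<Lambda>(1) e] E.M_parts.part_carrier by blast
    moreover have "y = \<zero>\<^bsub>E\<^esub>" if "(d, \<zero>\<^bsub>B\<^esub>, y) \<in> \<Gamma>" for d y
      using that \<Gamma>(2) unfolding functional_relation_def by blast
    ultimately have "y = r \<odot>\<^bsub>E\<^esub> e" if "r \<in> rpart R c" "(c + a, r \<odot>\<^bsub>B\<^esub> b, y) \<in> \<Gamma>" for c r y
      using False that bc by (metis B.smult_l_null E.smult_l_null)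
    with e show ?thesis by blast
  qed
qed

end

text \<open>Baer's condition: homomorphisms from homogeneous ideals, with any shift of degrees, are given by
  multiplication with an element.\<close>

definition graded_Baer :: "('g::ab_group_add, 'r) graded_ring \<Rightarrow> ('g, 'r, 'e) graded_module \<Rightarrow> bool" where
  "graded_Baer R E \<longleftrightarrow> (\<forall>a \<Gamma>. homogeneous_relation R (shift a (regular_module R)) E \<Gamma> \<longrightarrow>
     functional_relation (shift a (regular_module R)) E \<Gamma> \<longrightarrow>
     (\<exists>e \<in> mpart E a. \<forall>c r y. (c, r, y) \<in> \<Gamma> \<longrightarrow> y = r \<odot>\<^bsub>E\<^esub> e))"

lemma shift_simps [simp]:
  "carrier (shift g M) = carrier M" "\<zero>\<^bsub>shift g M\<^esub> = \<zero>\<^bsub>M\<^esub>" "x \<oplus>\<^bsub>shift g M\<^esub> y = x \<oplus>\<^bsub>M\<^esub> y"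
  "r \<odot>\<^bsub>shift g M\<^esub> x = r \<odot>\<^bsub>M\<^esub> x" "mpart (shift g M) a = mpart M (a - g)"
  by (simp_all add: shift_def)

lemma regular_module_simps [simp]:
  "carrier (regular_module R) = carrier R" "\<zero>\<^bsub>regular_module R\<^esub> = \<zero>\<^bsub>R\<^esub>"
  "x \<oplus>\<^bsub>regular_module R\<^esub> y = x \<oplus>\<^bsub>R\<^esub> y" "r \<odot>\<^bsub>regular_module R\<^esub> x = r \<otimes>\<^bsub>R\<^esub> x"
  "mpart (regular_module R) a = rpart R a"
  by (simp_all add: regular_module_def)

text \<open>The scalars that take \<open>b\<close> into the domain of a partial homomorphism make up a homogeneous ideal, and
  multiplication with \<open>b\<close> turns the partial homomorphism into one on this ideal. Baer's condition
  then supplies a compatible value at \<open>b\<close>.\<close>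

lemma (in graded_module_pair) Baer_Hom_extension:
  assumes Baer: "graded_Baer R E"
    and \<Gamma>\<^sub>0: "homogeneous_relation R B E \<Gamma>\<^sub>0" "functional_relation B E \<Gamma>\<^sub>0"
  shows "\<exists>h \<in> graded_Hom R B E. \<forall>a b e. (a, b, e) \<in> \<Gamma>\<^sub>0 \<longrightarrow> h b = e"
proof -
  let ?\<Lambda> = "{(a, b, e). b \<in> mpart B a \<and> e \<in> mpart E a}"
  have "\<exists>h \<in> graded_Hom R B E. (\<forall>a b. b \<in> mpart B a \<longrightarrow> (a, b, h b) \<in> ?\<Lambda>) \<and>
    (\<forall>a b e. (a, b, e) \<in> \<Gamma>\<^sub>0 \<longrightarrow> h b = e)"
  proof (rule Hom_extension[OF \<Gamma>\<^sub>0 _ homogeneous_relation_all])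
    show "\<Gamma>\<^sub>0 \<subseteq> ?\<Lambda>" using homogeneous_relationD(1,2)[OF \<Gamma>\<^sub>0(1)] by blast
    fix \<Gamma> a b
    assume \<Gamma>: "homogeneous_relation R B E \<Gamma>" "functional_relation B E \<Gamma>" and b: "b \<in> mpart B a"
    have bc: "b \<in> carrier B" using b B.M_parts.part_carrier by blast
    note rel = homogeneous_relationD[OF \<Gamma>(1)]
    let ?\<Gamma> = "{(c, r, y). r \<in> rpart R (c - a) \<and> (c, r \<odot>\<^bsub>B\<^esub> b, y) \<in> \<Gamma>}"
    have "homogeneous_relation R (shift a (regular_module R)) E ?\<Gamma>"
      unfolding homogeneous_relation_def
    proof (intro conjI allI impI)
      fix d r e r' e' assume "(d, r, e) \<in> ?\<Gamma>" "(d, r', e') \<in> ?\<Gamma>"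
      then show "(d, r \<oplus>\<^bsub>shift a (regular_module R)\<^esub> r', e \<oplus>\<^bsub>E\<^esub> e') \<in> ?\<Gamma>"
        using rel(4)[of d "r \<odot>\<^bsub>B\<^esub> b" e "r' \<odot>\<^bsub>B\<^esub> b" e'] bc B.R_parts.part_carrier
        by (auto intro: B.R_parts.part_add simp: B.smult_l_distr)
    next
      fix c s d r e assume s: "s \<in> rpart R c" and "(d, r, e) \<in> ?\<Gamma>"
      then show "(c + d, s \<odot>\<^bsub>shift a (regular_module R)\<^esub> r, s \<odot>\<^bsub>E\<^esub> e) \<in> ?\<Gamma>"
        using rel(5)[of s c d "r \<odot>\<^bsub>B\<^esub> b" e] B.mult_degree[of s c r "d - a"] bc B.R_parts.part_carrier
        by (auto simp: B.smult_assoc1 add_diff_eq)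
    qed (use rel(2,3) bc in auto)
    moreover have "functional_relation (shift a (regular_module R)) E ?\<Gamma>"
      using \<Gamma>(2) bc by (auto simp: functional_relation_def)
    ultimately obtain e where e: "e \<in> mpart E a" "\<And>c r y. (c, r, y) \<in> ?\<Gamma> \<Longrightarrow> y = r \<odot>\<^bsub>E\<^esub> e"
      using Baer unfolding graded_Baer_def by blast
    have "y = r \<odot>\<^bsub>E\<^esub> e" if "r \<in> rpart R c" "(c + a, r \<odot>\<^bsub>B\<^esub> b, y) \<in> \<Gamma>" for c r y
      using e(2)[of "c + a" r y] that by simp
    with e(1) b show "\<exists>e. (a, b, e) \<in> ?\<Lambda> \<and>
      (\<forall>c r y. r \<in> rpart R c \<longrightarrow> (c + a, r \<odot>\<^bsub>B\<^esub> b, y) \<in> \<Gamma> \<longrightarrow> y = r \<odot>\<^bsub>E\<^esub> e)"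
      by blast
  qed
  then show ?thesis by blast
qed

text \<open>The graded Baer criterion. For an injection \<open>i\<close> the pairs of \<open>i x\<close> and \<open>f x\<close> constitute a partial
  homomorphism, and an extension of \<open>f\<close> along \<open>i\<close> is a homomorphism that contains it.\<close>

theorem graded_Baer_imp_injective:
  fixes R :: "('g::ab_group_add, 'r) graded_ring"
  assumes E: "graded_module R E" and Baer: "graded_Baer R E"
  shows "graded_injective TYPE('a) TYPE('b) R E"
  unfolding graded_injective_def
proof (intro conjI allI impI E, elim conjE)
  fix A :: "('g, 'r, 'a) graded_module" and B :: "('g, 'r, 'b) graded_module" and i f
  assume A: "graded_module R A" and B: "graded_module R B"
    and i: "i \<in> graded_Hom R A B" "inj_on i (carrier A)" and f: "f \<in> graded_Hom R A E"
  interpret A: graded_module R A by fact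
  interpret graded_module_pair R B E using B E by (simp add: graded_module_pair_def)
  let ?\<Gamma> = "{(a, i x, f x) | a x. x \<in> mpart A a}"
  have i0: "i \<zero>\<^bsub>A\<^esub> = \<zero>\<^bsub>B\<^esub>" and f0: "f \<zero>\<^bsub>A\<^esub> = \<zero>\<^bsub>E\<^esub>"
    by (rule additive_zero[OF graded_module_abelian_group graded_module_abelian_group graded_Hom_additive];
        fact)+
  have mem: "(d, i u, f u) \<in> ?\<Gamma>" if "u \<in> mpart A d" for d u using that by blast
  have "homogeneous_relation R B E ?\<Gamma>"
    unfolding homogeneous_relation_def
  proof (intro conjI allI impI)
    fix d x e x' e' assume "(d, x, e) \<in> ?\<Gamma>" "(d, x', e') \<in> ?\<Gamma>"
    then obtain u v where uv: "u \<in> mpart A d" "v \<in> mpart A d"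
      "x = i u" "e = f u" "x' = i v" "e' = f v" by blast
    then have *: "u \<oplus>\<^bsub>A\<^esub> v \<in> mpart A d" "i (u \<oplus>\<^bsub>A\<^esub> v) = x \<oplus>\<^bsub>B\<^esub> x'" "f (u \<oplus>\<^bsub>A\<^esub> v) = e \<oplus>\<^bsub>E\<^esub> e'"
      using A.M_parts.part_add A.M_parts.part_carrier graded_Hom_add[OF i(1)] graded_Hom_add[OF f] by auto
    from mem[OF *(1)] show "(d, x \<oplus>\<^bsub>B\<^esub> x', e \<oplus>\<^bsub>E\<^esub> e') \<in> ?\<Gamma>" unfolding *(2,3) .
  next
    fix c r d x e assume r: "r \<in> rpart R c" and "(d, x, e) \<in> ?\<Gamma>"
    then obtain u where u: "u \<in> mpart A d" "x = i u" "e = f u" by blast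
    have *: "r \<odot>\<^bsub>A\<^esub> u \<in> mpart A (c + d)" "i (r \<odot>\<^bsub>A\<^esub> u) = r \<odot>\<^bsub>B\<^esub> x" "f (r \<odot>\<^bsub>A\<^esub> u) = r \<odot>\<^bsub>E\<^esub> e"
      using u r A.smult_degree A.M_parts.part_carrier A.R_parts.part_carrier
        graded_Hom_smult[OF i(1)] graded_Hom_smult[OF f] by auto
    from mem[OF *(1)] show "(c + d, r \<odot>\<^bsub>B\<^esub> x, r \<odot>\<^bsub>E\<^esub> e) \<in> ?\<Gamma>" unfolding *(2,3) .
  next
    fix d show "(d, \<zero>\<^bsub>B\<^esub>, \<zero>\<^bsub>E\<^esub>) \<in> ?\<Gamma>" using mem[OF A.M_parts.part_zero] unfolding i0 f0 .
  qed (use graded_Hom_part[OF i(1)] graded_Hom_part[OF f] in auto)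
  moreover have "functional_relation B E ?\<Gamma>"
    unfolding functional_relation_def
  proof (intro allI impI)
    fix a e assume "(a, \<zero>\<^bsub>B\<^esub>, e) \<in> ?\<Gamma>"
    then obtain u where u: "u \<in> mpart A a" "i u = \<zero>\<^bsub>B\<^esub>" "e = f u" by auto
    then have "u = \<zero>\<^bsub>A\<^esub>" using i0 A.M_parts.part_carrier by (intro inj_onD[OF i(2)]) auto
    then show "e = \<zero>\<^bsub>E\<^esub>" using u f0 by simp
  qed
  ultimately obtain h where h: "h \<in> graded_Hom R B E" "\<And>a b e. (a, b, e) \<in> ?\<Gamma> \<Longrightarrow> h b = e"
    using Baer_Hom_extension[OF Baer] by blast
  have "h (i x) = f x" if "x \<in> carrier A" for x
    by (rule A.M_parts.additive_eqI[OF additive_comp[OF graded_Hom_additive[OF i(1)] graded_Hom_additive[OF h(1)]]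
          graded_Hom_additive[OF f] _ that]) (use h(2) in blast)
  with h(1) show "\<exists>h\<in>graded_Hom R B E. \<forall>x\<in>carrier A. h (i x) = f x" by blast
qed

section \<open>Graded modules given by their parts\<close>

lemma (in abelian_group) additive_subgroupI:
  assumes "H \<subseteq> carrier G" "\<zero> \<in> H" "\<And>x y. x \<in> H \<Longrightarrow> y \<in> H \<Longrightarrow> x \<oplus> y \<in> H"
    and inv: "\<And>x. x \<in> H \<Longrightarrow> \<exists>y\<in>H. y \<oplus> x = \<zero>"
  shows "additive_subgroup H G"
proof (intro additive_subgroup.intro add.subgroupI)
  fix x assume x: "x \<in> H"
  then obtain y where "y \<in> H" "y \<oplus> x = \<zero>" using inv by blast
  then show "\<ominus> x \<in> H" using minus_equality x assms(1) by auto
qed (use assms in auto)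

lemma part_sumsI: "finite A \<Longrightarrow> f \<in> Pi A C \<Longrightarrow> finsum M f A \<in> part_sums M C"
  unfolding part_sums_def by blast

text \<open>The properties of a family of subgroups which turn it into the components of a graded module. All
  constructions below, from Hom modules to direct sums, are instances inside a suitable ungraded module.\<close>

locale direct_parts = module R M + graded_ring R
  for R :: "('g::ab_group_add, 'r) graded_ring" (structure) and M :: "('r, 'm) module" (structure) +
  fixes C :: "'g \<Rightarrow> 'm set"
  assumes part_subgroup: "\<And>a. additive_subgroup (C a) M"
    and smult_part: "\<And>a b r x. r \<in> rpart R b \<Longrightarrow> x \<in> C a \<Longrightarrow> r \<odot>\<^bsub>M\<^esub> x \<in> C (b + a)"
    and part_independent: "\<And>A f a. finite A \<Longrightarrow> f \<in> Pi A C \<Longrightarrow> finsum M f A = \<zero>\<^bsub>M\<^esub> \<Longrightarrow> a \<in> A \<Longrightarrow>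
      f a = \<zero>\<^bsub>M\<^esub>"
begin

lemma part_carrier: "x \<in> C a \<Longrightarrow> x \<in> carrier M"
  using additive_subgroup.a_Hcarr[OF part_subgroup] .

lemma part_zero: "\<zero>\<^bsub>M\<^esub> \<in> C a"
  using additive_subgroup.zero_closed[OF part_subgroup] .

lemma part_add: "x \<in> C a \<Longrightarrow> y \<in> C a \<Longrightarrow> x \<oplus>\<^bsub>M\<^esub> y \<in> C a"
  using additive_subgroup.a_closed[OF part_subgroup] .

lemma part_minus: "x \<in> C a \<Longrightarrow> \<ominus>\<^bsub>M\<^esub> x \<in> C a"
  by (simp add: additive_subgroup.a_subgroup part_subgroup subgroup.m_inv_closed a_inv_def)

lemma part_sums_carrier: "x \<in> part_sums M C \<Longrightarrow> x \<in> carrier M"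
  unfolding part_sums_def using part_carrier by (auto intro!: finsum_closed simp: Pi_def)

lemma part_in_part_sums: "x \<in> C a \<Longrightarrow> x \<in> part_sums M C"
  using part_sumsI[of "{a}" "\<lambda>_. x" C M] part_carrier by simp

lemma part_sums_add:
  assumes "x \<in> part_sums M C" "y \<in> part_sums M C"
  shows "x \<oplus>\<^bsub>M\<^esub> y \<in> part_sums M C"
proof -
  obtain A f B g where A: "finite A" "f \<in> Pi A C" "x = finsum M f A"
    and B: "finite B" "g \<in> Pi B C" "y = finsum M g B"
    using assms unfolding part_sums_def by auto
  let ?f = "\<lambda>a. if a \<in> A then f a else \<zero>\<^bsub>M\<^esub>" and ?g = "\<lambda>a. if a \<in> B then g a else \<zero>\<^bsub>M\<^esub>"
  have f: "f \<in> A \<rightarrow> carrier M" and g: "g \<in> B \<rightarrow> carrier M"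
    using A(2) B(2) part_carrier by blast+
  then have fg: "?f \<in> A \<union> B \<rightarrow> carrier M" "?g \<in> A \<union> B \<rightarrow> carrier M" by auto
  have "finsum M f A = finsum M ?f A" "finsum M g B = finsum M ?g B"
    using f g by (auto intro!: M.finsum_cong')
  moreover have "finsum M ?f A = finsum M ?f (A \<union> B)" "finsum M ?g B = finsum M ?g (A \<union> B)"
    using A B fg by (auto intro!: M.finsum_mono_neutral)
  ultimately have "x \<oplus>\<^bsub>M\<^esub> y = (\<Oplus>\<^bsub>M\<^esub>a\<in>A \<union> B. ?f a \<oplus>\<^bsub>M\<^esub> ?g a)"
    using A(3) B(3) M.finsum_addf[OF fg] by simp
  moreover have "(\<lambda>a. ?f a \<oplus>\<^bsub>M\<^esub> ?g a) \<in> Pi (A \<union> B) C"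
    using A(2) B(2) by (auto intro!: part_add part_zero)
  ultimately show ?thesis using A(1) B(1) by (simp only: part_sumsI finite_UnI)
qed

lemma part_sums_induct [consumes 1, case_names homogeneous add]:
  assumes "x \<in> part_sums M C"
    and homogeneous: "\<And>a x. x \<in> C a \<Longrightarrow> P x"
    and add: "\<And>x y. x \<in> part_sums M C \<Longrightarrow> y \<in> part_sums M C \<Longrightarrow> P x \<Longrightarrow> P y \<Longrightarrow> P (x \<oplus>\<^bsub>M\<^esub> y)"
  shows "P x"
proof -
  obtain A f where A: "finite A" "f \<in> Pi A C" "x = finsum M f A"
    using assms(1) unfolding part_sums_def by auto
  have "P (finsum M f A)" using A(1,2)
  proof (induction A)
    case empty
    show ?case using homogeneous[OF part_zero] by simp
  next
    case (insert a A)
    then have *: "f a \<in> C a" "f \<in> Pi A C" "f \<in> A \<rightarrow> carrier M" using part_carrier by auto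
    have "P (f a \<oplus>\<^bsub>M\<^esub> finsum M f A)"
      by (rule add[OF part_in_part_sums[OF *(1)] part_sumsI[OF insert.hyps(1) *(2)]
          homogeneous[OF *(1)] insert.IH[OF *(2)]])
    then show ?case using insert.hyps * part_carrier by (simp add: M.finsum_insert)
  qed
  with A(3) show ?thesis by simp
qed

lemma part_sums_minus: "x \<in> part_sums M C \<Longrightarrow> \<ominus>\<^bsub>M\<^esub> x \<in> part_sums M C"
  by (induction x rule: part_sums_induct)
    (auto simp: M.minus_add part_sums_carrier intro: part_sums_add part_in_part_sums part_minus)

lemma part_sums_smult:
  assumes r: "r \<in> carrier R" and x: "x \<in> part_sums M C"
  shows "r \<odot>\<^bsub>M\<^esub> x \<in> part_sums M C"
proof -
  have "r \<odot>\<^bsub>M\<^esub> x \<in> part_sums M C" if r: "r \<in> carrier R" and x: "x \<in> C a" for r x a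
    using r
    by (induction r rule: R_parts.homogeneous_induct)
      (use x in \<open>auto simp: smult_l_distr part_carrier intro: part_sums_add part_in_part_sums smult_part\<close>)
  note * = this
  from x show ?thesis
    by (induction x rule: part_sums_induct)
      (use * r in \<open>auto simp: smult_r_distr part_sums_carrier intro: part_sums_add\<close>)
qed

lemma module_of_parts_simps [simp]:
  "carrier (module_of_parts M C) = part_sums M C" "\<zero>\<^bsub>module_of_parts M C\<^esub> = \<zero>\<^bsub>M\<^esub>"
  "x \<oplus>\<^bsub>module_of_parts M C\<^esub> y = x \<oplus>\<^bsub>M\<^esub> y" "r \<odot>\<^bsub>module_of_parts M C\<^esub> x = r \<odot>\<^bsub>M\<^esub> x"
  "mpart (module_of_parts M C) = C"
  by (simp_all add: module_of_parts_def)

lemma abelian_group_of_parts: "abelian_group (module_of_parts M C)"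
proof (rule abelian_groupI)
  fix x assume "x \<in> carrier (module_of_parts M C)"
  then show "\<exists>y\<in>carrier (module_of_parts M C). y \<oplus>\<^bsub>module_of_parts M C\<^esub> x = \<zero>\<^bsub>module_of_parts M C\<^esub>"
    using part_sums_minus part_sums_carrier M.l_neg by auto
qed (auto simp: part_sums_carrier M.a_ac intro: part_sums_add part_in_part_sums part_zero)

lemma finsum_of_parts:
  assumes "f \<in> A \<rightarrow> part_sums M C"
  shows "finsum (module_of_parts M C) f A = finsum M f A"
proof -
  interpret P: abelian_group "module_of_parts M C" by (rule abelian_group_of_parts)
  show ?thesis
    using assms
  proof (induction A rule: infinite_finite_induct)
    case (insert a A)
    then have "f \<in> A \<rightarrow> carrier M" "f a \<in> carrier M" using part_sums_carrier by auto
    with insert show ?case by (simp add: M.finsum_insert P.finsum_insert)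
  qed simp_all
qed

theorem graded_module_of_parts: "graded_module R (module_of_parts M C)"
proof -
  interpret P: abelian_group "module_of_parts M C" by (rule abelian_group_of_parts)
  interpret P: module R "module_of_parts M C"
    by (rule moduleI[OF R.is_cring abelian_group_of_parts])
      (auto simp: part_sums_carrier smult_l_distr smult_r_distr smult_assoc1 intro: part_sums_smult)
  have "internal_direct_sum (module_of_parts M C) C"
  proof (rule P.internal_direct_sumI)
    show "additive_subgroup (C a) (module_of_parts M C)" for a
    proof (rule P.additive_subgroupI)
      fix x assume "x \<in> C a"
      then have "\<ominus>\<^bsub>M\<^esub> x \<in> C a" "\<ominus>\<^bsub>M\<^esub> x \<oplus>\<^bsub>M\<^esub> x = \<zero>\<^bsub>M\<^esub>" using part_minus part_carrier M.l_neg by auto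
      then show "\<exists>y\<in>C a. y \<oplus>\<^bsub>module_of_parts M C\<^esub> x = \<zero>\<^bsub>module_of_parts M C\<^esub>" by auto
    qed (auto intro: part_in_part_sums part_zero part_add)
    show "carrier (module_of_parts M C) \<subseteq> part_sums (module_of_parts M C) C"
    proof
      fix x assume "x \<in> carrier (module_of_parts M C)"
      then obtain A f where A: "finite A" "f \<in> Pi A C" "x = finsum M f A"
        unfolding module_of_parts_simps part_sums_def by auto
      have "x = finsum (module_of_parts M C) f A"
        using A part_in_part_sums by (subst finsum_of_parts) auto
      then show "x \<in> part_sums (module_of_parts M C) C" using A by (simp only: part_sumsI)
    qed
    fix A f a assume A: "finite A" "f \<in> Pi A C" "finsum (module_of_parts M C) f A = \<zero>\<^bsub>module_of_parts M C\<^esub>" "a \<in> A"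
    have "finsum M f A = \<zero>\<^bsub>M\<^esub>" using A part_in_part_sums by (subst finsum_of_parts[symmetric]) auto
    with A show "f a = \<zero>\<^bsub>module_of_parts M C\<^esub>" using part_independent by simp
  qed
  then show ?thesis
    by unfold_locales (auto intro: smult_part)
qed

end

lemma prod_module_simps [simp]:
  "carrier (prod_module I N) = (\<Pi>\<^sub>E i\<in>I. carrier (N i))" "\<zero>\<^bsub>prod_module I N\<^esub> = (\<lambda>i\<in>I. \<zero>\<^bsub>N i\<^esub>)"
  "x \<oplus>\<^bsub>prod_module I N\<^esub> y = (\<lambda>i\<in>I. x i \<oplus>\<^bsub>N i\<^esub> y i)" "r \<odot>\<^bsub>prod_module I N\<^esub> x = (\<lambda>i\<in>I. r \<odot>\<^bsub>N i\<^esub> x i)"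
  by (simp_all add: prod_module_def)

lemma module_prod_module:
  assumes R: "cring R" and N: "\<And>i. i \<in> I \<Longrightarrow> module R (N i)"
  shows "module R (prod_module I N)"
proof -
  have ab: "abelian_group (N i)" if "i \<in> I" for i using N[OF that] by (simp add: module_def)
  note [simp] = abelian_groupE(1,2,5)[OF ab] module.smult_closed[OF N] module.smult_l_distr[OF N]
    module.smult_r_distr[OF N] module.smult_assoc1[OF N] module.smult_one[OF N]
  have car: "x i \<in> carrier (N i)" if "x \<in> (\<Pi>\<^sub>E i\<in>I. carrier (N i))" "i \<in> I" for x i using that by auto
  show ?thesis
  proof (rule moduleI[OF R])
    show "abelian_group (prod_module I N)"
    proof (rule abelian_groupI)
      fix x y z assume xyz: "x \<in> carrier (prod_module I N)" "y \<in> carrier (prod_module I N)" "z \<in> carrier (prod_module I N)"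
      show "x \<oplus>\<^bsub>prod_module I N\<^esub> y \<oplus>\<^bsub>prod_module I N\<^esub> z = x \<oplus>\<^bsub>prod_module I N\<^esub> (y \<oplus>\<^bsub>prod_module I N\<^esub> z)"
        using xyz by (auto simp: car intro!: restrict_ext abelian_groupE(3)[OF ab])
    next
      fix x assume x: "x \<in> carrier (prod_module I N)"
      show "\<exists>y\<in>carrier (prod_module I N). y \<oplus>\<^bsub>prod_module I N\<^esub> x = \<zero>\<^bsub>prod_module I N\<^esub>"
      proof
        show "(\<lambda>i\<in>I. \<ominus>\<^bsub>N i\<^esub> x i) \<in> carrier (prod_module I N)"
          using x by (auto simp: abelian_group.a_inv_closed[OF ab] car)
        show "(\<lambda>i\<in>I. \<ominus>\<^bsub>N i\<^esub> x i) \<oplus>\<^bsub>prod_module I N\<^esub> x = \<zero>\<^bsub>prod_module I N\<^esub>"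
          using x by (auto simp: abelian_group.l_neg[OF ab] car intro!: restrict_ext)
      qed
      show "\<zero>\<^bsub>prod_module I N\<^esub> \<oplus>\<^bsub>prod_module I N\<^esub> x = x"
        using x by (intro ext) (simp add: car PiE_arb[of x I "\<lambda>i. carrier (N i)"])
    next
      fix x y assume xy: "x \<in> carrier (prod_module I N)" "y \<in> carrier (prod_module I N)"
      show "x \<oplus>\<^bsub>prod_module I N\<^esub> y = y \<oplus>\<^bsub>prod_module I N\<^esub> x"
        using xy by (auto simp: car intro!: restrict_ext abelian_groupE(4)[OF ab])
    qed (auto intro: abelian_groupE(1)[OF ab])
  next
    fix x assume x: "x \<in> carrier (prod_module I N)"
    show "\<one>\<^bsub>R\<^esub> \<odot>\<^bsub>prod_module I N\<^esub> x = x"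
      using x by (intro ext) (simp add: car PiE_arb[of x I "\<lambda>i. carrier (N i)"])
  qed (auto simp: car intro!: restrict_ext intro: module.smult_closed[OF N])
qed

lemma additive_evaluation:
  assumes "\<And>i. i \<in> I \<Longrightarrow> abelian_group (N i)" "i \<in> I"
  shows "(\<lambda>x. x i) \<in> additive_maps (prod_module I N) (N i)"
  using assms by (intro additive_mapsI) auto

section \<open>Modules of linear maps\<close>

lemma graded_module_module: "graded_module R M \<Longrightarrow> module R M"
  by (simp add: graded_module_def)

lemma linear_maps_closed: "f \<in> linear_maps K V N \<Longrightarrow> v \<in> carrier V \<Longrightarrow> f v \<in> carrier N"
  by (rule additive_closed[OF linear_maps_additive])

lemma linear_maps_add:
  "f \<in> linear_maps K V N \<Longrightarrow> v \<in> carrier V \<Longrightarrow> w \<in> carrier V \<Longrightarrow> f (v \<oplus>\<^bsub>V\<^esub> w) = f v \<oplus>\<^bsub>N\<^esub> f w"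
  by (rule additive_add[OF linear_maps_additive])

text \<open>Both \<open>hom\<^sub>R(M, N)\<close> and \<open>Hom\<^sub>k(V, N)\<close> consist of linear maps whose degree can be read off from
  the values at certain vectors. The pair \<open>(b, v)\<close> stands for a test vector \<open>v\<close> of degree \<open>b\<close>.\<close>

definition linear_maps_of_degree ::
  "('r, 'z) ring_scheme \<Rightarrow> ('r, 'v, 'y) module_scheme \<Rightarrow> ('g::ab_group_add, 'r, 'n) graded_module
     \<Rightarrow> ('g \<times> 'v) set \<Rightarrow> 'g \<Rightarrow> ('v \<Rightarrow> 'n) set" where
  "linear_maps_of_degree K V N J a =
     {f \<in> linear_maps K V N. \<forall>b v. (b, v) \<in> J \<longrightarrow> f v \<in> mpart N (a + b)}"

lemma direct_parts_linear_maps: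
  fixes R :: "('g::ab_group_add, 'r) graded_ring"
  assumes N: "graded_module R N" and K: "carrier K \<subseteq> carrier R"
    and V_add: "\<And>v w. v \<in> carrier V \<Longrightarrow> w \<in> carrier V \<Longrightarrow> v \<oplus>\<^bsub>V\<^esub> w \<in> carrier V"
    and V_smult: "\<And>c v. c \<in> carrier K \<Longrightarrow> v \<in> carrier V \<Longrightarrow> c \<odot>\<^bsub>V\<^esub> v \<in> carrier V"
    and J: "\<And>b v. (b, v) \<in> J \<Longrightarrow> v \<in> carrier V"
    and test: "\<And>f v. f \<in> linear_maps K V N \<Longrightarrow> (\<And>b v. (b, v) \<in> J \<Longrightarrow> f v = \<zero>\<^bsub>N\<^esub>) \<Longrightarrow>
      v \<in> carrier V \<Longrightarrow> f v = \<zero>\<^bsub>N\<^esub>"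
  shows "direct_parts R (prod_module (carrier V) (\<lambda>_. N)) (linear_maps_of_degree K V N J)"
proof -
  interpret N: graded_module R N by fact
  let ?P = "prod_module (carrier V) (\<lambda>_. N)"
  interpret P: module R ?P
    by (rule module_prod_module) (use N.is_cring graded_module_module[OF N] in auto)
  have Kc: "c \<in> carrier R" if "c \<in> carrier K" for c using K that by blast
  have add: "f \<oplus>\<^bsub>?P\<^esub> g \<in> linear_maps K V N" if f: "f \<in> linear_maps K V N" and g: "g \<in> linear_maps K V N" for f g
  proof (intro linear_mapsI additive_mapsI)
    fix c x assume "c \<in> carrier K" "x \<in> carrier V"
    then show "(f \<oplus>\<^bsub>?P\<^esub> g) (c \<odot>\<^bsub>V\<^esub> x) = c \<odot>\<^bsub>N\<^esub> (f \<oplus>\<^bsub>?P\<^esub> g) x"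
      by (simp add: V_smult linear_maps_smult[OF f] linear_maps_smult[OF g] N.smult_r_distr Kc
          linear_maps_closed[OF f] linear_maps_closed[OF g])
  qed (simp_all add: V_add linear_maps_closed[OF f] linear_maps_closed[OF g] linear_maps_add[OF f]
      linear_maps_add[OF g] N.M.a_ac)
  have smult: "r \<odot>\<^bsub>?P\<^esub> f \<in> linear_maps K V N" if r: "r \<in> carrier R" and f: "f \<in> linear_maps K V N" for r f
  proof (intro linear_mapsI additive_mapsI)
    fix c x assume "c \<in> carrier K" "x \<in> carrier V"
    then show "(r \<odot>\<^bsub>?P\<^esub> f) (c \<odot>\<^bsub>V\<^esub> x) = c \<odot>\<^bsub>N\<^esub> (r \<odot>\<^bsub>?P\<^esub> f) x"
      using N.smult_assoc1[of r c "f x"] N.smult_assoc1[of c r "f x"] N.m_comm[of r c]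
      by (simp add: V_smult linear_maps_smult[OF f] Kc r linear_maps_closed[OF f])
  qed (simp_all add: V_add linear_maps_closed[OF f] linear_maps_add[OF f] N.smult_r_distr r)
  have zero: "\<zero>\<^bsub>?P\<^esub> \<in> linear_maps K V N"
    by (intro linear_mapsI additive_mapsI) (simp_all add: V_add V_smult Kc)
  have car: "f \<in> carrier ?P" if "f \<in> linear_maps K V N" for f
    using that by (auto simp: linear_maps_def)
  note [simp] = linear_maps_of_degree_def
  show ?thesis
  proof (intro direct_parts.intro direct_parts_axioms.intro P.module_axioms N.graded_ring_axioms)
    fix a
    show "additive_subgroup (linear_maps_of_degree K V N J a) ?P"
    proof (rule P.M.additive_subgroupI)
      show "linear_maps_of_degree K V N J a \<subseteq> carrier ?P" using car by auto
      show "\<zero>\<^bsub>?P\<^esub> \<in> linear_maps_of_degree K V N J a" using zero J by auto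
    next
      fix f g assume "f \<in> linear_maps_of_degree K V N J a" "g \<in> linear_maps_of_degree K V N J a"
      then show "f \<oplus>\<^bsub>?P\<^esub> g \<in> linear_maps_of_degree K V N J a"
        using add[of f g] J by (auto intro: N.M_parts.part_add)
    next
      fix f assume f: "f \<in> linear_maps_of_degree K V N J a"
      let ?m = "(\<ominus>\<^bsub>R\<^esub> \<one>\<^bsub>R\<^esub>) \<odot>\<^bsub>?P\<^esub> f"
      have fl: "f \<in> linear_maps K V N" using f by simp
      have "(\<ominus>\<^bsub>R\<^esub> \<one>\<^bsub>R\<^esub>) \<odot>\<^bsub>N\<^esub> f v \<in> mpart N (a + b)" if "(b, v) \<in> J" for b v
        using N.smult_degree[OF N.R_parts.part_minus[OF N.one_part], of "f v" "a + b"] f that by simp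
      then have "?m \<in> linear_maps_of_degree K V N J a" using smult[OF _ fl] J by simp
      moreover have "?m \<oplus>\<^bsub>?P\<^esub> f = \<zero>\<^bsub>?P\<^esub>"
        using car[OF fl] P.smult_l_minus[of "\<one>\<^bsub>R\<^esub>" f] P.M.l_neg[of f] by (simp only: P.smult_one N.one_closed)
      ultimately show "\<exists>g\<in>linear_maps_of_degree K V N J a. g \<oplus>\<^bsub>?P\<^esub> f = \<zero>\<^bsub>?P\<^esub>" by blast
    qed
  next
    fix a b r f assume r: "r \<in> rpart R b" and f: "f \<in> linear_maps_of_degree K V N J a"
    have "r \<odot>\<^bsub>N\<^esub> f v \<in> mpart N (b + a + c)" if "(c, v) \<in> J" for c v
      using N.smult_degree[OF r, of "f v" "a + c"] f that by (simp add: add.assoc)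
    then show "r \<odot>\<^bsub>?P\<^esub> f \<in> linear_maps_of_degree K V N J (b + a)"
      using f smult[OF N.R_parts.part_carrier[OF r], of f] J by simp
  next
    fix A f a assume A: "finite A" "f \<in> Pi A (linear_maps_of_degree K V N J)" "finsum ?P f A = \<zero>\<^bsub>?P\<^esub>" "a \<in> A"
    show "f a = \<zero>\<^bsub>?P\<^esub>"
    proof (rule independent_by_maps[where T = "\<lambda>_. N" and D = "\<lambda>_. mpart N" and J = J
          and \<pi> = "\<lambda>(b, v) f. f v" and s = fst and C = "linear_maps_of_degree K V N J"])
      show "direct_decomposition N (mpart N)" by (rule N.M_parts.direct_decomposition_axioms)
      show "(case j of (b, v) \<Rightarrow> \<lambda>f. f v) \<in> additive_maps ?P N" if "j \<in> J" for j
      proof -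
        obtain b v where j: "j = (b, v)" by (cases j)
        have "(\<lambda>f. f v) \<in> additive_maps ?P N"
          by (rule additive_evaluation) (use that J j N.M.abelian_group_axioms in auto)
        then show ?thesis using j by simp
      qed
      show "(case j of (b, v) \<Rightarrow> \<lambda>f. f v) x \<in> mpart N (c + fst j)"
        if "j \<in> J" "x \<in> linear_maps_of_degree K V N J c" for j c x
        using that by (cases j) auto
      show "x = \<zero>\<^bsub>?P\<^esub>" if x: "x \<in> linear_maps_of_degree K V N J c"
        and 0: "\<And>j. j \<in> J \<Longrightarrow> (case j of (b, v) \<Rightarrow> \<lambda>f. f v) x = \<zero>\<^bsub>N\<^esub>" for c x
      proof (rule linear_maps_eqI)
        show xl: "x \<in> linear_maps K V N" using x by simp
        show "x v = \<zero>\<^bsub>?P\<^esub> v" if "v \<in> carrier V" for v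
          using test[OF xl _ that] 0 that by fastforce
      qed (rule zero)
    qed (use A car P.M.abelian_group_axioms in auto)
  qed
qed

lemma hom_module_simps [simp]:
  "\<zero>\<^bsub>hom_module R M N\<^esub> = (\<lambda>x\<in>carrier M. \<zero>\<^bsub>N\<^esub>)"
  "f \<oplus>\<^bsub>hom_module R M N\<^esub> g = (\<lambda>x\<in>carrier M. f x \<oplus>\<^bsub>N\<^esub> g x)"
  "r \<odot>\<^bsub>hom_module R M N\<^esub> f = (\<lambda>x\<in>carrier M. r \<odot>\<^bsub>N\<^esub> f x)"
  "mpart (hom_module R M N) a = graded_Hom R (shift a M) N"
  by (simp_all add: hom_module_def module_of_parts_def prod_module_def)

lemma graded_Hom_shift:
  "f \<in> graded_Hom R (shift a M) N \<longleftrightarrow> f \<in> linear_maps R M N \<and> (\<forall>b. \<forall>x \<in> mpart M b. f x \<in> mpart N (a + b))"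
proof -
  have "linear_maps R (shift a M) N = linear_maps R M N" by (simp add: linear_maps_def)
  moreover have "(\<forall>c. f ` mpart M (c - a) \<subseteq> mpart N c) \<longleftrightarrow> (\<forall>b. \<forall>x \<in> mpart M b. f x \<in> mpart N (a + b))"
  proof (intro iffI allI ballI)
    fix b x assume "\<forall>c. f ` mpart M (c - a) \<subseteq> mpart N c" and x: "x \<in> mpart M b"
    then have "f ` mpart M (a + b - a) \<subseteq> mpart N (a + b)" by blast
    with x show "f x \<in> mpart N (a + b)" by auto
  next
    fix c assume *: "\<forall>b. \<forall>x \<in> mpart M b. f x \<in> mpart N (a + b)"
    have "f x \<in> mpart N c" if "x \<in> mpart M (c - a)" for x
    proof -
      have "f x \<in> mpart N (a + (c - a))" using * that by blast
      then show ?thesis by (simp add: add.commute)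
    qed
    then show "f ` mpart M (c - a) \<subseteq> mpart N c" by blast
  qed
  ultimately show ?thesis by (simp add: graded_Hom_def)
qed

lemma hom_module_parts:
  assumes M: "graded_module R M" and N: "graded_module R N"
  shows "direct_parts R (prod_module (carrier M) (\<lambda>_. N)) (\<lambda>a. graded_Hom R (shift a M) N)"
proof -
  interpret M: graded_module R M by fact
  let ?J = "{(b, x). x \<in> mpart M b}"
  have "graded_Hom R (shift a M) N = linear_maps_of_degree R M N ?J a" for a
    by (auto simp: graded_Hom_shift linear_maps_of_degree_def)
  moreover have "direct_parts R (prod_module (carrier M) (\<lambda>_. N)) (linear_maps_of_degree R M N ?J)"
  proof (rule direct_parts_linear_maps[OF N])
    fix f v assume f: "f \<in> linear_maps R M N" and 0: "\<And>b v. (b, v) \<in> ?J \<Longrightarrow> f v = \<zero>\<^bsub>N\<^esub>" and v: "v \<in> carrier M"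
    have "(\<lambda>_. \<zero>\<^bsub>N\<^esub>) \<in> additive_maps M N"
      using graded_module_abelian_group[OF N] by (intro additive_mapsI) (auto simp: abelian_groupE)
    from M.M_parts.additive_eqI[OF linear_maps_additive[OF f] this _ v]
    show "f v = \<zero>\<^bsub>N\<^esub>" using 0 by blast
  qed (use M.M_parts.part_carrier in auto)
  ultimately show ?thesis by presburger
qed

lemma graded_module_hom_module:
  assumes "graded_module R M" "graded_module R N"
  shows "graded_module R (hom_module R M N)"
  unfolding hom_module_def by (rule direct_parts.graded_module_of_parts[OF hom_module_parts[OF assms]])

lemma component_simps [simp]:
  "carrier (component M g) = mpart M g" "\<zero>\<^bsub>component M g\<^esub> = \<zero>\<^bsub>M\<^esub>"
  "x \<oplus>\<^bsub>component M g\<^esub> y = x \<oplus>\<^bsub>M\<^esub> y" "r \<odot>\<^bsub>component M g\<^esub> x = r \<odot>\<^bsub>M\<^esub> x"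
  by (simp_all add: component_def)

lemma graded_vector_hom_simps [simp]:
  "\<zero>\<^bsub>graded_vector_hom K V N\<^esub> = (\<lambda>x\<in>carrier V. \<zero>\<^bsub>N\<^esub>)"
  "f \<oplus>\<^bsub>graded_vector_hom K V N\<^esub> g = (\<lambda>x\<in>carrier V. f x \<oplus>\<^bsub>N\<^esub> g x)"
  "r \<odot>\<^bsub>graded_vector_hom K V N\<^esub> f = (\<lambda>x\<in>carrier V. r \<odot>\<^bsub>N\<^esub> f x)"
  "mpart (graded_vector_hom K V N) a = linear_maps K V (component N a)"
  by (simp_all add: graded_vector_hom_def module_of_parts_def prod_module_def)

lemma graded_module_vector_hom:
  assumes N: "graded_module R N" and K: "carrier K \<subseteq> carrier R"
    and V: "\<And>v w. v \<in> carrier V \<Longrightarrow> w \<in> carrier V \<Longrightarrow> v \<oplus>\<^bsub>V\<^esub> w \<in> carrier V"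
      "\<And>c v. c \<in> carrier K \<Longrightarrow> v \<in> carrier V \<Longrightarrow> c \<odot>\<^bsub>V\<^esub> v \<in> carrier V"
  shows "graded_module R (graded_vector_hom K V N)"
proof -
  interpret N: graded_module R N by fact
  let ?J = "{0} \<times> carrier V"
  have "linear_maps K V (component N a) = linear_maps_of_degree K V N ?J a" for a
    using N.M_parts.part_carrier
    by (fastforce simp: linear_maps_def linear_maps_of_degree_def PiE_iff)
  moreover have "direct_parts R (prod_module (carrier V) (\<lambda>_. N)) (linear_maps_of_degree K V N ?J)"
    by (rule direct_parts_linear_maps[OF N K V]) auto
  ultimately have "direct_parts R (prod_module (carrier V) (\<lambda>_. N)) (\<lambda>a. linear_maps K V (component N a))"
    by presburger
  then show ?thesis unfolding graded_vector_hom_def by (rule direct_parts.graded_module_of_parts)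
qed

lemma graded_product_simps [simp]:
  "\<zero>\<^bsub>graded_product N\<^esub> = (\<lambda>i. \<zero>\<^bsub>N i\<^esub>)" "x \<oplus>\<^bsub>graded_product N\<^esub> y = (\<lambda>i. x i \<oplus>\<^bsub>N i\<^esub> y i)"
  "r \<odot>\<^bsub>graded_product N\<^esub> x = (\<lambda>i. r \<odot>\<^bsub>N i\<^esub> x i)"
  "mpart (graded_product N) a = {x. \<forall>i. x i \<in> mpart (N i) a}"
  by (simp_all add: restrict_UNIV graded_product_def module_of_parts_def prod_module_def)

lemma direct_parts_product:
  fixes R :: "('g::ab_group_add, 'r) graded_ring"
  assumes R: "graded_ring R" and N: "\<And>i. graded_module R (N i)"
  shows "direct_parts R (prod_module UNIV N) (\<lambda>a. {x. \<forall>i. x i \<in> mpart (N i) a})"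
proof -
  let ?P = "prod_module UNIV N" and ?C = "\<lambda>a. {x. \<forall>i. x i \<in> mpart (N i) a}"
  interpret R: graded_ring R by fact
  have dec: "direct_decomposition (N i) (mpart (N i))" for i
    using graded_module.axioms(3)[OF N] graded_module_abelian_group[OF N]
    by (simp add: graded_module_axioms_def direct_decomposition_def direct_decomposition_axioms_def)
  note parts = direct_decomposition.part_carrier[OF dec] direct_decomposition.part_zero[OF dec]
    direct_decomposition.part_add[OF dec] direct_decomposition.part_minus[OF dec]
  interpret P: module R ?P
    by (rule module_prod_module) (use R.is_cring graded_module_module[OF N] in auto)
  show ?thesis
  proof (intro direct_parts.intro direct_parts_axioms.intro P.module_axioms R)
    fix a
    show "additive_subgroup (?C a) ?P"
    proof (rule P.M.additive_subgroupI)
      fix x assume x: "x \<in> ?C a"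
      then have "(\<lambda>i. \<ominus>\<^bsub>N i\<^esub> x i) \<in> ?C a" by (auto intro: parts)
      moreover have "(\<lambda>i. \<ominus>\<^bsub>N i\<^esub> x i) \<oplus>\<^bsub>?P\<^esub> x = \<zero>\<^bsub>?P\<^esub>"
        using x by (auto simp: fun_eq_iff intro!: abelian_group.l_neg[OF graded_module_abelian_group[OF N]] parts)
      ultimately show "\<exists>y\<in>?C a. y \<oplus>\<^bsub>?P\<^esub> x = \<zero>\<^bsub>?P\<^esub>" by blast
    qed (auto intro: parts)
  next
    fix a b r x assume "r \<in> rpart R b" "x \<in> ?C a"
    then show "r \<odot>\<^bsub>?P\<^esub> x \<in> ?C (b + a)"
      using graded_module.smult_degree[OF N] by auto
  next
    fix A f a assume A: "finite A" "f \<in> Pi A ?C" "finsum ?P f A = \<zero>\<^bsub>?P\<^esub>" "a \<in> A"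
    show "f a = \<zero>\<^bsub>?P\<^esub>"
    proof (rule independent_by_maps[where T = N and D = "\<lambda>i. mpart (N i)" and J = UNIV
          and \<pi> = "\<lambda>i x. x i" and s = "\<lambda>_. 0" and C = ?C])
      show "(\<lambda>x. x i) \<in> additive_maps ?P (N i)" for i
        by (rule additive_evaluation) (auto intro: graded_module_abelian_group N)
      show "?C b \<subseteq> carrier ?P" for b using parts(1) by (auto simp: PiE_UNIV_domain)
    qed (use A dec P.M.abelian_group_axioms in auto)
  qed
qed

lemma graded_module_product:
  fixes R :: "('g::ab_group_add, 'r) graded_ring"
  assumes "graded_ring R" "\<And>i. graded_module R (N i)"
  shows "graded_module R (graded_product N)"
  unfolding graded_product_def by (rule direct_parts.graded_module_of_parts[OF direct_parts_product[OF assms]])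

lemma graded_module_shift:
  assumes "graded_module R M"
  shows "graded_module R (shift a M)"
proof -
  interpret M: graded_module R M by fact
  have add: "add_monoid (shift a M) = add_monoid M" by (simp add: shift_def)
  have S: "abelian_group (shift a M)"
    using M.M.abelian_group_axioms
    unfolding abelian_group_def abelian_monoid_def abelian_group_axioms_def add .
  have "internal_direct_sum M (\<lambda>b. mpart M (b - a))"
  proof (rule M.M.internal_direct_sumI)
    show "additive_subgroup (mpart M (b - a)) M" for b by (rule M.M_parts.part_subgroup)
    show "carrier M \<subseteq> part_sums M (\<lambda>b. mpart M (b - a))"
    proof
      fix x assume x: "x \<in> carrier M"
      let ?A = "{b. M.M_parts.hcomp x b \<noteq> \<zero>\<^bsub>M\<^esub>}" and ?f = "\<lambda>b. M.M_parts.hcomp x (b - a)"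
      have "finsum M ?f ((\<lambda>b. b + a) ` ?A) = (\<Oplus>\<^bsub>M\<^esub>b\<in>?A. M.M_parts.hcomp x b)"
        using x by (subst M.M.finsum_reindex) (auto simp: inj_on_def)
      moreover have "finsum M ?f ((\<lambda>b. b + a) ` ?A) \<in> part_sums M (\<lambda>b. mpart M (b - a))"
        using x M.M_parts.hcomp_finite M.M_parts.hcomp_part by (intro part_sumsI) auto
      ultimately show "x \<in> part_sums M (\<lambda>b. mpart M (b - a))"
        using M.M_parts.hcomp_sum[OF x] by simp
    qed
    fix A f b
    assume A: "finite A" "f \<in> Pi A (\<lambda>b. mpart M (b - a))" "finsum M f A = \<zero>\<^bsub>M\<^esub>" "b \<in> A"
    show "f b = \<zero>\<^bsub>M\<^esub>"
      by (rule independent_by_maps[where T = "\<lambda>_. M" and D = "\<lambda>_. mpart M" and J = "{()}"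
            and \<pi> = "\<lambda>_ x. x" and s = "\<lambda>_. - a", OF M.M.abelian_group_axioms _ _ _ _ _ A])
        (auto intro: M.M_parts.direct_decomposition_axioms additive_mapsI M.M_parts.part_carrier)
  qed
  then have "internal_direct_sum (shift a M) (mpart (shift a M))"
    unfolding internal_direct_sum_def additive_subgroup_def finsum_def add shift_simps .
  moreover have "module R (shift a M)"
    by (rule moduleI[OF M.is_cring S]) (auto simp: M.smult_l_distr M.smult_r_distr M.smult_assoc1)
  moreover have "r \<odot>\<^bsub>M\<^esub> x \<in> mpart M (b + c - a)" if "r \<in> rpart R b" "x \<in> mpart M (c - a)" for r x b c
    using M.smult_degree[OF that] by (simp add: add_diff_eq)
  ultimately show ?thesis
    using M.graded_ring_axioms by (simp add: graded_module_def graded_module_axioms_def)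
qed

lemma (in graded_ring) graded_module_regular: "graded_module R (regular_module R)"
proof -
  let ?M = "regular_module R"
  interpret M: abelian_group ?M
  proof (rule abelian_groupI)
    fix x assume "x \<in> carrier ?M"
    then show "\<exists>y\<in>carrier ?M. y \<oplus>\<^bsub>?M\<^esub> x = \<zero>\<^bsub>?M\<^esub>" using l_neg by (intro bexI[of _ "\<ominus> x"]) auto
  qed (auto simp: a_ac)
  have id: "(\<lambda>x. x) \<in> additive_maps R ?M" "(\<lambda>x. x) \<in> additive_maps ?M R"
    by (rule additive_mapsI; simp)+
  have "internal_direct_sum ?M (rpart R)"
  proof (rule M.internal_direct_sumI)
    fix a show "additive_subgroup (rpart R a) ?M"
    proof (rule M.additive_subgroupI)
      fix x assume "x \<in> rpart R a"
      then have "\<ominus> x \<in> rpart R a" "\<ominus> x \<oplus> x = \<zero>" using R_parts.part_minus R_parts.part_carrier l_neg by auto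
      then show "\<exists>y\<in>rpart R a. y \<oplus>\<^bsub>?M\<^esub> x = \<zero>\<^bsub>?M\<^esub>" by auto
    qed (auto intro: R_parts.part_add R_parts.part_carrier)
  next
    show "carrier ?M \<subseteq> part_sums ?M (rpart R)"
    proof
      fix x assume x: "x \<in> carrier ?M"
      let ?A = "{a. R_parts.hcomp x a \<noteq> \<zero>}"
      have "x = (\<Oplus>\<^bsub>?M\<^esub>a\<in>?A. R_parts.hcomp x a)"
        using additive_finsum[OF abelian_group_axioms M.abelian_group_axioms id(1), of "R_parts.hcomp x" ?A]
          R_parts.hcomp_sum x by simp
      also have "\<dots> \<in> part_sums ?M (rpart R)"
        using x R_parts.hcomp_finite R_parts.hcomp_part by (intro part_sumsI) auto
      finally show "x \<in> part_sums ?M (rpart R)" .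
    qed
  next
    fix A f a
    assume A: "finite A" "f \<in> Pi A (rpart R)" "finsum ?M f A = \<zero>\<^bsub>?M\<^esub>" "a \<in> A"
    show "f a = \<zero>\<^bsub>?M\<^esub>"
      by (rule independent_by_maps[where T = "\<lambda>_. R" and D = "\<lambda>_. rpart R" and J = "{()}"
            and \<pi> = "\<lambda>_ x. x" and s = "\<lambda>_. 0", OF M.abelian_group_axioms _ _ _ _ _ A])
        (rule R_parts.direct_decomposition_axioms id(2) | simp add: R_parts.part_carrier subsetI)+
  qed
  moreover have "mpart ?M = rpart R" by (simp add: regular_module_def)
  ultimately have "internal_direct_sum ?M (mpart ?M)" by simp
  moreover have "module R (regular_module R)"
    by (rule moduleI[OF is_cring M.abelian_group_axioms]) (auto simp: l_distr r_distr m_assoc)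
  ultimately show ?thesis
    using graded_ring_axioms mult_degree by (simp add: graded_module_def graded_module_axioms_def)
qed

section \<open>Modules over the degree-zero part\<close>

text \<open>The ring \<open>R\<^sub>0\<close>, concentrated in degree zero. Every graded \<open>R\<close>-module is a graded module over it, and
  this allows linear algebra over \<open>R\<^sub>0\<close> to be done in all degrees at once.\<close>

definition degree_zero_graded :: "('g::ab_group_add, 'r) graded_ring \<Rightarrow> ('g, 'r) graded_ring" where
  "degree_zero_graded R = R\<lparr>carrier := rpart R 0, rpart := \<lambda>a. if a = 0 then rpart R 0 else {\<zero>\<^bsub>R\<^esub>}\<rparr>"

lemma degree_zero_simps [simp]:
  "carrier (degree_zero_graded R) = rpart R 0" "\<zero>\<^bsub>degree_zero_graded R\<^esub> = \<zero>\<^bsub>R\<^esub>"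
  "\<one>\<^bsub>degree_zero_graded R\<^esub> = \<one>\<^bsub>R\<^esub>" "x \<oplus>\<^bsub>degree_zero_graded R\<^esub> y = x \<oplus>\<^bsub>R\<^esub> y"
  "x \<otimes>\<^bsub>degree_zero_graded R\<^esub> y = x \<otimes>\<^bsub>R\<^esub> y"
  "rpart (degree_zero_graded R) a = (if a = 0 then rpart R 0 else {\<zero>\<^bsub>R\<^esub>})"
  "carrier (degree_zero_ring R) = rpart R 0"
  by (simp_all add: degree_zero_graded_def degree_zero_ring_def)

lemma (in graded_ring) mult_degree_zero:
  "r \<in> rpart R 0 \<Longrightarrow> s \<in> rpart R 0 \<Longrightarrow> r \<otimes> s \<in> rpart R 0"
  using mult_degree[of r 0 s 0] by simp

lemma graded_ring_degree_zero:
  fixes R :: "('g::ab_group_add, 'r) graded_ring" (structure)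
  assumes "graded_ring R"
  shows "graded_ring (degree_zero_graded R)"
proof -
  interpret graded_ring R by fact
  let ?K = "degree_zero_graded R"
  note [simp] = R_parts.part_carrier[of _ 0]
  interpret K: abelian_group ?K
  proof (rule abelian_groupI)
    fix x assume "x \<in> carrier ?K"
    then have "\<ominus> x \<in> rpart R 0" "\<ominus> x \<oplus> x = \<zero>" using R_parts.part_minus l_neg by auto
    then show "\<exists>y\<in>carrier ?K. y \<oplus>\<^bsub>?K\<^esub> x = \<zero>\<^bsub>?K\<^esub>" by auto
  qed (auto intro: R_parts.part_add simp: a_ac)
  have id: "(\<lambda>x. x) \<in> additive_maps ?K R" by (rule additive_mapsI; simp)
  have "comm_monoid ?K"
    by (rule comm_monoidI) (auto intro: one_part mult_degree_zero m_comm m_assoc)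
  then have "cring ?K"
    by (rule cringI[OF K.abelian_group_axioms]) (auto simp: l_distr)
  moreover have "internal_direct_sum ?K (rpart ?K)"
  proof (rule K.internal_direct_sumI)
    fix a show "additive_subgroup (rpart ?K a) ?K"
    proof (rule K.additive_subgroupI)
      fix x assume "x \<in> rpart ?K a"
      then have "\<ominus> x \<in> rpart ?K a" "\<ominus> x \<oplus> x = \<zero>"
        using R_parts.part_minus l_neg by (auto split: if_splits)
      then show "\<exists>y\<in>rpart ?K a. y \<oplus>\<^bsub>?K\<^esub> x = \<zero>\<^bsub>?K\<^esub>" by (intro bexI) auto
    qed (auto intro: R_parts.part_add split: if_splits)
  next
    show "carrier ?K \<subseteq> part_sums ?K (rpart ?K)"
    proof
      fix x assume x: "x \<in> carrier ?K"
      then have "x = (\<Oplus>\<^bsub>?K\<^esub>a\<in>{0::'g}. x)" by simp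
      moreover have "(\<Oplus>\<^bsub>?K\<^esub>a\<in>{0::'g}. x) \<in> part_sums ?K (rpart ?K)"
        by (rule part_sumsI) (use x in auto)
      ultimately show "x \<in> part_sums ?K (rpart ?K)" by simp
    qed
  next
    fix A f a
    assume A: "finite A" "f \<in> Pi A (rpart ?K)" "finsum ?K f A = \<zero>\<^bsub>?K\<^esub>" "a \<in> A"
    show "f a = \<zero>\<^bsub>?K\<^esub>"
      by (rule independent_by_maps[where T = "\<lambda>_. R" and D = "\<lambda>_. rpart R" and J = "{()}"
            and \<pi> = "\<lambda>_ x. x" and s = "\<lambda>_. 0", OF K.abelian_group_axioms _ _ _ _ _ A])
        (rule R_parts.direct_decomposition_axioms id | auto split: if_splits)+
  qed
  ultimately show ?thesis
    by (auto simp: graded_ring_def graded_ring_axioms_def intro: mult_degree_zero)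
qed

lemma graded_module_degree_zero:
  assumes "graded_module R M"
  shows "graded_module (degree_zero_graded R) M"
proof -
  interpret M: graded_module R M by fact
  interpret K: graded_ring "degree_zero_graded R" by (rule graded_ring_degree_zero[OF M.graded_ring_axioms])
  note [simp] = M.R_parts.part_carrier[of _ 0]
  have "module (degree_zero_graded R) M"
    by (rule moduleI[OF K.is_cring M.M.abelian_group_axioms])
      (auto simp: M.smult_l_distr M.smult_r_distr M.smult_assoc1)
  moreover have "r \<odot>\<^bsub>M\<^esub> x \<in> mpart M (a + b)"
    if "r \<in> rpart (degree_zero_graded R) a" "x \<in> mpart M b" for r x a b
    using M.smult_degree[of r 0 x b] that M.M_parts.part_carrier by (auto split: if_splits)
  ultimately show ?thesis
    using M.module_decomposition K.graded_ring_axioms by (simp add: graded_module_def graded_module_axioms_def)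
qed

section \<open>Injectivity of the associated injective module\<close>

text \<open>Graded injectivity tested on the carrier type of \<open>R\<close> already gives Baer's condition, because
  homogeneous ideals live there.\<close>

lemma graded_injective_imp_Baer:
  fixes R :: "('g::ab_group_add, 'r) graded_ring"
  assumes R: "graded_ring R" and inj: "graded_injective TYPE('r) TYPE('r) R E"
  shows "graded_Baer R E"
  unfolding graded_Baer_def
proof (intro allI impI)
  fix a \<Gamma>
  let ?B = "shift a (regular_module R)"
  assume \<Gamma>: "homogeneous_relation R ?B E \<Gamma>" "functional_relation ?B E \<Gamma>"
  interpret R: graded_ring R by fact
  have E: "graded_module R E" using inj by (simp add: graded_injective_def)
  have reg: "graded_module R (regular_module R)" by (rule R.graded_module_regular)
  interpret graded_module_pair R ?B E
    using E graded_module_shift[OF reg] by (simp add: graded_module_pair_def)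
  note rel = homogeneous_relationD[OF \<Gamma>(1)]
  define M where "M = module.truncate (regular_module R)"
  have [simp]: "carrier M = carrier R" "\<zero>\<^bsub>M\<^esub> = \<zero>\<^bsub>R\<^esub>" "x \<oplus>\<^bsub>M\<^esub> y = x \<oplus>\<^bsub>R\<^esub> y" "r \<odot>\<^bsub>M\<^esub> x = r \<otimes>\<^bsub>R\<^esub> x" for x y r
    by (simp_all add: M_def module.truncate_def regular_module_def)
  have M_ab: "abelian_group M"
  proof (rule abelian_groupI)
    fix x assume "x \<in> carrier M"
    then show "\<exists>y\<in>carrier M. y \<oplus>\<^bsub>M\<^esub> x = \<zero>\<^bsub>M\<^esub>" using R.l_neg by (intro bexI[of _ "\<ominus>\<^bsub>R\<^esub> x"]) auto
  qed (auto simp: R.a_ac)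
  interpret M: module R M
    by (rule moduleI[OF R.is_cring M_ab]) (auto simp: R.l_distr R.r_distr R.m_assoc)
  \<comment> \<open>The domain of the relation is a homogeneous ideal, here made into a graded module.\<close>
  define C where "C c = {r. \<exists>y. (c, r, y) \<in> \<Gamma>}" for c
  have C_part: "r \<in> rpart R (c - a)" if "r \<in> C c" for r c
    using that rel(1) unfolding C_def by fastforce
  have parts: "direct_parts R M C"
  proof (intro direct_parts.intro direct_parts_axioms.intro M.module_axioms R)
    fix c
    show "additive_subgroup (C c) M"
    proof (rule M.M.additive_subgroupI)
      show "C c \<subseteq> carrier M" using C_part R.R_parts.part_carrier by auto
      show "\<zero>\<^bsub>M\<^esub> \<in> C c" using rel(3) by (auto simp: C_def)
    next
      fix x y assume "x \<in> C c" "y \<in> C c"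
      then obtain u v where "(c, x, u) \<in> \<Gamma>" "(c, y, v) \<in> \<Gamma>" unfolding C_def by blast
      from rel(4)[OF this] show "x \<oplus>\<^bsub>M\<^esub> y \<in> C c" by (auto simp: C_def)
    next
      fix x assume x: "x \<in> C c"
      then obtain u where "(c, x, u) \<in> \<Gamma>" unfolding C_def by blast
      from relation_minus[OF \<Gamma>(1) this] have "\<ominus>\<^bsub>?B\<^esub> x \<in> C c" by (auto simp: C_def)
      moreover have "\<ominus>\<^bsub>?B\<^esub> x \<oplus>\<^bsub>R\<^esub> x = \<zero>\<^bsub>R\<^esub>"
        using B.M.l_neg[of x] C_part[OF x] R.R_parts.part_carrier by simp
      ultimately show "\<exists>y\<in>C c. y \<oplus>\<^bsub>M\<^esub> x = \<zero>\<^bsub>M\<^esub>" by auto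
    qed
  next
    fix c b r x assume r: "r \<in> rpart R b" and "x \<in> C c"
    then obtain u where "(c, x, u) \<in> \<Gamma>" unfolding C_def by blast
    from rel(5)[OF r this] show "r \<odot>\<^bsub>M\<^esub> x \<in> C (b + c)" by (auto simp: C_def)
  next
    fix A f c
    assume A: "finite A" "f \<in> Pi A C" "finsum M f A = \<zero>\<^bsub>M\<^esub>" "c \<in> A"
    have id: "(\<lambda>x. x) \<in> additive_maps M R" by (rule additive_mapsI; simp)
    show "f c = \<zero>\<^bsub>M\<^esub>"
      by (rule independent_by_maps[where T = "\<lambda>_. R" and D = "\<lambda>_. rpart R" and J = "{()}"
            and \<pi> = "\<lambda>_ x. x" and s = "\<lambda>_. - a", OF M_ab _ _ _ _ _ A])
        (rule R.R_parts.direct_decomposition_axioms id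
          | simp add: C_part subsetI R.R_parts.part_carrier[OF C_part])+
  qed
  define A where "A = module_of_parts M C"
  note A_simps [simp] = direct_parts.module_of_parts_simps[OF parts, folded A_def]
  have A: "graded_module R A" unfolding A_def by (rule direct_parts.graded_module_of_parts[OF parts])
  interpret A: graded_module R A by fact
  define \<phi> where "\<phi> c r = (SOME y. (c, r, y) \<in> \<Gamma>)" for c r
  have \<phi>_mem: "(c, r, \<phi> c r) \<in> \<Gamma>" if "r \<in> C c" for c r
    unfolding \<phi>_def using that by (auto simp: C_def intro: someI)
  have \<phi>_eq: "\<phi> c r = y" if "(c, r, y) \<in> \<Gamma>" for c r y
    using relation_unique[OF \<Gamma> \<phi>_mem that] that by (auto simp: C_def)
  have "\<exists>f \<in> graded_Hom R A E. \<forall>c. \<forall>r \<in> mpart A c. f r = \<phi> c r"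
  proof (rule graded_Hom_from_parts[OF A E])
    show "\<phi> c r \<in> mpart E c" if "r \<in> mpart A c" for c r
      using rel(2)[OF \<phi>_mem] that by simp
    show "\<phi> c (r \<oplus>\<^bsub>A\<^esub> s) = \<phi> c r \<oplus>\<^bsub>E\<^esub> \<phi> c s" if "r \<in> mpart A c" "s \<in> mpart A c" for c r s
      using \<phi>_eq[OF rel(4)[OF \<phi>_mem \<phi>_mem]] that by simp
    show "\<phi> (b + c) (r \<odot>\<^bsub>A\<^esub> s) = r \<odot>\<^bsub>E\<^esub> \<phi> c s" if "r \<in> rpart R b" "s \<in> mpart A c" for b c r s
      using \<phi>_eq[OF rel(5)[OF _ \<phi>_mem]] that by simp
  qed
  then obtain f where f: "f \<in> graded_Hom R A E" "\<And>c r. r \<in> C c \<Longrightarrow> f r = \<phi> c r" by auto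
  have A_car: "r \<in> carrier R" if "r \<in> carrier A" for r
    using direct_parts.part_sums_carrier[OF parts] that by simp
  define i where "i = (\<lambda>r\<in>carrier A. r)"
  have i: "i \<in> graded_Hom R A ?B"
  proof (rule graded_HomI[OF A B.graded_module_axioms])
    show "i \<in> additive_maps A ?B"
      using A_car A.M.a_closed by (intro additive_mapsI) (auto simp: i_def)
    show "i \<in> extensional (carrier A)" by (simp add: i_def)
    show "i r \<in> mpart ?B c" if "r \<in> mpart A c" for c r
      using that C_part A.M_parts.part_carrier[OF that] by (simp add: i_def)
    show "i (r \<odot>\<^bsub>A\<^esub> x) = r \<odot>\<^bsub>?B\<^esub> i x" if "r \<in> rpart R b" "x \<in> mpart A c" for c b r x
      using A.M_parts.part_carrier[OF that(2)] A.M_parts.part_carrier[OF A.smult_degree[OF that]]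
      by (simp add: i_def)
  qed
  moreover have "inj_on i (carrier A)" by (simp add: i_def inj_on_def)
  ultimately obtain h where h: "h \<in> graded_Hom R ?B E" "\<forall>x\<in>carrier A. h (i x) = f x"
    using inj A B.graded_module_axioms f(1) unfolding graded_injective_def by blast
  have "h \<one>\<^bsub>R\<^esub> \<in> mpart E a" by (rule graded_Hom_part[OF h(1)]) (simp add: R.one_part)
  moreover have "y = r \<odot>\<^bsub>E\<^esub> h \<one>\<^bsub>R\<^esub>" if y: "(c, r, y) \<in> \<Gamma>" for c r y
  proof -
    have r: "r \<in> C c" using y by (auto simp: C_def)
    then have rA: "r \<in> carrier A" using A.M_parts.part_carrier[of r c] by simp
    have "y = f r" using f(2)[OF r] \<phi>_eq[OF y] by simp
    also have "\<dots> = h r" using h(2) rA by (simp add: i_def)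
    also have "\<dots> = h (r \<odot>\<^bsub>?B\<^esub> \<one>\<^bsub>R\<^esub>)" using A_car[OF rA] by simp
    also have "\<dots> = r \<odot>\<^bsub>E\<^esub> h \<one>\<^bsub>R\<^esub>" using A_car[OF rA] by (intro graded_Hom_smult[OF h(1)]) auto
    finally show ?thesis .
  qed
  ultimately show "\<exists>e\<in>mpart E a. \<forall>c r y. (c, r, y) \<in> \<Gamma> \<longrightarrow> y = r \<odot>\<^bsub>E\<^esub> e" by blast
qed

lemma matlis_dual_simps [simp]:
  "\<zero>\<^bsub>matlis_dual R E M\<^esub> = (\<lambda>x\<in>carrier M. \<zero>\<^bsub>E\<^esub>)"
  "f \<oplus>\<^bsub>matlis_dual R E M\<^esub> g = (\<lambda>x\<in>carrier M. f x \<oplus>\<^bsub>E\<^esub> g x)"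
  "r \<odot>\<^bsub>matlis_dual R E M\<^esub> f = (\<lambda>x\<in>carrier M. r \<odot>\<^bsub>E\<^esub> f x)"
  "mpart (matlis_dual R E M) a = graded_Hom R (shift a M) E"
  by (simp_all add: matlis_dual_def)

locale matlis_pair = graded_module_pair R M E
  for R :: "('g::ab_group_add, 'r) graded_ring" and M :: "('g, 'r, 'm) graded_module"
    and E :: "('g, 'r, 'e) graded_module"
begin

abbreviation "dual \<equiv> matlis_dual R E M"
abbreviation "I\<^sub>M \<equiv> associated_injective R E M"
abbreviation "coregular \<equiv> matlis_dual R E (regular_module R)"

lemma graded_module_dual: "graded_module R dual"
  unfolding matlis_dual_def
  by (rule graded_module_hom_module[OF B.graded_module_axioms E.graded_module_axioms])

sublocale D: graded_module R dual by (rule graded_module_dual)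

lemma graded_module_regular: "graded_module R (regular_module R)"
  by (rule B.graded_module_regular)

lemma graded_module_associated_injective: "graded_module R I\<^sub>M"
  unfolding associated_injective_def
proof (rule graded_module_product[OF B.graded_ring_axioms graded_module_vector_hom])
  fix h
  show "graded_module R (shift (- h) coregular)"
    unfolding matlis_dual_def
    by (intro graded_module_shift graded_module_hom_module graded_module_regular E.graded_module_axioms)
  show "carrier (degree_zero_ring R) \<subseteq> carrier R" using B.R_parts.part_carrier by auto
  show "v \<oplus>\<^bsub>component dual h\<^esub> w \<in> carrier (component dual h)"
    if "v \<in> carrier (component dual h)" "w \<in> carrier (component dual h)" for v w
    using D.M_parts.part_add that by (simp only: component_simps)
  show "c \<odot>\<^bsub>component dual h\<^esub> v \<in> carrier (component dual h)"
    if "c \<in> carrier (degree_zero_ring R)" "v \<in> carrier (component dual h)" for c v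
    using D.smult_degree[of c 0 v h] that by (simp only: component_simps degree_zero_simps add_0)
qed

sublocale I: graded_module R I\<^sub>M by (rule graded_module_associated_injective)

lemma associated_injective_simps [simp]:
  "\<zero>\<^bsub>I\<^sub>M\<^esub> = (\<lambda>h. \<lambda>v\<in>mpart dual h. \<lambda>s\<in>carrier R. \<zero>\<^bsub>E\<^esub>)"
  "x \<oplus>\<^bsub>I\<^sub>M\<^esub> y = (\<lambda>h. \<lambda>v\<in>mpart dual h. \<lambda>s\<in>carrier R. x h v s \<oplus>\<^bsub>E\<^esub> y h v s)"
  "r \<odot>\<^bsub>I\<^sub>M\<^esub> x = (\<lambda>h. \<lambda>v\<in>mpart dual h. \<lambda>s\<in>carrier R. r \<odot>\<^bsub>E\<^esub> x h v s)"
  by (simp_all add: associated_injective_def)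

lemma associated_injective_part:
  "x \<in> mpart I\<^sub>M a \<longleftrightarrow>
     (\<forall>h. x h \<in> linear_maps (degree_zero_ring R) (component dual h) (component (shift (- h) coregular) a))"
  by (simp add: associated_injective_def del: matlis_dual_simps)

lemma associated_injective_value:
  assumes "x \<in> mpart I\<^sub>M a" "v \<in> mpart dual h"
  shows "x h v \<in> graded_Hom R (shift (a + h) (regular_module R)) E"
proof -
  have "x h v \<in> carrier (component (shift (- h) coregular) a)"
    by (rule linear_maps_closed[OF assms(1)[unfolded associated_injective_part, rule_format]])
      (simp only: component_simps assms(2))
  then show ?thesis by simp
qed

lemma associated_injective_value_one:
  assumes x: "x \<in> mpart I\<^sub>M a" and v: "v \<in> mpart dual h"
  shows "x h v \<one>\<^bsub>R\<^esub> \<in> mpart E (a + h)"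
    and "s \<in> carrier R \<Longrightarrow> x h v s = s \<odot>\<^bsub>E\<^esub> x h v \<one>\<^bsub>R\<^esub>"
proof -
  note f = associated_injective_value[OF x v]
  show "x h v \<one>\<^bsub>R\<^esub> \<in> mpart E (a + h)"
    by (rule graded_Hom_part[OF f]) (simp add: B.one_part)
  show "x h v s = s \<odot>\<^bsub>E\<^esub> x h v \<one>\<^bsub>R\<^esub>" if s: "s \<in> carrier R"
    using graded_Hom_smult[OF f s, of "\<one>\<^bsub>R\<^esub>"] s by simp
qed

lemma associated_injective_extensional:
  assumes x: "x \<in> mpart I\<^sub>M a"
  shows "x h \<in> extensional (mpart dual h)" and "v \<in> mpart dual h \<Longrightarrow> x h v \<in> extensional (carrier R)"
proof -
  show "x h \<in> extensional (mpart dual h)"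
    using x[unfolded associated_injective_part, rule_format, of h] by (auto simp: linear_maps_def PiE_def)
  show "x h v \<in> extensional (carrier R)" if "v \<in> mpart dual h"
    using graded_Hom_extensional[OF associated_injective_value[OF x that]] by simp
qed

text \<open>The homogeneous elements of \<open>E\<^sub>M\<close> have this form, for \<open>R\<^sub>0\<close>-linear \<open>g\<close>, because an element of \<open>R\<^sup>\<or>\<close> is
  determined by its value at one.\<close>

definition coinduced :: "(('m \<Rightarrow> 'e) \<Rightarrow> 'e) \<Rightarrow> 'g \<Rightarrow> ('m \<Rightarrow> 'e) \<Rightarrow> 'r \<Rightarrow> 'e" where
  "coinduced g = (\<lambda>h. \<lambda>v\<in>mpart dual h. \<lambda>s\<in>carrier R. s \<odot>\<^bsub>E\<^esub> g v)"

lemma multiplication_Hom: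
  assumes e: "e \<in> mpart E d"
  shows "(\<lambda>s\<in>carrier R. s \<odot>\<^bsub>E\<^esub> e) \<in> graded_Hom R (shift d (regular_module R)) E"
proof -
  have ec: "e \<in> carrier E" using e E.M_parts.part_carrier by blast
  have "(\<lambda>s\<in>carrier R. s \<odot>\<^bsub>E\<^esub> e) \<in> linear_maps R (regular_module R) E"
    by (intro linear_mapsI additive_mapsI) (auto simp: ec E.smult_l_distr E.smult_assoc1)
  moreover have "s \<odot>\<^bsub>E\<^esub> e \<in> mpart E (d + b)" if "s \<in> rpart R b" for s b
    using E.smult_degree[OF that e] by (simp add: add.commute)
  ultimately show ?thesis
    using B.R_parts.part_carrier by (simp add: graded_Hom_shift)
qed

lemma coinduced_part:
  assumes g: "\<And>h v. v \<in> mpart dual h \<Longrightarrow> g v \<in> mpart E (a + h)"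
    and add: "\<And>h v w. v \<in> mpart dual h \<Longrightarrow> w \<in> mpart dual h \<Longrightarrow> g (v \<oplus>\<^bsub>dual\<^esub> w) = g v \<oplus>\<^bsub>E\<^esub> g w"
    and smult: "\<And>h c v. c \<in> rpart R 0 \<Longrightarrow> v \<in> mpart dual h \<Longrightarrow> g (c \<odot>\<^bsub>dual\<^esub> v) = c \<odot>\<^bsub>E\<^esub> g v"
  shows "coinduced g \<in> mpart I\<^sub>M a"
  unfolding associated_injective_part
proof (intro allI linear_mapsI additive_mapsI)
  fix h
  let ?V = "component dual h" and ?N = "component (shift (- h) coregular) a"
  have gc: "g v \<in> carrier E" if "v \<in> mpart dual h" for v
    using g[OF that] E.M_parts.part_carrier by blast
  have V: "v \<oplus>\<^bsub>dual\<^esub> w \<in> mpart dual h" if "v \<in> mpart dual h" "w \<in> mpart dual h" for v w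
    by (rule D.M_parts.part_add[OF that])
  have V': "c \<odot>\<^bsub>dual\<^esub> v \<in> mpart dual h" if "c \<in> rpart R 0" "v \<in> mpart dual h" for c v
    using D.smult_degree[OF that] by (simp only: add_0)
  show "coinduced g h \<in> extensional (carrier ?V)"
    unfolding coinduced_def component_simps by simp
  show "coinduced g h v \<in> carrier ?N" if "v \<in> carrier ?V" for v
  proof -
    have v: "v \<in> mpart dual h" using that by (simp only: component_simps)
    show ?thesis
      using multiplication_Hom[OF g[OF v]] v unfolding coinduced_def by simp
  qed
  show "coinduced g h (v \<oplus>\<^bsub>?V\<^esub> w) = coinduced g h v \<oplus>\<^bsub>?N\<^esub> coinduced g h w"
    if "v \<in> carrier ?V" "w \<in> carrier ?V" for v w
  proof -
    have v: "v \<in> mpart dual h" "w \<in> mpart dual h" using that by (simp_all only: component_simps)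
    note g_add = add[OF v]
    show ?thesis
      unfolding component_simps coinduced_def
      by (simp only: restrict_apply' v V g_add shift_simps)
         (auto simp: gc[OF v(1)] gc[OF v(2)] E.smult_r_distr intro!: restrict_ext)
  qed
  show "coinduced g h (c \<odot>\<^bsub>?V\<^esub> v) = c \<odot>\<^bsub>?N\<^esub> coinduced g h v"
    if "c \<in> carrier (degree_zero_ring R)" "v \<in> carrier ?V" for c v
  proof -
    have v: "v \<in> mpart dual h" and c: "c \<in> rpart R 0" using that by (simp_all only: component_simps degree_zero_simps)
    have "c \<in> carrier R" using c B.R_parts.part_carrier by blast
    moreover have "s \<odot>\<^bsub>E\<^esub> (c \<odot>\<^bsub>E\<^esub> g v) = c \<odot>\<^bsub>E\<^esub> (s \<odot>\<^bsub>E\<^esub> g v)" if "s \<in> carrier R" for s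
      using that \<open>c \<in> carrier R\<close> gc[OF v] E.smult_assoc1[of s c "g v"] E.smult_assoc1[of c s "g v"] B.m_comm[of s c]
      by simp
    moreover note g_smult = smult[OF c v]
    ultimately show ?thesis
      unfolding component_simps coinduced_def
      by (simp only: restrict_apply' v V' c g_smult shift_simps) (auto intro!: restrict_ext)
  qed
qed

lemma coinduced_smult:
  assumes g: "\<And>h v. v \<in> mpart dual h \<Longrightarrow> g v \<in> carrier E" and r: "r \<in> carrier R"
  shows "r \<odot>\<^bsub>I\<^sub>M\<^esub> coinduced g = coinduced (\<lambda>v. r \<odot>\<^bsub>E\<^esub> g v)"
proof -
  have "r \<odot>\<^bsub>E\<^esub> (s \<odot>\<^bsub>E\<^esub> g v) = s \<odot>\<^bsub>E\<^esub> (r \<odot>\<^bsub>E\<^esub> g v)" if "s \<in> carrier R" "v \<in> mpart dual h" for s v h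
    using that g[OF that(2)] r E.smult_assoc1[of s r "g v"] E.smult_assoc1[of r s "g v"] B.m_comm[of s r] by simp
  then show ?thesis unfolding coinduced_def associated_injective_simps
    by (intro ext) (simp add: restrict_def)
qed

lemma eq_coinduced:
  assumes x: "x \<in> mpart I\<^sub>M a" and eq: "\<And>h v. v \<in> mpart dual h \<Longrightarrow> x h v \<one>\<^bsub>R\<^esub> = g v"
  shows "x = coinduced g"
proof (rule ext)
  fix h show "x h = coinduced g h"
  proof (rule extensionalityI[OF associated_injective_extensional(1)[OF x]])
    show "coinduced g h \<in> extensional (mpart dual h)" unfolding coinduced_def by (rule restrict_extensional)
    fix v assume v: "v \<in> mpart dual h"
    show "x h v = coinduced g h v"
    proof (rule extensionalityI[OF associated_injective_extensional(2)[OF x v]])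
      show "coinduced g h v \<in> extensional (carrier R)"
        unfolding coinduced_def by (simp only: restrict_apply' v restrict_extensional)
      fix s assume s: "s \<in> carrier R"
      show "x h v s = coinduced g h v s"
        unfolding associated_injective_value_one(2)[OF x v s] eq[OF v] coinduced_def
        by (simp only: restrict_apply' v s)
    qed
  qed
qed

text \<open>The value at one of an extension of a homomorphism from an ideal to \<open>E\<^sub>M\<close> assigns to each \<open>v\<close> in the
  dual an element of \<open>R\<^sup>\<or>\<close>. What the latter may be at one is a nonempty set by injectivity of \<open>E\<close>. These
  sets constitute a linear relation over the field \<open>R\<^sub>0\<close>, and such a relation contains a linear map.\<close>

theorem graded_Baer_associated_injective:
  assumes Baer: "graded_Baer R E"
    and field: "\<And>c. c \<in> rpart R 0 \<Longrightarrow> c \<noteq> \<zero>\<^bsub>R\<^esub> \<Longrightarrow> \<exists>d \<in> rpart R 0. d \<otimes>\<^bsub>R\<^esub> c = \<one>\<^bsub>R\<^esub>"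
  shows "graded_Baer R I\<^sub>M"
  unfolding graded_Baer_def
proof (intro allI impI)
  fix a \<Gamma>
  let ?K = "degree_zero_graded R" and ?B = "shift a (regular_module R)" and ?E = "shift (- a) E"
  assume \<Gamma>: "homogeneous_relation R ?B I\<^sub>M \<Gamma>" "functional_relation ?B I\<^sub>M \<Gamma>"
  note rel = homogeneous_relationD[OF \<Gamma>(1)]
  interpret K: graded_module_pair ?K dual ?E
    by (intro graded_module_pair.intro graded_module_degree_zero graded_module_shift
        graded_module_dual E.graded_module_axioms)
  have \<Gamma>_car: "r \<in> carrier R" if "(c, r, y) \<in> \<Gamma>" for c r y
    using rel(1)[OF that] B.R_parts.part_carrier by simp
  have ec: "e \<in> carrier E" if "e \<in> mpart E b" for e b using that E.M_parts.part_carrier by blast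
  \<comment> \<open>The admissible values at one. They are collected for all degrees of the dual at once.\<close>
  define \<Lambda> where "\<Lambda> = {(h, v, e). v \<in> mpart dual h \<and> e \<in> mpart E (h + a) \<and>
    (\<forall>c r y. (c, r, y) \<in> \<Gamma> \<longrightarrow> y h v \<one>\<^bsub>R\<^esub> = r \<odot>\<^bsub>E\<^esub> e)}"
  have \<Lambda>I: "(h, v, e) \<in> \<Lambda>" if "v \<in> mpart dual h" "e \<in> mpart E (h + a)"
      "\<And>c r y. (c, r, y) \<in> \<Gamma> \<Longrightarrow> y h v \<one>\<^bsub>R\<^esub> = r \<odot>\<^bsub>E\<^esub> e" for h v e
    unfolding \<Lambda>_def using that by blast
  have \<Lambda>D: "v \<in> mpart dual h" "e \<in> mpart E (h + a)" "(c, r, y) \<in> \<Gamma> \<Longrightarrow> y h v \<one>\<^bsub>R\<^esub> = r \<odot>\<^bsub>E\<^esub> e"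
    if "(h, v, e) \<in> \<Lambda>" for h v e c r y
    using that unfolding \<Lambda>_def by blast+
  have lin: "y h \<in> linear_maps (degree_zero_ring R) (component dual h) (component (shift (- h) coregular) c)"
    if "(c, r, y) \<in> \<Gamma>" for c r y h
    using rel(2)[OF that] unfolding associated_injective_part by blast
  have y_zero: "y h \<zero>\<^bsub>dual\<^esub> \<one>\<^bsub>R\<^esub> = \<zero>\<^bsub>E\<^esub>" if y: "(c, r, y) \<in> \<Gamma>" for c r y h
  proof -
    have "\<zero>\<^bsub>R\<^esub> \<in> carrier (degree_zero_ring R)" "\<zero>\<^bsub>dual\<^esub> \<in> carrier (component dual h)"
      by (simp_all only: degree_zero_simps component_simps B.R_parts.part_zero D.M_parts.part_zero)
    note l = linear_maps_smult[OF lin[OF y] this]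
    have 0: "\<zero>\<^bsub>R\<^esub> \<odot>\<^bsub>dual\<^esub> \<zero>\<^bsub>dual\<^esub> = \<zero>\<^bsub>dual\<^esub>" by (rule D.smult_r_null) simp
    have "y h \<zero>\<^bsub>dual\<^esub> \<one>\<^bsub>R\<^esub> = \<zero>\<^bsub>R\<^esub> \<odot>\<^bsub>E\<^esub> y h \<zero>\<^bsub>dual\<^esub> \<one>\<^bsub>R\<^esub>"
      using fun_cong[OF l[unfolded component_simps shift_simps 0], of "\<one>\<^bsub>R\<^esub>"]
      unfolding matlis_dual_simps(3)
      by (simp only: restrict_apply' regular_module_simps B.one_closed)
    moreover have "y h \<zero>\<^bsub>dual\<^esub> \<one>\<^bsub>R\<^esub> \<in> carrier E"
      using associated_injective_value_one(1)[OF rel(2)[OF y] D.M_parts.part_zero] ec by blast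
    ultimately show ?thesis by simp
  qed
  have \<Lambda>_rel: "homogeneous_relation ?K dual ?E \<Lambda>"
    unfolding homogeneous_relation_def
  proof (intro conjI allI impI)
    fix h v e assume *: "(h, v, e) \<in> \<Lambda>"
    show "v \<in> mpart dual h" by (rule \<Lambda>D(1)[OF *])
    show "e \<in> mpart ?E h" using \<Lambda>D(2)[OF *] by simp
  next
    fix h
    show "(h, \<zero>\<^bsub>dual\<^esub>, \<zero>\<^bsub>?E\<^esub>) \<in> \<Lambda>"
    proof (rule \<Lambda>I)
      show "y h \<zero>\<^bsub>dual\<^esub> \<one>\<^bsub>R\<^esub> = r \<odot>\<^bsub>E\<^esub> \<zero>\<^bsub>?E\<^esub>" if "(c, r, y) \<in> \<Gamma>" for c r y
        unfolding y_zero[OF that] using \<Gamma>_car[OF that] by simp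
    qed (simp_all only: D.M_parts.part_zero shift_simps E.M_parts.part_zero)
  next
    fix h v e w f assume v: "(h, v, e) \<in> \<Lambda>" and w: "(h, w, f) \<in> \<Lambda>"
    show "(h, v \<oplus>\<^bsub>dual\<^esub> w, e \<oplus>\<^bsub>?E\<^esub> f) \<in> \<Lambda>"
    proof (rule \<Lambda>I)
      show "v \<oplus>\<^bsub>dual\<^esub> w \<in> mpart dual h" by (rule D.M_parts.part_add[OF \<Lambda>D(1)[OF v] \<Lambda>D(1)[OF w]])
      show "e \<oplus>\<^bsub>?E\<^esub> f \<in> mpart E (h + a)"
        using E.M_parts.part_add[OF \<Lambda>D(2)[OF v] \<Lambda>D(2)[OF w]] by simp
      fix c r y assume y: "(c, r, y) \<in> \<Gamma>"
      have vw: "v \<in> carrier (component dual h)" "w \<in> carrier (component dual h)"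
        using \<Lambda>D(1)[OF v] \<Lambda>D(1)[OF w] by (simp_all only: component_simps)
      have "y h (v \<oplus>\<^bsub>dual\<^esub> w) \<one>\<^bsub>R\<^esub> = y h v \<one>\<^bsub>R\<^esub> \<oplus>\<^bsub>E\<^esub> y h w \<one>\<^bsub>R\<^esub>"
        using linear_maps_add[OF lin[OF y] vw] unfolding component_simps shift_simps by (simp add: fun_eq_iff)
      then show "y h (v \<oplus>\<^bsub>dual\<^esub> w) \<one>\<^bsub>R\<^esub> = r \<odot>\<^bsub>E\<^esub> (e \<oplus>\<^bsub>?E\<^esub> f)"
        using \<Lambda>D(3)[OF v y] \<Lambda>D(3)[OF w y] ec[OF \<Lambda>D(2)[OF v]] ec[OF \<Lambda>D(2)[OF w]] \<Gamma>_car[OF y]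
        by (simp only: shift_simps E.smult_r_distr)
    qed
  next
    fix b k h v e assume k: "k \<in> rpart ?K b" and v: "(h, v, e) \<in> \<Lambda>"
    have k0: "k \<in> rpart R 0" using k B.R_parts.part_zero by (auto split: if_splits)
    then have kc: "k \<in> carrier R" using B.R_parts.part_carrier by blast
    have vw: "v \<in> carrier (component dual h)" "k \<in> carrier (degree_zero_ring R)"
      using \<Lambda>D(1)[OF v] k0 by (simp_all only: component_simps degree_zero_simps)
    have fit: "y h (k \<odot>\<^bsub>dual\<^esub> v) \<one>\<^bsub>R\<^esub> = r \<odot>\<^bsub>E\<^esub> (k \<odot>\<^bsub>E\<^esub> e)" if y: "(c, r, y) \<in> \<Gamma>" for c r y
    proof -
      have "y h (k \<odot>\<^bsub>dual\<^esub> v) \<one>\<^bsub>R\<^esub> = k \<odot>\<^bsub>E\<^esub> y h v \<one>\<^bsub>R\<^esub>"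
        using linear_maps_smult[OF lin[OF y] vw(2,1)] unfolding component_simps shift_simps by (simp add: fun_eq_iff)
      also have "\<dots> = k \<odot>\<^bsub>E\<^esub> (r \<odot>\<^bsub>E\<^esub> e)" using \<Lambda>D(3)[OF v y] by simp
      also have "\<dots> = r \<odot>\<^bsub>E\<^esub> (k \<odot>\<^bsub>E\<^esub> e)"
        using E.smult_assoc1[OF kc \<Gamma>_car[OF y] ec[OF \<Lambda>D(2)[OF v]]] 
          E.smult_assoc1[OF \<Gamma>_car[OF y] kc ec[OF \<Lambda>D(2)[OF v]]] B.m_comm[OF kc \<Gamma>_car[OF y]] by simp
      finally show ?thesis .
    qed
    show "(b + h, k \<odot>\<^bsub>dual\<^esub> v, k \<odot>\<^bsub>?E\<^esub> e) \<in> \<Lambda>"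
    proof (cases "b = 0")
      case True
      show ?thesis
      proof (rule \<Lambda>I)
        show "k \<odot>\<^bsub>dual\<^esub> v \<in> mpart dual (b + h)" unfolding True by (rule D.smult_degree[OF k0 \<Lambda>D(1)[OF v]])
        show "k \<odot>\<^bsub>?E\<^esub> e \<in> mpart E (b + h + a)"
          unfolding True shift_simps add.assoc by (rule E.smult_degree[OF k0 \<Lambda>D(2)[OF v]])
        show "y (b + h) (k \<odot>\<^bsub>dual\<^esub> v) \<one>\<^bsub>R\<^esub> = r \<odot>\<^bsub>E\<^esub> (k \<odot>\<^bsub>?E\<^esub> e)" if "(c, r, y) \<in> \<Gamma>" for c r y
          unfolding True add_0 shift_simps by (rule fit[OF that])
      qed
    next
      case False
      then have kz: "k = \<zero>\<^bsub>R\<^esub>" using k by simp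
      have z: "k \<odot>\<^bsub>dual\<^esub> v = \<zero>\<^bsub>dual\<^esub>" "k \<odot>\<^bsub>?E\<^esub> e = \<zero>\<^bsub>E\<^esub>"
        unfolding kz shift_simps
        by (rule D.smult_l_null[OF D.M_parts.part_carrier[OF \<Lambda>D(1)[OF v]]])
          (rule E.smult_l_null[OF ec[OF \<Lambda>D(2)[OF v]]])
      show ?thesis
        unfolding z
      proof (rule \<Lambda>I)
        show "y (b + h) \<zero>\<^bsub>dual\<^esub> \<one>\<^bsub>R\<^esub> = r \<odot>\<^bsub>E\<^esub> \<zero>\<^bsub>E\<^esub>" if "(c, r, y) \<in> \<Gamma>" for c r y
          unfolding y_zero[OF that] using \<Gamma>_car[OF that] by simp
      qed (simp_all only: D.M_parts.part_zero E.M_parts.part_zero)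
    qed
  qed
  have \<Lambda>_total: "\<exists>e. (h, v, e) \<in> \<Lambda>" if v: "v \<in> mpart dual h" for h v
  proof -
    let ?C = "shift (h + a) (regular_module R)"
    \<comment> \<open>For a fixed \<open>v\<close>, the relation followed by evaluation at \<open>v\<close> and at one is a partial homomorphism
      to \<open>E\<close>.\<close>
    define \<Delta> where "\<Delta> = {(c + h, r, y h v \<one>\<^bsub>R\<^esub>) | c r y. (c, r, y) \<in> \<Gamma>}"
    have \<Delta>I: "(c + h, r, y h v \<one>\<^bsub>R\<^esub>) \<in> \<Delta>" if "(c, r, y) \<in> \<Gamma>" for c r y
      unfolding \<Delta>_def using that by blast
    have \<Delta>E: "\<exists>y. (d - h, r, y) \<in> \<Gamma> \<and> e = y h v \<one>\<^bsub>R\<^esub>" if "(d, r, e) \<in> \<Delta>" for d r e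
      using that unfolding \<Delta>_def by auto
    have "homogeneous_relation R ?C E \<Delta>"
      unfolding homogeneous_relation_def
    proof (intro conjI allI impI)
      fix d r e assume "(d, r, e) \<in> \<Delta>"
      then obtain y where y: "(d - h, r, y) \<in> \<Gamma>" "e = y h v \<one>\<^bsub>R\<^esub>" using \<Delta>E by blast
      show "r \<in> mpart ?C d" using rel(1)[OF y(1)] by (simp add: diff_diff_eq)
      show "e \<in> mpart E d" using associated_injective_value_one(1)[OF rel(2)[OF y(1)] v] y(2) by simp
    next
      fix d
      have "(d - h + h, \<zero>\<^bsub>?B\<^esub>, \<zero>\<^bsub>I\<^sub>M\<^esub> h v \<one>\<^bsub>R\<^esub>) \<in> \<Delta>" by (rule \<Delta>I[OF rel(3)])
      then show "(d, \<zero>\<^bsub>?C\<^esub>, \<zero>\<^bsub>E\<^esub>) \<in> \<Delta>" using v by simp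
    next
      fix d r e r' e' assume "(d, r, e) \<in> \<Delta>" "(d, r', e') \<in> \<Delta>"
      then obtain y y' where y: "(d - h, r, y) \<in> \<Gamma>" "e = y h v \<one>\<^bsub>R\<^esub>" "(d - h, r', y') \<in> \<Gamma>" "e' = y' h v \<one>\<^bsub>R\<^esub>"
        using \<Delta>E by meson
      have "(d - h + h, r \<oplus>\<^bsub>?B\<^esub> r', (y \<oplus>\<^bsub>I\<^sub>M\<^esub> y') h v \<one>\<^bsub>R\<^esub>) \<in> \<Delta>" by (rule \<Delta>I[OF rel(4)[OF y(1,3)]])
      then show "(d, r \<oplus>\<^bsub>?C\<^esub> r', e \<oplus>\<^bsub>E\<^esub> e') \<in> \<Delta>" using v y(2,4) by simp
    next
      fix b s d r e assume s: "s \<in> rpart R b" and "(d, r, e) \<in> \<Delta>"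
      then obtain y where y: "(d - h, r, y) \<in> \<Gamma>" "e = y h v \<one>\<^bsub>R\<^esub>" using \<Delta>E by blast
      have "(b + (d - h) + h, s \<odot>\<^bsub>?B\<^esub> r, (s \<odot>\<^bsub>I\<^sub>M\<^esub> y) h v \<one>\<^bsub>R\<^esub>) \<in> \<Delta>" by (rule \<Delta>I[OF rel(5)[OF s y(1)]])
      then show "(b + d, s \<odot>\<^bsub>?C\<^esub> r, s \<odot>\<^bsub>E\<^esub> e) \<in> \<Delta>" using v y(2) by (simp add: add.assoc)
    qed
    moreover have "functional_relation ?C E \<Delta>"
      unfolding functional_relation_def
    proof (intro allI impI)
      fix d e assume "(d, \<zero>\<^bsub>?C\<^esub>, e) \<in> \<Delta>"
      then obtain y where y: "(d - h, \<zero>\<^bsub>?C\<^esub>, y) \<in> \<Gamma>" "e = y h v \<one>\<^bsub>R\<^esub>" using \<Delta>E by blast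
      then have "y = \<zero>\<^bsub>I\<^sub>M\<^esub>" using \<Gamma>(2) unfolding functional_relation_def shift_simps by blast
      then show "e = \<zero>\<^bsub>E\<^esub>" using y(2) v by simp
    qed
    ultimately obtain e where e: "e \<in> mpart E (h + a)" "\<And>d r y. (d, r, y) \<in> \<Delta> \<Longrightarrow> y = r \<odot>\<^bsub>E\<^esub> e"
      using Baer unfolding graded_Baer_def by blast
    have "(h, v, e) \<in> \<Lambda>" by (rule \<Lambda>I[OF v e(1)]) (rule e(2)[OF \<Delta>I])
    then show ?thesis ..
  qed
  let ?\<Gamma>\<^sub>0 = "{(h::'g, \<zero>\<^bsub>dual\<^esub>, \<zero>\<^bsub>?E\<^esub>) | h. True}"
  have \<Gamma>\<^sub>0_sub: "?\<Gamma>\<^sub>0 \<subseteq> \<Lambda>" using homogeneous_relationD(3)[OF \<Lambda>_rel] by blast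
  have K_field: "\<exists>s \<in> rpart ?K (- c). s \<otimes>\<^bsub>?K\<^esub> r = \<one>\<^bsub>?K\<^esub>" if "r \<in> rpart ?K c" "r \<noteq> \<zero>\<^bsub>?K\<^esub>" for c r
    using field that by (simp split: if_splits)
  obtain g where g1: "g \<in> graded_Hom ?K dual ?E"
    and g2: "(\<forall>h v. v \<in> mpart dual h \<longrightarrow> (h, v, g v) \<in> \<Lambda>) \<and>
      (\<forall>h v e. (h, v, e) \<in> ?\<Gamma>\<^sub>0 \<longrightarrow> g v = e)"
    using K.graded_field_Hom_extension[OF K_field K.zero_relation \<Gamma>\<^sub>0_sub \<Lambda>_rel \<Lambda>_total]
    by (rule bexE)
  note g = g1 g2[THEN conjunct1, rule_format]
  have gc: "g v \<in> carrier E" if "v \<in> mpart dual h" for v h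
    using ec[OF \<Lambda>D(2)[OF g(2)[OF that]]] .
  have "coinduced g \<in> mpart I\<^sub>M a"
  proof (rule coinduced_part)
    fix h v assume v: "v \<in> mpart dual h"
    show "g v \<in> mpart E (a + h)" using \<Lambda>D(2)[OF g(2)[OF v]] by (simp add: add.commute)
    show "g (v \<oplus>\<^bsub>dual\<^esub> w) = g v \<oplus>\<^bsub>E\<^esub> g w" if "w \<in> mpart dual h" for w
      using graded_Hom_add[OF g(1) D.M_parts.part_carrier[OF v] D.M_parts.part_carrier[OF that]]
      by (simp only: shift_simps)
    show "g (c \<odot>\<^bsub>dual\<^esub> v) = c \<odot>\<^bsub>E\<^esub> g v" if "c \<in> rpart R 0" for c
      using graded_Hom_smult[OF g(1) _ D.M_parts.part_carrier[OF v], of c] that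
      by (simp only: shift_simps degree_zero_simps)
  qed
  moreover have "y = r \<odot>\<^bsub>I\<^sub>M\<^esub> coinduced g" if y: "(c, r, y) \<in> \<Gamma>" for c r y
  proof -
    have "y = coinduced (\<lambda>v. r \<odot>\<^bsub>E\<^esub> g v)"
      by (rule eq_coinduced[OF rel(2)[OF y]]) (rule \<Lambda>D(3)[OF g(2) y])
    then show ?thesis using coinduced_smult[OF gc \<Gamma>_car[OF y]] by simp
  qed
  ultimately show "\<exists>e\<in>mpart I\<^sub>M a. \<forall>c r y. (c, r, y) \<in> \<Gamma> \<longrightarrow> y = r \<odot>\<^bsub>I\<^sub>M\<^esub> e" by blast
qed

end

section \<open>Tensor products\<close>

lemma (in abelian_group) add_minus_minus:
  assumes "b \<in> carrier G" "c \<in> carrier G"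
  shows "b \<oplus> c \<oplus> \<ominus> b \<oplus> \<ominus> c = \<zero>"
proof -
  have "b \<oplus> c \<oplus> \<ominus> b = c"
    using assms a_comm[of b c] a_assoc[of c b "\<ominus> b"] r_neg[of b] by simp
  then show ?thesis using assms r_neg by simp
qed

locale tensor_factors = N: abelian_group N + V: abelian_group V
  for K :: "('r, 'z) ring_scheme" and N :: "('r, 'n, 'x) module_scheme" and V :: "('r, 'v, 'y) module_scheme" +
  assumes N_smult: "c \<in> carrier K \<Longrightarrow> x \<in> carrier N \<Longrightarrow> c \<odot>\<^bsub>N\<^esub> x \<in> carrier N"
    and V_smult: "c \<in> carrier K \<Longrightarrow> v \<in> carrier V \<Longrightarrow> c \<odot>\<^bsub>V\<^esub> v \<in> carrier V"
begin

abbreviation "F \<equiv> tensor_free N V"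
abbreviation "T \<equiv> tensor K N V"
abbreviation "cls \<equiv> tensor_class K N V"

definition pure :: "'n \<Rightarrow> 'v \<Rightarrow> ('n \<times> 'v \<Rightarrow>\<^sub>0 int) set" where
  "pure x v = cls (frag_of (x, v))"

lemma relations_carrier: "tensor_relations K N V \<subseteq> carrier F"
proof -
  have diff: "x - y \<in> carrier F" if "x \<in> carrier F" "y \<in> carrier F" for x y
    using that keys_diff[of x y] by auto
  have F: "frag_of (x, v) \<in> carrier F" if "x \<in> carrier N" "v \<in> carrier V" for x v
    using that by simp
  show ?thesis
  proof
    fix t assume "t \<in> tensor_relations K N V"
    then show "t \<in> carrier F"
      unfolding tensor_relations_def
      by (elim UnE CollectE exE conjE; hypsubst; intro diff F)
        (simp_all only: N_smult V_smult N.a_closed V.a_closed)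
  qed
qed

lemma kernel_subgroup: "subgroup (tensor_kernel K N V) F"
  unfolding tensor_kernel_def
  by (rule group.generate_is_subgroup[OF group_free_Abelian_group relations_carrier])

lemma kernel_normal: "tensor_kernel K N V \<lhd> F"
  using kernel_subgroup comm_group.normal_iff_subgroup[OF abelian_free_Abelian_group] by blast

lemma relation_in_kernel: "x \<in> tensor_relations K N V \<Longrightarrow> x \<in> tensor_kernel K N V"
  unfolding tensor_kernel_def by (rule generate.incl)

lemma tensor_simps:
  "carrier T = cls ` carrier F" "\<zero>\<^bsub>T\<^esub> = tensor_kernel K N V" "X \<oplus>\<^bsub>T\<^esub> Y = X <#>\<^bsub>F\<^esub> Y"
  by (auto simp: tensor_def Let_def FactGroup_def RCOSETS_def tensor_class_def)

lemma class_add: "x \<in> carrier F \<Longrightarrow> y \<in> carrier F \<Longrightarrow> cls (x + y) = cls x \<oplus>\<^bsub>T\<^esub> cls y"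
  unfolding tensor_simps tensor_class_def
  using normal.rcos_sum[OF kernel_normal, of x y] by simp

lemma class_eq_zero: "x \<in> tensor_kernel K N V \<Longrightarrow> cls x = \<zero>\<^bsub>T\<^esub>"
  unfolding tensor_simps tensor_class_def
  by (rule subgroup.rcos_const[OF kernel_subgroup group_free_Abelian_group])

lemma class_zero: "cls 0 = \<zero>\<^bsub>T\<^esub>"
  using class_eq_zero[OF subgroup.one_closed[OF kernel_subgroup]] by simp

lemma tensor_abelian_group: "abelian_group T"
proof (rule abelian_groupI)
  have F: "x + y \<in> carrier F" if "x \<in> carrier F" "y \<in> carrier F" for x y
    using that keys_add[of x y] by auto
  fix X Y Z assume "X \<in> carrier T" "Y \<in> carrier T" "Z \<in> carrier T"
  then obtain x y z where x: "x \<in> carrier F" "X = cls x" and y: "y \<in> carrier F" "Y = cls y"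
    and z: "z \<in> carrier F" "Z = cls z" unfolding tensor_simps by blast
  have xyz: "cls (x + y) = X \<oplus>\<^bsub>T\<^esub> Y" "cls (y + x) = Y \<oplus>\<^bsub>T\<^esub> X" "cls (y + z) = Y \<oplus>\<^bsub>T\<^esub> Z"
    "cls ((x + y) + z) = cls (x + y) \<oplus>\<^bsub>T\<^esub> Z" "cls (x + (y + z)) = X \<oplus>\<^bsub>T\<^esub> cls (y + z)"
    using class_add x y z F[OF x(1) y(1)] F[OF y(1) z(1)] by blast+
  show "X \<oplus>\<^bsub>T\<^esub> Y \<in> carrier T"
    unfolding xyz(1)[symmetric] using F[OF x(1) y(1)] unfolding tensor_simps by blast
  show "X \<oplus>\<^bsub>T\<^esub> Y \<oplus>\<^bsub>T\<^esub> Z = X \<oplus>\<^bsub>T\<^esub> (Y \<oplus>\<^bsub>T\<^esub> Z)" using xyz by (simp add: add.assoc)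
  show "X \<oplus>\<^bsub>T\<^esub> Y = Y \<oplus>\<^bsub>T\<^esub> X" using xyz by (simp add: add.commute)
next
  have 0: "0 \<in> carrier F" by simp
  then show "\<zero>\<^bsub>T\<^esub> \<in> carrier T" unfolding class_zero[symmetric] tensor_simps(1) by blast
  fix X assume "X \<in> carrier T"
  then obtain x where x: "x \<in> carrier F" "X = cls x" unfolding tensor_simps by blast
  show "\<zero>\<^bsub>T\<^esub> \<oplus>\<^bsub>T\<^esub> X = X" using class_add[OF 0 x(1)] class_zero x(2) by simp
  have m: "- x \<in> carrier F" using x(1) by simp
  have "cls (- x) \<oplus>\<^bsub>T\<^esub> X = \<zero>\<^bsub>T\<^esub>" using class_add[OF m x(1)] class_zero x(2) by simp
  moreover have "cls (- x) \<in> carrier T" using m unfolding tensor_simps by blast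
  ultimately show "\<exists>Y\<in>carrier T. Y \<oplus>\<^bsub>T\<^esub> X = \<zero>\<^bsub>T\<^esub>" by blast
qed

sublocale T: abelian_group T by (rule tensor_abelian_group)

lemma class_carrier: "x \<in> carrier F \<Longrightarrow> cls x \<in> carrier T"
  unfolding tensor_simps by blast

lemma class_minus: "x \<in> carrier F \<Longrightarrow> cls (- x) = \<ominus>\<^bsub>T\<^esub> cls x"
  using class_add[of "- x" x] class_zero class_carrier[of x] class_carrier[of "- x"]
  by (intro T.minus_equality[symmetric]) simp_all

lemma pure_carrier [simp]: "x \<in> carrier N \<Longrightarrow> v \<in> carrier V \<Longrightarrow> pure x v \<in> carrier T"
  unfolding pure_def by (rule class_carrier) simp

lemma class_eq_add:
  assumes "a - b - c \<in> tensor_relations K N V" "b \<in> carrier F" "c \<in> carrier F"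
  shows "cls a = cls b \<oplus>\<^bsub>T\<^esub> cls c"
proof -
  have abc: "a - b - c \<in> carrier F" using assms(1) relations_carrier by blast
  have bc: "b + c \<in> carrier F" using assms keys_add[of b c] by auto
  have "a = (a - b - c) + (b + c)" by simp
  then have "cls a = cls (a - b - c) \<oplus>\<^bsub>T\<^esub> cls (b + c)" using class_add[OF abc bc] by simp
  also have "\<dots> = cls b \<oplus>\<^bsub>T\<^esub> cls c"
    using class_eq_zero[OF relation_in_kernel[OF assms(1)]] class_add[OF assms(2,3)]
      class_carrier[OF assms(2)] class_carrier[OF assms(3)] by simp
  finally show ?thesis .
qed

lemma pure_add_left:
  "x \<in> carrier N \<Longrightarrow> y \<in> carrier N \<Longrightarrow> v \<in> carrier V \<Longrightarrow> pure (x \<oplus>\<^bsub>N\<^esub> y) v = pure x v \<oplus>\<^bsub>T\<^esub> pure y v"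
  unfolding pure_def by (rule class_eq_add) (auto simp: tensor_relations_def)

lemma pure_add_right:
  "x \<in> carrier N \<Longrightarrow> v \<in> carrier V \<Longrightarrow> w \<in> carrier V \<Longrightarrow> pure x (v \<oplus>\<^bsub>V\<^esub> w) = pure x v \<oplus>\<^bsub>T\<^esub> pure x w"
  unfolding pure_def by (rule class_eq_add) (auto simp: tensor_relations_def)

lemma pure_balanced:
  assumes "c \<in> carrier K" "x \<in> carrier N" "v \<in> carrier V"
  shows "pure (c \<odot>\<^bsub>N\<^esub> x) v = pure x (c \<odot>\<^bsub>V\<^esub> v)"
proof -
  have "frag_of (c \<odot>\<^bsub>N\<^esub> x, v) - frag_of (x, c \<odot>\<^bsub>V\<^esub> v) - 0 \<in> tensor_relations K N V"
    unfolding tensor_relations_def using assms by auto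
  then have "pure (c \<odot>\<^bsub>N\<^esub> x) v = pure x (c \<odot>\<^bsub>V\<^esub> v) \<oplus>\<^bsub>T\<^esub> cls 0"
    unfolding pure_def by (rule class_eq_add) (use assms V_smult in auto)
  then show ?thesis using assms V_smult class_zero by simp
qed

lemma pure_left_additive: "v \<in> carrier V \<Longrightarrow> (\<lambda>x. pure x v) \<in> additive_maps N T"
  by (rule additive_mapsI) (simp_all add: pure_add_left)

lemma pure_zero_left: "v \<in> carrier V \<Longrightarrow> pure \<zero>\<^bsub>N\<^esub> v = \<zero>\<^bsub>T\<^esub>"
  using additive_zero[OF N.abelian_group_axioms T.abelian_group_axioms pure_left_additive] by blast

lemma pure_minus_left: "x \<in> carrier N \<Longrightarrow> v \<in> carrier V \<Longrightarrow> pure (\<ominus>\<^bsub>N\<^esub> x) v = \<ominus>\<^bsub>T\<^esub> pure x v"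
  using additive_minus[OF N.abelian_group_axioms T.abelian_group_axioms pure_left_additive] by blast

text \<open>The subgroup \<open>A\<close> of the left factor serves for the homogeneous parts of a graded tensor
  product.\<close>

lemma class_induct:
  assumes A: "additive_subgroup A N" and x: "x \<in> carrier (free_Abelian_group (A \<times> carrier V))"
    and pure: "\<And>n v. n \<in> A \<Longrightarrow> v \<in> carrier V \<Longrightarrow> P (pure n v)"
    and add: "\<And>X Y. X \<in> carrier T \<Longrightarrow> Y \<in> carrier T \<Longrightarrow> P X \<Longrightarrow> P Y \<Longrightarrow> P (X \<oplus>\<^bsub>T\<^esub> Y)"
  shows "P (cls x)"
proof -
  have sub: "y \<in> carrier F" if "Poly_Mapping.keys y \<subseteq> A \<times> carrier V" for y
    using that additive_subgroup.a_subset[OF A] by auto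
  have "P (cls x) \<and> P (\<ominus>\<^bsub>T\<^esub> cls x)"
  proof (rule free_Abelian_group_induct)
    show "Poly_Mapping.keys x \<subseteq> A \<times> carrier V" using x by simp
    have "P (pure \<zero>\<^bsub>N\<^esub> \<zero>\<^bsub>V\<^esub>)" by (rule pure) (simp_all add: additive_subgroup.zero_closed[OF A])
    then have "P \<zero>\<^bsub>T\<^esub>" by (simp add: pure_zero_left)
    moreover have minus_zero: "\<ominus>\<^bsub>T\<^esub> \<zero>\<^bsub>T\<^esub> = \<zero>\<^bsub>T\<^esub>" by (rule T.minus_equality) simp_all
    ultimately show "P (cls 0) \<and> P (\<ominus>\<^bsub>T\<^esub> cls 0)" unfolding class_zero minus_zero by blast
  next
    fix y z assume yz: "Poly_Mapping.keys y \<subseteq> A \<times> carrier V" "Poly_Mapping.keys z \<subseteq> A \<times> carrier V"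
      and IH: "P (cls y) \<and> P (\<ominus>\<^bsub>T\<^esub> cls y)" "P (cls z) \<and> P (\<ominus>\<^bsub>T\<^esub> cls z)"
    note car = sub[OF yz(1)] sub[OF yz(2)]
    have m: "- z \<in> carrier F" using car(2) by simp
    have "cls (y - z) = cls y \<oplus>\<^bsub>T\<^esub> \<ominus>\<^bsub>T\<^esub> cls z"
      using class_add[OF car(1) m] class_minus[OF car(2)] by simp
    moreover have "\<ominus>\<^bsub>T\<^esub> (cls y \<oplus>\<^bsub>T\<^esub> \<ominus>\<^bsub>T\<^esub> cls z) = \<ominus>\<^bsub>T\<^esub> cls y \<oplus>\<^bsub>T\<^esub> cls z"
      using class_carrier[OF car(1)] class_carrier[OF car(2)] by (simp add: T.minus_add)
    ultimately show "P (cls (y - z)) \<and> P (\<ominus>\<^bsub>T\<^esub> cls (y - z))"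
      using IH class_carrier[OF car(1)] class_carrier[OF car(2)] by (simp add: add)
  next
    fix p assume "p \<in> A \<times> carrier V"
    then obtain n v where p: "p = (n, v)" "n \<in> A" "v \<in> carrier V" by auto
    have n: "n \<in> carrier N" using additive_subgroup.a_Hcarr[OF A p(2)] .
    have m: "\<ominus>\<^bsub>N\<^esub> n \<in> A"
      using additive_subgroup.a_subgroup[OF A] p(2) subgroup.m_inv_closed unfolding a_inv_def by metis
    show "P (cls (frag_of p)) \<and> P (\<ominus>\<^bsub>T\<^esub> cls (frag_of p))"
      using pure[OF p(2,3)] pure[OF m p(3)] pure_minus_left[OF n p(3)] p(1) by (simp add: pure_def)
  qed
  then show ?thesis ..
qed

lemma carrier_additive_subgroup: "additive_subgroup (carrier N) N"
  by (intro additive_subgroup.intro N.add.subgroup_self)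

lemma tensor_induct [consumes 1, case_names pure add]:
  assumes "X \<in> carrier T"
    and "\<And>n v. n \<in> carrier N \<Longrightarrow> v \<in> carrier V \<Longrightarrow> P (pure n v)"
    and "\<And>X Y. X \<in> carrier T \<Longrightarrow> Y \<in> carrier T \<Longrightarrow> P X \<Longrightarrow> P Y \<Longrightarrow> P (X \<oplus>\<^bsub>T\<^esub> Y)"
  shows "P X"
proof -
  obtain x where x: "x \<in> carrier F" "X = cls x" using assms(1) unfolding tensor_simps by blast
  show ?thesis unfolding x(2)
    by (rule class_induct[OF carrier_additive_subgroup x(1)]) (use assms(2,3) in blast)+
qed

lemma additive_eq_on_tensor:
  assumes "f \<in> additive_maps T S" "g \<in> additive_maps T S"
    and "\<And>n v. n \<in> carrier N \<Longrightarrow> v \<in> carrier V \<Longrightarrow> f (pure n v) = g (pure n v)" and "X \<in> carrier T"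
  shows "f X = g X"
  using assms(4)
  by (induction X rule: tensor_induct)
    (simp_all add: assms(3) additive_add[OF assms(1)] additive_add[OF assms(2)])

definition balanced_map :: "('s, 't) ring_scheme \<Rightarrow> ('n \<times> 'v \<Rightarrow> 's) \<Rightarrow> bool" where
  "balanced_map S b \<longleftrightarrow>
    (\<forall>x\<in>carrier N. \<forall>v\<in>carrier V. b (x, v) \<in> carrier S) \<and>
    (\<forall>x\<in>carrier N. \<forall>y\<in>carrier N. \<forall>v\<in>carrier V. b (x \<oplus>\<^bsub>N\<^esub> y, v) = b (x, v) \<oplus>\<^bsub>S\<^esub> b (y, v)) \<and>
    (\<forall>x\<in>carrier N. \<forall>v\<in>carrier V. \<forall>w\<in>carrier V. b (x, v \<oplus>\<^bsub>V\<^esub> w) = b (x, v) \<oplus>\<^bsub>S\<^esub> b (x, w)) \<and>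
    (\<forall>c\<in>carrier K. \<forall>x\<in>carrier N. \<forall>v\<in>carrier V. b (c \<odot>\<^bsub>N\<^esub> x, v) = b (x, c \<odot>\<^bsub>V\<^esub> v))"

lemma balanced_hom_kills_relations:
  assumes S: "abelian_group S" and h: "h \<in> hom F (add_monoid S)"
    and bal: "balanced_map S (\<lambda>p. h (frag_of p))" and x: "x \<in> tensor_relations K N V"
  shows "h x = \<zero>\<^bsub>S\<^esub>"
proof -
  interpret S: abelian_group S by fact
  interpret h: group_hom F "add_monoid S" h
    using S.a_group h by (simp add: group_hom_def group_hom_axioms_def)
  have c: "h p \<in> carrier S" if "p \<in> carrier F" for p using h.hom_closed[OF that] by simp
  have diff: "h (p - q) = h p \<oplus>\<^bsub>S\<^esub> \<ominus>\<^bsub>S\<^esub> h q" "p - q \<in> carrier F"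
    if "p \<in> carrier F" "q \<in> carrier F" for p q
  proof -
    have "h (p + - q) = h p \<oplus>\<^bsub>S\<^esub> h (- q)" using h.hom_mult[of p "- q"] that by simp
    moreover have "h (- q) = \<ominus>\<^bsub>S\<^esub> h q" using h.hom_inv[of q] that by (simp add: a_inv_def)
    ultimately show "h (p - q) = h p \<oplus>\<^bsub>S\<^esub> \<ominus>\<^bsub>S\<^esub> h q" by simp
    show "p - q \<in> carrier F" using that keys_diff[of p q] by auto
  qed
  have three: "h (p - q - r) = \<zero>\<^bsub>S\<^esub>"
    if "p \<in> carrier F" "q \<in> carrier F" "r \<in> carrier F" "h p = h q \<oplus>\<^bsub>S\<^esub> h r" for p q r
    using that c by (simp only: diff S.add_minus_minus)
  have two: "h (p - q) = \<zero>\<^bsub>S\<^esub>" if "p \<in> carrier F" "q \<in> carrier F" "h p = h q" for p q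
    using that c by (simp only: diff S.r_neg)
  have F: "frag_of (x, v) \<in> carrier F" if "x \<in> carrier N" "v \<in> carrier V" for x v using that by simp
  show ?thesis
    using x bal N_smult V_smult unfolding tensor_relations_def balanced_map_def
    by (elim UnE CollectE exE conjE; hypsubst; intro three two F; simp)
qed

text \<open>Maps out of a tensor product are defined by representatives; this makes them independent of the
  choice.\<close>

lemma hom_constant_on_class:
  assumes S: "group S" and h: "h \<in> hom F S"
    and rel: "\<And>x. x \<in> tensor_relations K N V \<Longrightarrow> h x = \<one>\<^bsub>S\<^esub>"
    and x: "x \<in> carrier F" and y: "y \<in> cls x"
  shows "h y = h x"
proof -
  interpret h: group_hom F S h
    using S h by (simp add: group_hom_def group_hom_axioms_def)
  have "tensor_kernel K N V \<subseteq> kernel F S h"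
    unfolding tensor_kernel_def
    by (rule group.generate_subgroup_incl[OF group_free_Abelian_group _ h.subgroup_kernel])
      (use rel relations_carrier in \<open>unfold kernel_def, blast\<close>)
  moreover obtain k where k: "k \<in> tensor_kernel K N V" "y = k + x"
    using y unfolding tensor_class_def r_coset_def by auto
  ultimately have "k \<in> carrier F" "h k = \<one>\<^bsub>S\<^esub>" unfolding kernel_def by blast+
  then show ?thesis using h.hom_mult[of k x] x k(2) h.hom_closed[OF x] h.H.l_one[of "h x"] by simp
qed

lemma class_self: "x \<in> carrier F \<Longrightarrow> x \<in> cls x"
  unfolding tensor_class_def by (rule group.rcos_self[OF group_free_Abelian_group _ kernel_subgroup])

text \<open>The right-hand side is the sum by which maps out of a tensor product are defined.\<close>

lemma hom_free_eq_sum: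
  assumes S: "abelian_group S" and h: "h \<in> hom (free_Abelian_group B) (add_monoid S)"
    and x: "Poly_Mapping.keys x \<subseteq> B"
  shows "h x = (\<Oplus>\<^bsub>S\<^esub>p\<in>Poly_Mapping.keys x. add_pow S (Poly_Mapping.lookup x p) (h (frag_of p)))"
proof -
  interpret S: abelian_group S by fact
  interpret h: group_hom "free_Abelian_group B" "add_monoid S" h
    using S.a_group h by (simp add: group_hom_def group_hom_axioms_def)
  have one: "h (frag_cmul n (frag_of p)) = add_pow S n (h (frag_of p))" if "p \<in> B" for n p
    using h.hom_int_pow[of "frag_of p" n] that by (simp add: int_pow_free_Abelian_group add_pow_def)
  have "h (\<Sum>p\<in>A. frag_cmul (Poly_Mapping.lookup x p) (frag_of p)) =
      (\<Oplus>\<^bsub>S\<^esub>p\<in>A. add_pow S (Poly_Mapping.lookup x p) (h (frag_of p)))" if "finite A" "A \<subseteq> B" for A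
    using that
  proof (induction A)
    case empty
    show ?case using h.hom_one by simp
  next
    case (insert p A)
    have car: "frag_cmul (Poly_Mapping.lookup x q) (frag_of q) \<in> carrier (free_Abelian_group B)" if "q \<in> B" for q
      using that keys_cmul by (simp, force)
    have A: "(\<Sum>p\<in>A. frag_cmul (Poly_Mapping.lookup x p) (frag_of p)) \<in> carrier (free_Abelian_group B)"
      by (rule sum_closed_free_Abelian_group, rule car) (use insert in auto)
    have c: "h (frag_of q) \<in> carrier S" if "q \<in> B" for q using h.hom_closed[of "frag_of q"] that by simp
    have cA: "(\<lambda>p. add_pow S (Poly_Mapping.lookup x p) (h (frag_of p))) \<in> A \<rightarrow> carrier S"
      "add_pow S (Poly_Mapping.lookup x p) (h (frag_of p)) \<in> carrier S"
      using c insert.prems by auto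
    show ?case
      using insert h.hom_mult[OF car A] one by (simp add: S.finsum_insert cA)
  qed
  then show ?thesis
    using x frag_expansion[of x] by (metis finite_keys frag_extend_def)
qed

theorem tensor_lift:
  assumes S: "abelian_group S" and b: "balanced_map S b"
  shows tensor_lift_additive: "tensor_lift S b \<in> additive_maps T S"
    and tensor_lift_pure: "\<And>x v. x \<in> carrier N \<Longrightarrow> v \<in> carrier V \<Longrightarrow> tensor_lift S b (pure x v) = b (x, v)"
proof -
  interpret S: abelian_group S by fact
  have "b ` (carrier N \<times> carrier V) \<subseteq> carrier (add_monoid S)"
    using b by (auto simp: balanced_map_def)
  then obtain h where h: "h \<in> hom F (add_monoid S)" and hb: "\<And>p. p \<in> carrier N \<times> carrier V \<Longrightarrow> h (frag_of p) = b p"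
    using comm_group.free_Abelian_group_universal[OF S.a_comm_group] by blast
  interpret h: group_hom F "add_monoid S" h
    using S.a_group h by (simp add: group_hom_def group_hom_axioms_def)
  have "balanced_map S (\<lambda>p. h (frag_of p))"
    using b hb N_smult V_smult by (simp add: balanced_map_def)
  then have rel: "h x = \<one>\<^bsub>add_monoid S\<^esub>" if "x \<in> tensor_relations K N V" for x
    using balanced_hom_kills_relations[OF S h _ that] by simp
  have lift: "tensor_lift S b (cls x) = h x" if x: "x \<in> carrier F" for x
  proof -
    have "(\<Oplus>\<^bsub>S\<^esub>p\<in>Poly_Mapping.keys y. add_pow S (Poly_Mapping.lookup y p) (b p)) = h x" if y: "y \<in> cls x" for y
    proof -
      have yF: "Poly_Mapping.keys y \<subseteq> carrier N \<times> carrier V"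
        using subgroup.elemrcos_carrier[OF kernel_subgroup group_free_Abelian_group x] y
        unfolding tensor_class_def by simp
      have "h y = (\<Oplus>\<^bsub>S\<^esub>p\<in>Poly_Mapping.keys y. add_pow S (Poly_Mapping.lookup y p) (h (frag_of p)))"
        by (rule hom_free_eq_sum[OF S h yF])
      also have "\<dots> = (\<Oplus>\<^bsub>S\<^esub>p\<in>Poly_Mapping.keys y. add_pow S (Poly_Mapping.lookup y p) (b p))"
        using yF hb b by (intro S.finsum_cong') (auto simp: balanced_map_def subset_iff)
      finally show ?thesis using hom_constant_on_class[OF S.a_group h rel x y] by simp
    qed
    then have "(\<lambda>y. \<Oplus>\<^bsub>S\<^esub>p\<in>Poly_Mapping.keys y. add_pow S (Poly_Mapping.lookup y p) (b p)) ` cls x = {h x}"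
      using class_self[OF x] by (auto simp: image_iff)
    then show ?thesis unfolding tensor_lift_def by simp
  qed
  show "tensor_lift S b \<in> additive_maps T S"
  proof (rule additive_mapsI)
    fix X assume "X \<in> carrier T"
    then obtain x where x: "x \<in> carrier F" "X = cls x" unfolding tensor_simps by blast
    then show "tensor_lift S b X \<in> carrier S" using lift[OF x(1)] h.hom_closed[OF x(1)] by simp
    fix Y assume "Y \<in> carrier T"
    then obtain y where y: "y \<in> carrier F" "Y = cls y" unfolding tensor_simps by blast
    have xy: "x + y \<in> carrier F" using x(1) y(1) keys_add[of x y] by auto
    have "X \<oplus>\<^bsub>T\<^esub> Y = cls (x + y)" using class_add x y by simp
    then show "tensor_lift S b (X \<oplus>\<^bsub>T\<^esub> Y) = tensor_lift S b X \<oplus>\<^bsub>S\<^esub> tensor_lift S b Y"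
      using lift[OF x(1)] lift[OF y(1)] lift[OF xy] h.hom_mult[OF x(1) y(1)] x(2) y(2) by simp
  qed
  show "tensor_lift S b (pure x v) = b (x, v)" if "x \<in> carrier N" "v \<in> carrier V" for x v
    unfolding pure_def using lift[of "frag_of (x, v)"] hb[of "(x, v)"] that by simp
qed

text \<open>The product with a scalar is defined as a union over the representatives of a class. All of them yield
  the same class, because a scalar that commutes with \<open>K\<close> preserves the relations.\<close>

lemma tensor_smult:
  assumes r: "\<And>x. x \<in> carrier N \<Longrightarrow> r \<odot>\<^bsub>N\<^esub> x \<in> carrier N"
    "\<And>x y. x \<in> carrier N \<Longrightarrow> y \<in> carrier N \<Longrightarrow> r \<odot>\<^bsub>N\<^esub> (x \<oplus>\<^bsub>N\<^esub> y) = r \<odot>\<^bsub>N\<^esub> x \<oplus>\<^bsub>N\<^esub> r \<odot>\<^bsub>N\<^esub> y"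
    "\<And>c x. c \<in> carrier K \<Longrightarrow> x \<in> carrier N \<Longrightarrow> r \<odot>\<^bsub>N\<^esub> (c \<odot>\<^bsub>N\<^esub> x) = c \<odot>\<^bsub>N\<^esub> (r \<odot>\<^bsub>N\<^esub> x)"
  shows tensor_smult_additive: "(\<lambda>X. r \<odot>\<^bsub>T\<^esub> X) \<in> additive_maps T T"
    and tensor_smult_pure: "\<And>x v. x \<in> carrier N \<Longrightarrow> v \<in> carrier V \<Longrightarrow> r \<odot>\<^bsub>T\<^esub> pure x v = pure (r \<odot>\<^bsub>N\<^esub> x) v"
proof -
  let ?g = "frag_extend (\<lambda>(n, v). frag_of (r \<odot>\<^bsub>N\<^esub> n, v))"
  have g_car: "?g x \<in> carrier F" if "x \<in> carrier F" for x
  proof -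
    have "Poly_Mapping.keys (?g x) \<subseteq> (\<Union>p\<in>Poly_Mapping.keys x. Poly_Mapping.keys ((\<lambda>(n, v). frag_of (r \<odot>\<^bsub>N\<^esub> n, v)) p))"
      by (rule keys_frag_extend)
    also have "\<dots> \<subseteq> carrier N \<times> carrier V" using that r(1) by (auto simp: keys_frag_of)
    finally show ?thesis by simp
  qed
  define h where "h x = cls (?g x)" for x
  have h: "h \<in> hom F (add_monoid T)"
    using class_add g_car class_carrier by (auto simp: hom_def h_def frag_extend_add simp del: carrier_free_Abelian_group_iff)
  have h_of: "h (frag_of (x, v)) = pure (r \<odot>\<^bsub>N\<^esub> x) v" for x v by (simp add: h_def pure_def)
  have "balanced_map T (\<lambda>p. h (frag_of p))"
    using r N_smult V_smult by (simp add: balanced_map_def h_of pure_add_left pure_add_right pure_balanced)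
  then have rel: "h x = \<one>\<^bsub>add_monoid T\<^esub>" if "x \<in> tensor_relations K N V" for x
    using balanced_hom_kills_relations[OF tensor_abelian_group h _ that] by simp
  have smult: "r \<odot>\<^bsub>T\<^esub> cls x = h x" if x: "x \<in> carrier F" for x
  proof -
    have "r \<odot>\<^bsub>T\<^esub> cls x = (\<Union>y\<in>cls x. h y)" by (simp add: tensor_def Let_def h_def)
    also have "\<dots> = (\<Union>y\<in>cls x. h x)"
      using hom_constant_on_class[OF T.a_group h rel x] by simp
    also have "\<dots> = h x" using class_self[OF x] by blast
    finally show ?thesis .
  qed
  show "r \<odot>\<^bsub>T\<^esub> pure x v = pure (r \<odot>\<^bsub>N\<^esub> x) v" if "x \<in> carrier N" "v \<in> carrier V" for x v
    using smult[of "frag_of (x, v)"] that by (simp add: h_of pure_def)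
  show "(\<lambda>X. r \<odot>\<^bsub>T\<^esub> X) \<in> additive_maps T T"
  proof (rule additive_mapsI)
    fix X assume "X \<in> carrier T"
    then obtain x where x: "x \<in> carrier F" "X = cls x" unfolding tensor_simps by blast
    show "r \<odot>\<^bsub>T\<^esub> X \<in> carrier T" unfolding x(2) smult[OF x(1)] h_def by (rule class_carrier[OF g_car[OF x(1)]])
    fix Y assume "Y \<in> carrier T"
    then obtain y where y: "y \<in> carrier F" "Y = cls y" unfolding tensor_simps by blast
    have xy: "x + y \<in> carrier F" using x(1) y(1) keys_add[of x y] by auto
    have "X \<oplus>\<^bsub>T\<^esub> Y = cls (x + y)" using class_add x y by simp
    moreover have "h (x + y) = h x \<oplus>\<^bsub>T\<^esub> h y" using hom_mult[OF h x(1) y(1)] by simp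
    ultimately show "r \<odot>\<^bsub>T\<^esub> (X \<oplus>\<^bsub>T\<^esub> Y) = r \<odot>\<^bsub>T\<^esub> X \<oplus>\<^bsub>T\<^esub> r \<odot>\<^bsub>T\<^esub> Y"
      using smult[OF x(1)] smult[OF y(1)] smult[OF xy] x(2) y(2) by simp
  qed
qed

end

section \<open>Graded tensor products and direct sums\<close>

lemma (in graded_module) smult_additive: "r \<in> carrier R \<Longrightarrow> (\<lambda>x. r \<odot>\<^bsub>M\<^esub> x) \<in> additive_maps M M"
  by (rule additive_mapsI) (simp_all add: smult_r_distr)

lemma (in graded_module) hcomp_smult:
  assumes r: "r \<in> rpart R 0" and x: "x \<in> carrier M"
  shows "M_parts.hcomp (r \<odot>\<^bsub>M\<^esub> x) = (\<lambda>a. r \<odot>\<^bsub>M\<^esub> M_parts.hcomp x a)"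
proof (rule M_parts.hcomp_unique)
  let ?A = "{a. M_parts.hcomp x a \<noteq> \<zero>\<^bsub>M\<^esub>}"
  have rc: "r \<in> carrier R" using r R_parts.part_carrier by blast
  show "finite ?A" by (rule M_parts.hcomp_finite[OF x])
  show "r \<odot>\<^bsub>M\<^esub> M_parts.hcomp x a \<in> mpart M a" for a
    using smult_degree[OF r M_parts.hcomp_part[OF x, of a]] by simp
  show "r \<odot>\<^bsub>M\<^esub> M_parts.hcomp x a = \<zero>\<^bsub>M\<^esub>" if "a \<notin> ?A" for a using that rc by simp
  show "r \<odot>\<^bsub>M\<^esub> x = (\<Oplus>\<^bsub>M\<^esub>a\<in>?A. r \<odot>\<^bsub>M\<^esub> M_parts.hcomp x a)"
    using additive_finsum[OF M.abelian_group_axioms M.abelian_group_axioms smult_additive[OF rc],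
        of "M_parts.hcomp x" ?A] M_parts.hcomp_sum[OF x] x by simp
qed

locale graded_tensor_factors = N: graded_module R N + V: abelian_group V
  for R :: "('g::ab_group_add, 'r) graded_ring" and K :: "('r, 'z) ring_scheme"
    and N :: "('g, 'r, 'n) graded_module" and V :: "('r, 'v, 'y) module_scheme" +
  assumes K: "carrier K \<subseteq> rpart R 0"
    and V_smult: "\<And>c v. c \<in> carrier K \<Longrightarrow> v \<in> carrier V \<Longrightarrow> c \<odot>\<^bsub>V\<^esub> v \<in> carrier V"
begin

lemma K_carrier: "c \<in> carrier K \<Longrightarrow> c \<in> carrier R"
  using K N.R_parts.part_carrier by blast

sublocale tensor_factors K N V
  by unfold_locales (simp_all add: K_carrier V_smult)

lemma smult_commute:
  assumes "r \<in> carrier R" "c \<in> carrier K" "x \<in> carrier N"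
  shows "r \<odot>\<^bsub>N\<^esub> (c \<odot>\<^bsub>N\<^esub> x) = c \<odot>\<^bsub>N\<^esub> (r \<odot>\<^bsub>N\<^esub> x)"
  using N.smult_assoc1[of r c x] N.smult_assoc1[of c r x] N.m_comm[of r c] assms K_carrier by simp

lemma T_smult_additive: "r \<in> carrier R \<Longrightarrow> (\<lambda>X. r \<odot>\<^bsub>T\<^esub> X) \<in> additive_maps T T"
  by (rule tensor_smult_additive) (auto simp: N.smult_r_distr smult_commute)

lemma T_smult_pure:
  "r \<in> carrier R \<Longrightarrow> x \<in> carrier N \<Longrightarrow> v \<in> carrier V \<Longrightarrow> r \<odot>\<^bsub>T\<^esub> pure x v = pure (r \<odot>\<^bsub>N\<^esub> x) v"
  by (rule tensor_smult_pure) (auto simp: N.smult_r_distr smult_commute)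

lemma T_smult_closed: "r \<in> carrier R \<Longrightarrow> X \<in> carrier T \<Longrightarrow> r \<odot>\<^bsub>T\<^esub> X \<in> carrier T"
  by (rule additive_closed[OF T_smult_additive])

lemma T_smult_add:
  "r \<in> carrier R \<Longrightarrow> X \<in> carrier T \<Longrightarrow> Y \<in> carrier T \<Longrightarrow> r \<odot>\<^bsub>T\<^esub> (X \<oplus>\<^bsub>T\<^esub> Y) = r \<odot>\<^bsub>T\<^esub> X \<oplus>\<^bsub>T\<^esub> r \<odot>\<^bsub>T\<^esub> Y"
  by (rule additive_add[OF T_smult_additive])

lemma module_tensor: "module R T"
proof (rule moduleI[OF N.is_cring tensor_abelian_group])
  show "(a \<oplus>\<^bsub>R\<^esub> b) \<odot>\<^bsub>T\<^esub> X = a \<odot>\<^bsub>T\<^esub> X \<oplus>\<^bsub>T\<^esub> b \<odot>\<^bsub>T\<^esub> X"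
    if "a \<in> carrier R" "b \<in> carrier R" "X \<in> carrier T" for a b X
    using that(3)
  proof (induction X rule: tensor_induct)
    case (add X Y)
    have "a \<odot>\<^bsub>T\<^esub> X \<in> carrier T" "b \<odot>\<^bsub>T\<^esub> X \<in> carrier T" "a \<odot>\<^bsub>T\<^esub> Y \<in> carrier T" "b \<odot>\<^bsub>T\<^esub> Y \<in> carrier T"
      using that add T_smult_closed by blast+
    with add that show ?case by (simp add: T_smult_add T.a_ac)
  qed (use that in \<open>simp add: T_smult_pure N.smult_l_distr pure_add_left\<close>)
  show "(a \<otimes>\<^bsub>R\<^esub> b) \<odot>\<^bsub>T\<^esub> X = a \<odot>\<^bsub>T\<^esub> (b \<odot>\<^bsub>T\<^esub> X)"
    if "a \<in> carrier R" "b \<in> carrier R" "X \<in> carrier T" for a b X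
    using that(3)
    by (induction X rule: tensor_induct)
      (use that in \<open>simp_all add: T_smult_pure N.smult_assoc1 T_smult_add T_smult_closed\<close>)
  show "\<one>\<^bsub>R\<^esub> \<odot>\<^bsub>T\<^esub> X = X" if "X \<in> carrier T" for X
    using that by (induction X rule: tensor_induct) (simp_all add: T_smult_pure T_smult_add)
qed (simp_all add: T_smult_closed T_smult_add)

definition T_part :: "'g \<Rightarrow> ('n \<times> 'v \<Rightarrow>\<^sub>0 int) set set" where
  "T_part a = cls ` carrier (free_Abelian_group (mpart N a \<times> carrier V))"

lemma T_part_induct [consumes 1, case_names pure add]:
  assumes "X \<in> T_part a"
    and "\<And>n v. n \<in> mpart N a \<Longrightarrow> v \<in> carrier V \<Longrightarrow> P (pure n v)"
    and "\<And>X Y. X \<in> carrier T \<Longrightarrow> Y \<in> carrier T \<Longrightarrow> P X \<Longrightarrow> P Y \<Longrightarrow> P (X \<oplus>\<^bsub>T\<^esub> Y)"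
  shows "P X"
proof -
  obtain x where x: "x \<in> carrier (free_Abelian_group (mpart N a \<times> carrier V))" "X = cls x"
    using assms(1) unfolding T_part_def by blast
  show ?thesis unfolding x(2)
    by (rule class_induct[OF N.M_parts.part_subgroup x(1)]) (use assms(2,3) in blast)+
qed

lemma T_part_pure: "n \<in> mpart N a \<Longrightarrow> v \<in> carrier V \<Longrightarrow> pure n v \<in> T_part a"
  unfolding T_part_def pure_def by (rule imageI) simp

lemma free_part_carrier:
  "x \<in> carrier (free_Abelian_group (mpart N a \<times> carrier V)) \<Longrightarrow> x \<in> carrier F"
  using N.M_parts.part_carrier by auto

lemma T_part_subgroup: "additive_subgroup (T_part a) T"
proof (rule T.additive_subgroupI)
  let ?S = "free_Abelian_group (mpart N a \<times> carrier V)"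
  show "T_part a \<subseteq> carrier T" unfolding T_part_def using class_carrier free_part_carrier by blast
  have "0 \<in> carrier ?S" by simp
  then show "\<zero>\<^bsub>T\<^esub> \<in> T_part a" unfolding T_part_def class_zero[symmetric] by (rule imageI)
  fix X assume "X \<in> T_part a"
  then obtain x where x: "x \<in> carrier ?S" "X = cls x" unfolding T_part_def by blast
  have m: "- x \<in> carrier ?S" using x(1) by simp
  have "cls (- x) \<oplus>\<^bsub>T\<^esub> X = \<zero>\<^bsub>T\<^esub>"
    using class_minus[OF free_part_carrier[OF x(1)]] class_carrier[OF free_part_carrier[OF x(1)]] x(2)
    by (simp add: T.l_neg)
  moreover have "cls (- x) \<in> T_part a" unfolding T_part_def by (rule imageI[OF m])
  ultimately show "\<exists>Y\<in>T_part a. Y \<oplus>\<^bsub>T\<^esub> X = \<zero>\<^bsub>T\<^esub>" by blast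
  fix Y assume "Y \<in> T_part a"
  then obtain y where y: "y \<in> carrier ?S" "Y = cls y" unfolding T_part_def by blast
  have xy: "x + y \<in> carrier ?S" using x(1) y(1) keys_add[of x y] by auto
  have "X \<oplus>\<^bsub>T\<^esub> Y = cls (x + y)"
    using class_add[OF free_part_carrier[OF x(1)] free_part_carrier[OF y(1)]] x(2) y(2) by simp
  then show "X \<oplus>\<^bsub>T\<^esub> Y \<in> T_part a" unfolding T_part_def using xy by blast
qed

lemma T_part_carrier: "X \<in> T_part a \<Longrightarrow> X \<in> carrier T"
  by (rule additive_subgroup.a_Hcarr[OF T_part_subgroup])

text \<open>The parts of the tensor product are independent because the projections of the left factor onto
  its components induce projections of the tensor product.\<close>

definition T_proj :: "'g \<Rightarrow> ('n \<times> 'v \<Rightarrow>\<^sub>0 int) set \<Rightarrow> ('n \<times> 'v \<Rightarrow>\<^sub>0 int) set" where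
  "T_proj a = tensor_lift T (\<lambda>(n, v). pure (N.M_parts.hcomp n a) v)"

lemma T_proj_balanced: "balanced_map T (\<lambda>(n, v). pure (N.M_parts.hcomp n a) v)"
  unfolding balanced_map_def using K
  by (auto simp: N.M_parts.hcomp_add pure_add_left pure_add_right N.hcomp_smult pure_balanced)

lemma T_proj_additive: "T_proj a \<in> additive_maps T T"
  unfolding T_proj_def by (rule tensor_lift_additive[OF tensor_abelian_group T_proj_balanced])

lemma T_proj_pure: "n \<in> carrier N \<Longrightarrow> v \<in> carrier V \<Longrightarrow> T_proj a (pure n v) = pure (N.M_parts.hcomp n a) v"
  unfolding T_proj_def by (subst tensor_lift_pure[OF tensor_abelian_group T_proj_balanced]) auto

lemma T_proj_part: "X \<in> T_part b \<Longrightarrow> T_proj a X = (if a = b then X else \<zero>\<^bsub>T\<^esub>)"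
proof (induction X rule: T_part_induct)
  case (pure n v)
  then show ?case
    using N.M_parts.part_carrier by (simp add: T_proj_pure N.M_parts.hcomp_homogeneous pure_zero_left)
next
  case (add X Y)
  then show ?case by (simp add: additive_add[OF T_proj_additive])
qed

lemma T_direct_parts: "direct_parts R T T_part"
proof (intro direct_parts.intro direct_parts_axioms.intro module_tensor N.graded_ring_axioms T_part_subgroup)
  fix a b r X assume r: "r \<in> rpart R b" and X: "X \<in> T_part a"
  have rc: "r \<in> carrier R" using r N.R_parts.part_carrier by blast
  show "r \<odot>\<^bsub>T\<^esub> X \<in> T_part (b + a)"
    using X
  proof (induction X rule: T_part_induct)
    case (pure n v)
    have "r \<odot>\<^bsub>T\<^esub> pure n v = pure (r \<odot>\<^bsub>N\<^esub> n) v"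
      by (rule T_smult_pure[OF rc N.M_parts.part_carrier[OF pure(1)] pure(2)])
    then show ?case using T_part_pure[OF N.smult_degree[OF r pure(1)] pure(2)] by simp
  next
    case (add X Y)
    then show ?case
      using additive_subgroup.a_closed[OF T_part_subgroup] by (simp add: T_smult_add rc)
  qed
next
  fix A f a assume A: "finite A" "f \<in> Pi A T_part" "finsum T f A = \<zero>\<^bsub>T\<^esub>" "a \<in> A"
  have f: "f \<in> A \<rightarrow> carrier T" using A(2) T_part_carrier by blast
  have "\<zero>\<^bsub>T\<^esub> = T_proj a (finsum T f A)"
    using additive_zero[OF tensor_abelian_group tensor_abelian_group T_proj_additive] A(3) by simp
  also have "\<dots> = (\<Oplus>\<^bsub>T\<^esub>b\<in>A. T_proj a (f b))"
    by (rule additive_finsum[OF tensor_abelian_group tensor_abelian_group T_proj_additive f])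
  also have "\<dots> = (\<Oplus>\<^bsub>T\<^esub>b\<in>A. if a = b then f b else \<zero>\<^bsub>T\<^esub>)"
    using A(2) f by (intro T.finsum_cong') (auto simp: T_proj_part Pi_iff)
  also have "\<dots> = f a" using A(1,4) f by (intro T.add.finprod_singleton)
  finally show "f a = \<zero>\<^bsub>T\<^esub>" by simp
qed

lemma graded_tensor_simps [simp]:
  "carrier (graded_tensor K N V) = carrier T" "\<zero>\<^bsub>graded_tensor K N V\<^esub> = \<zero>\<^bsub>T\<^esub>"
  "X \<oplus>\<^bsub>graded_tensor K N V\<^esub> Y = X \<oplus>\<^bsub>T\<^esub> Y" "r \<odot>\<^bsub>graded_tensor K N V\<^esub> X = r \<odot>\<^bsub>T\<^esub> X"
  "mpart (graded_tensor K N V) = T_part"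
  by (simp_all add: graded_tensor_def module.extend_def graded_module.fields_def T_part_def[abs_def])

lemma graded_module_tensor: "graded_module R (graded_tensor K N V)"
proof -
  have "X \<in> part_sums T T_part" if "X \<in> carrier T" for X
    using that
  proof (induction X rule: tensor_induct)
    case (pure n v)
    then show ?case
    proof (induction n rule: N.M_parts.homogeneous_induct)
      case (homogeneous a n)
      then show ?case by (intro direct_parts.part_in_part_sums[OF T_direct_parts] T_part_pure)
    next
      case (add n m)
      then show ?case by (simp add: pure_add_left direct_parts.part_sums_add[OF T_direct_parts])
    qed
  qed (rule direct_parts.part_sums_add[OF T_direct_parts])
  then have "part_sums T T_part = carrier T"
    using direct_parts.part_sums_carrier[OF T_direct_parts] by blast
  then have "graded_tensor K N V = module_of_parts T T_part"
    by (simp add: graded_tensor_def module.extend_def graded_module.fields_def T_part_def[abs_def] module_of_parts_def)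
  then show ?thesis using direct_parts.graded_module_of_parts[OF T_direct_parts] by simp
qed

end

lemma direct_sum_simps [simp]:
  "\<zero>\<^bsub>direct_sum N\<^esub> = (\<lambda>i. \<zero>\<^bsub>N i\<^esub>)" "x \<oplus>\<^bsub>direct_sum N\<^esub> y = (\<lambda>i. x i \<oplus>\<^bsub>N i\<^esub> y i)"
  "r \<odot>\<^bsub>direct_sum N\<^esub> x = (\<lambda>i. r \<odot>\<^bsub>N i\<^esub> x i)"
  by (simp_all add: direct_sum_def)

lemma direct_sum_carrier:
  "x \<in> carrier (direct_sum N) \<longleftrightarrow> (\<forall>i. x i \<in> carrier (N i)) \<and> finite {i. x i \<noteq> \<zero>\<^bsub>N i\<^esub>}"
  by (simp add: direct_sum_def)

lemma direct_sum_part: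
  "x \<in> mpart (direct_sum N) a \<longleftrightarrow> (\<forall>i. x i \<in> mpart (N i) a) \<and> finite {i. x i \<noteq> \<zero>\<^bsub>N i\<^esub>}"
  by (simp add: direct_sum_def)

definition single :: "('i \<Rightarrow> ('r, 'm, 'x) module_scheme) \<Rightarrow> 'i \<Rightarrow> 'm \<Rightarrow> 'i \<Rightarrow> 'm" where
  "single N i y = (\<lambda>j. if j = i then y else \<zero>\<^bsub>N j\<^esub>)"

lemma single_support: "finite {j. single N i y j \<noteq> \<zero>\<^bsub>N j\<^esub>}"
  by (rule finite_subset[of _ "{i}"]) (auto simp: single_def)

locale direct_summands =
  fixes R :: "('g::ab_group_add, 'r) graded_ring" and N :: "'i \<Rightarrow> ('g, 'r, 'm) graded_module"
  assumes summand: "\<And>i. graded_module R (N i)"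
begin

abbreviation "S \<equiv> direct_sum N"

lemma summand_group: "abelian_group (N i)"
  by (rule graded_module_abelian_group[OF summand])

lemma summand_monoid: "abelian_monoid (N i)"
  using summand_group by (simp add: abelian_group_def)

lemmas [simp] = abelian_monoid.zero_closed[OF summand_monoid] abelian_monoid.a_closed[OF summand_monoid]
  abelian_monoid.l_zero[OF summand_monoid] abelian_monoid.r_zero[OF summand_monoid]

lemma single_carrier: "y \<in> carrier (N i) \<Longrightarrow> single N i y \<in> carrier S"
  unfolding direct_sum_carrier using single_support[of N i y] by (auto simp: single_def)

lemma single_add:
  "y \<in> carrier (N i) \<Longrightarrow> z \<in> carrier (N i) \<Longrightarrow> single N i (y \<oplus>\<^bsub>N i\<^esub> z) = single N i y \<oplus>\<^bsub>S\<^esub> single N i z"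
  by (auto simp: single_def)

lemma finite_support_add:
  assumes "finite {i. x i \<noteq> \<zero>\<^bsub>N i\<^esub>}" "finite {i. y i \<noteq> \<zero>\<^bsub>N i\<^esub>}"
  shows "finite {i. x i \<oplus>\<^bsub>N i\<^esub> y i \<noteq> \<zero>\<^bsub>N i\<^esub>}"
  by (rule finite_subset[OF _ finite_UnI[OF assms]]) auto

lemma direct_sum_induct [consumes 1, case_names single add]:
  assumes x: "x \<in> carrier S"
    and single: "\<And>i y. y \<in> carrier (N i) \<Longrightarrow> P (single N i y)"
    and add: "\<And>x y. x \<in> carrier S \<Longrightarrow> y \<in> carrier S \<Longrightarrow> P x \<Longrightarrow> P y \<Longrightarrow> P (x \<oplus>\<^bsub>S\<^esub> y)"
  shows "P x"
proof -
  have "P x" if "finite A" "{i. x i \<noteq> \<zero>\<^bsub>N i\<^esub>} \<subseteq> A" "\<forall>i. x i \<in> carrier (N i)" for x A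
    using that
  proof (induction A arbitrary: x)
    case empty
    then have "x = single N undefined \<zero>\<^bsub>N undefined\<^esub>" by (auto simp: single_def)
    then show ?case using single by simp
  next
    case (insert i A)
    let ?y = "x(i := \<zero>\<^bsub>N i\<^esub>)"
    have y: "{j. ?y j \<noteq> \<zero>\<^bsub>N j\<^esub>} \<subseteq> A" "\<forall>j. ?y j \<in> carrier (N j)" using insert.prems by auto
    have "finite {j. ?y j \<noteq> \<zero>\<^bsub>N j\<^esub>}" using y(1) insert.hyps(1) by (rule finite_subset)
    then have yS: "?y \<in> carrier S" unfolding direct_sum_carrier using y(2) by blast
    have xi: "x i \<in> carrier (N i)" using insert.prems by blast
    have "P (single N i (x i) \<oplus>\<^bsub>S\<^esub> ?y)"
      by (rule add[OF single_carrier[OF xi] yS single[OF xi] insert.IH[OF y]])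
    moreover have "single N i (x i) \<oplus>\<^bsub>S\<^esub> ?y = x" using insert.prems by (auto simp: single_def)
    ultimately show ?case by simp
  qed
  then show ?thesis using x unfolding direct_sum_carrier by blast
qed

text \<open>The direct sum lies inside the product of the underlying modules, where independence of the parts is
  known; the elements of finite support are exactly the sums of homogeneous ones of finite support.\<close>

lemma graded_module_direct_sum:
  assumes R: "graded_ring R"
  shows "graded_module R S"
proof -
  interpret R: graded_ring R by fact
  let ?P = "prod_module UNIV N" and ?C = "mpart S"
  interpret P: direct_parts R ?P "\<lambda>a. {x. \<forall>i. x i \<in> mpart (N i) a}"
    by (rule direct_parts_product[OF R summand])
  have sub: "?C a \<subseteq> {x. \<forall>i. x i \<in> mpart (N i) a}" for a by (auto simp: direct_sum_part)
  have parts: "direct_parts R ?P ?C"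
  proof (intro direct_parts.intro direct_parts_axioms.intro P.module_axioms R)
    fix a
    show "additive_subgroup (?C a) ?P"
    proof (rule P.M.additive_subgroupI)
      show "?C a \<subseteq> carrier ?P" using sub P.part_carrier by blast
      show "\<zero>\<^bsub>?P\<^esub> \<in> ?C a" using P.part_zero[of a] by (simp add: direct_sum_part)
    next
      fix x y assume xy: "x \<in> ?C a" "y \<in> ?C a"
      then have "x \<oplus>\<^bsub>?P\<^esub> y \<in> {x. \<forall>i. x i \<in> mpart (N i) a}" using sub P.part_add by blast
      then show "x \<oplus>\<^bsub>?P\<^esub> y \<in> ?C a"
        using xy finite_support_add[of x y] by (simp add: direct_sum_part)
    next
      fix x assume x: "x \<in> ?C a"
      let ?m = "(\<ominus>\<^bsub>R\<^esub> \<one>\<^bsub>R\<^esub>) \<odot>\<^bsub>?P\<^esub> x"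
      have xP: "x \<in> carrier ?P" using x sub P.part_carrier by blast
      have "?m \<in> {x. \<forall>i. x i \<in> mpart (N i) a}"
        using P.smult_part[OF R.R_parts.part_minus[OF R.one_part], of x a] x sub by (simp only: add_0) blast
      moreover have "finite {i. ?m i \<noteq> \<zero>\<^bsub>N i\<^esub>}"
      proof (rule finite_subset)
        show "{i. ?m i \<noteq> \<zero>\<^bsub>N i\<^esub>} \<subseteq> {i. x i \<noteq> \<zero>\<^bsub>N i\<^esub>}"
          using module.smult_r_null[OF graded_module_module[OF summand]] by auto
        show "finite {i. x i \<noteq> \<zero>\<^bsub>N i\<^esub>}" using x by (simp add: direct_sum_part)
      qed
      ultimately have "?m \<in> ?C a" unfolding direct_sum_part by blast
      moreover have "?m \<oplus>\<^bsub>?P\<^esub> x = \<zero>\<^bsub>?P\<^esub>"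
        using xP P.smult_l_minus[of "\<one>\<^bsub>R\<^esub>" x] P.M.l_neg[of x] by (simp only: P.smult_one R.one_closed)
      ultimately show "\<exists>y\<in>?C a. y \<oplus>\<^bsub>?P\<^esub> x = \<zero>\<^bsub>?P\<^esub>" by blast
    qed
  next
    fix a b r x assume r: "r \<in> rpart R b" and x: "x \<in> ?C a"
    have rc: "r \<in> carrier R" using r R.R_parts.part_carrier by blast
    have "r \<odot>\<^bsub>?P\<^esub> x \<in> {x. \<forall>i. x i \<in> mpart (N i) (b + a)}"
      using P.smult_part[OF r] x sub by blast
    moreover have "finite {i. (r \<odot>\<^bsub>?P\<^esub> x) i \<noteq> \<zero>\<^bsub>N i\<^esub>}"
    proof (rule finite_subset)
      show "{i. (r \<odot>\<^bsub>?P\<^esub> x) i \<noteq> \<zero>\<^bsub>N i\<^esub>} \<subseteq> {i. x i \<noteq> \<zero>\<^bsub>N i\<^esub>}"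
        using module.smult_r_null[OF graded_module_module[OF summand] rc] by auto
      show "finite {i. x i \<noteq> \<zero>\<^bsub>N i\<^esub>}" using x by (simp add: direct_sum_part)
    qed
    ultimately show "r \<odot>\<^bsub>?P\<^esub> x \<in> ?C (b + a)" unfolding direct_sum_part by blast
  next
    fix A f a assume A: "finite A" "f \<in> Pi A ?C" "finsum ?P f A = \<zero>\<^bsub>?P\<^esub>" "a \<in> A"
    have "f \<in> (\<Pi> a\<in>A. {x. \<forall>i. x i \<in> mpart (N i) a})" using A(2) sub by (auto simp: Pi_iff)
    then show "f a = \<zero>\<^bsub>?P\<^esub>" by (rule P.part_independent[OF A(1) _ A(3,4)])
  qed
  interpret C: direct_parts R ?P ?C by (rule parts)
  have "x \<in> part_sums ?P ?C" if "x \<in> carrier S" for x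
    using that
  proof (induction x rule: direct_sum_induct)
    case (single i y)
    interpret Ni: graded_module R "N i" by (rule summand)
    from single show ?case
    proof (induction y rule: Ni.M_parts.homogeneous_induct)
      case (homogeneous a y)
      have "single N i y \<in> ?C a"
        unfolding direct_sum_part using homogeneous single_support[of N i y]
          P.part_zero[of a] by (auto simp: single_def)
      then show ?case by (rule C.part_in_part_sums)
    next
      case (add y z)
      have "single N i (y \<oplus>\<^bsub>N i\<^esub> z) = single N i y \<oplus>\<^bsub>?P\<^esub> single N i z"
        using single_add[OF add(1,2)] by (simp add: restrict_UNIV)
      then show ?case using C.part_sums_add[OF add.IH] by (simp add: restrict_UNIV)
    qed
  next
    case (add x y)
    then show ?case using C.part_sums_add[OF add.IH] by (simp add: restrict_UNIV)
  qed
  moreover have "x \<in> carrier S" if "x \<in> part_sums ?P ?C" for x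
    using that
  proof (induction x rule: C.part_sums_induct)
    case (homogeneous a x)
    then show ?case
      using graded_module.axioms(3)[OF summand] C.part_carrier[OF homogeneous]
      by (auto simp: direct_sum_part direct_sum_carrier PiE_UNIV_domain)
  next
    case (add x y)
    then show ?case using finite_support_add[of x y] by (simp add: direct_sum_carrier restrict_UNIV)
  qed
  ultimately have "part_sums ?P ?C = carrier S" by blast
  then have "S = module_of_parts ?P ?C"
    by (simp add: direct_sum_def module_of_parts_def prod_module_def restrict_UNIV)
  then show ?thesis using C.graded_module_of_parts by simp
qed

definition sum_map :: "('t, 'u) ring_scheme \<Rightarrow> ('i \<Rightarrow> 'm \<Rightarrow> 't) \<Rightarrow> ('i \<Rightarrow> 'm) \<Rightarrow> 't" where
  "sum_map T L x = (\<Oplus>\<^bsub>T\<^esub>i\<in>{i. x i \<noteq> \<zero>\<^bsub>N i\<^esub>}. L i (x i))"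

lemma sum_map:
  assumes T: "abelian_group T" and L: "\<And>i. L i \<in> additive_maps (N i) T"
  shows sum_map_additive: "sum_map T L \<in> additive_maps S T"
    and sum_map_single: "\<And>i y. y \<in> carrier (N i) \<Longrightarrow> sum_map T L (single N i y) = L i y"
proof -
  interpret T: abelian_group T by fact
  have Lc: "L i y \<in> carrier T" if "y \<in> carrier (N i)" for i y by (rule additive_closed[OF L that])
  have L0: "L i \<zero>\<^bsub>N i\<^esub> = \<zero>\<^bsub>T\<^esub>" for i by (rule additive_zero[OF summand_group T L])
  have superset: "sum_map T L x = (\<Oplus>\<^bsub>T\<^esub>i\<in>A. L i (x i))"
    if "finite A" "{i. x i \<noteq> \<zero>\<^bsub>N i\<^esub>} \<subseteq> A" "\<forall>i. x i \<in> carrier (N i)" for x A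
    unfolding sum_map_def using that Lc L0 by (intro T.finsum_mono_neutral) auto
  show "sum_map T L \<in> additive_maps S T"
  proof (rule additive_mapsI)
    fix x assume x: "x \<in> carrier S"
    then show "sum_map T L x \<in> carrier T"
      unfolding sum_map_def by (auto intro!: T.finsum_closed Lc simp: direct_sum_carrier)
    fix y assume y: "y \<in> carrier S"
    let ?A = "{i. x i \<noteq> \<zero>\<^bsub>N i\<^esub>} \<union> {i. y i \<noteq> \<zero>\<^bsub>N i\<^esub>}"
    have fin: "finite ?A" and xc: "\<forall>i. x i \<in> carrier (N i)" and yc: "\<forall>i. y i \<in> carrier (N i)"
      using x y by (simp_all add: direct_sum_carrier)
    have "sum_map T L (x \<oplus>\<^bsub>S\<^esub> y) = (\<Oplus>\<^bsub>T\<^esub>i\<in>?A. L i (x i \<oplus>\<^bsub>N i\<^esub> y i))"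
      using xc yc by (subst superset[OF fin]) auto
    also have "\<dots> = (\<Oplus>\<^bsub>T\<^esub>i\<in>?A. L i (x i) \<oplus>\<^bsub>T\<^esub> L i (y i))"
      using xc yc Lc by (intro T.finsum_cong') (auto simp: additive_add[OF L])
    also have "\<dots> = (\<Oplus>\<^bsub>T\<^esub>i\<in>?A. L i (x i)) \<oplus>\<^bsub>T\<^esub> (\<Oplus>\<^bsub>T\<^esub>i\<in>?A. L i (y i))"
      using xc yc Lc by (intro T.finsum_addf) auto
    also have "\<dots> = sum_map T L x \<oplus>\<^bsub>T\<^esub> sum_map T L y"
      by (subst superset[OF fin _ xc], blast, subst superset[OF fin _ yc], blast, rule refl)
    finally show "sum_map T L (x \<oplus>\<^bsub>S\<^esub> y) = sum_map T L x \<oplus>\<^bsub>T\<^esub> sum_map T L y" .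
  qed
  show "sum_map T L (single N i y) = L i y" if y: "y \<in> carrier (N i)" for i y
  proof -
    have "sum_map T L (single N i y) = (\<Oplus>\<^bsub>T\<^esub>j\<in>{i}. L j (single N i y j))"
      using y by (intro superset) (auto simp: single_def)
    then show ?thesis using Lc[OF y] by (simp add: single_def)
  qed
qed

end

section \<open>The associated flat module\<close>

text \<open>Over a graded field all graded modules are injective. Thus an injection of graded \<open>R\<close>-modules has an
  \<open>R\<^sub>0\<close>-linear left inverse, and this is the source of flatness.\<close>

lemma graded_field_Baer:
  assumes E: "graded_module R E"
    and field: "\<And>c r. r \<in> rpart R c \<Longrightarrow> r \<noteq> \<zero>\<^bsub>R\<^esub> \<Longrightarrow> \<exists>s \<in> rpart R (- c). s \<otimes>\<^bsub>R\<^esub> r = \<one>\<^bsub>R\<^esub>"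
  shows "graded_Baer R E"
  unfolding graded_Baer_def
proof (intro allI impI)
  fix a \<Gamma>
  interpret E: graded_module R E by fact
  let ?B = "shift a (regular_module R)"
  let ?\<Lambda> = "{(c, b, e). b \<in> mpart ?B c \<and> e \<in> mpart E c}"
  interpret graded_module_pair R ?B E
    by (intro graded_module_pair.intro graded_module_shift E.graded_module_regular E)
  assume \<Gamma>: "homogeneous_relation R ?B E \<Gamma>" "functional_relation ?B E \<Gamma>"
  have sub: "\<Gamma> \<subseteq> ?\<Lambda>" using homogeneous_relationD(1,2)[OF \<Gamma>(1)] by blast
  have total: "\<exists>e. (c, b, e) \<in> ?\<Lambda>" if "b \<in> mpart ?B c" for c b
    using that E.M_parts.part_zero by blast
  obtain h where h: "h \<in> graded_Hom R ?B E"
    and h2: "(\<forall>c b. b \<in> mpart ?B c \<longrightarrow> (c, b, h b) \<in> ?\<Lambda>) \<and> (\<forall>c b e. (c, b, e) \<in> \<Gamma> \<longrightarrow> h b = e)"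
    using graded_field_Hom_extension[OF field \<Gamma> sub homogeneous_relation_all total] by (rule bexE)
  have "h \<one>\<^bsub>R\<^esub> \<in> mpart E a" by (rule graded_Hom_part[OF h]) (simp add: E.one_part)
  moreover have "y = r \<odot>\<^bsub>E\<^esub> h \<one>\<^bsub>R\<^esub>" if y: "(c, r, y) \<in> \<Gamma>" for c r y
  proof -
    have r: "r \<in> carrier R" using homogeneous_relationD(1)[OF \<Gamma>(1) y] E.R_parts.part_carrier by simp
    have "h r = y" by (rule h2[THEN conjunct2, rule_format, OF y])
    then show ?thesis using graded_Hom_smult[OF h, of r "\<one>\<^bsub>R\<^esub>"] r by simp
  qed
  ultimately show "\<exists>e\<in>mpart E a. \<forall>c r y. (c, r, y) \<in> \<Gamma> \<longrightarrow> y = r \<odot>\<^bsub>E\<^esub> e" by blast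
qed

lemma graded_Hom_degree_zero:
  assumes R: "graded_ring R" and f: "f \<in> graded_Hom R M N"
  shows "f \<in> graded_Hom (degree_zero_graded R) M N"
proof -
  interpret graded_ring R by fact
  show ?thesis
    using f R_parts.part_carrier by (auto simp: graded_Hom_def linear_maps_def)
qed

lemma degree_zero_left_inverse:
  fixes R :: "('g::ab_group_add, 'r) graded_ring"
    and A :: "('g, 'r, 'a) graded_module" and B :: "('g, 'r, 'b) graded_module"
  assumes field: "\<And>c. c \<in> rpart R 0 \<Longrightarrow> c \<noteq> \<zero>\<^bsub>R\<^esub> \<Longrightarrow> \<exists>d \<in> rpart R 0. d \<otimes>\<^bsub>R\<^esub> c = \<one>\<^bsub>R\<^esub>"
    and A: "graded_module R A" and B: "graded_module R B"
    and f: "f \<in> graded_Hom R A B" "inj_on f (carrier A)"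
  shows "\<exists>s \<in> graded_Hom (degree_zero_graded R) B A. \<forall>x \<in> carrier A. s (f x) = x"
proof -
  let ?K = "degree_zero_graded R" and ?id = "\<lambda>x\<in>carrier A. x"
  interpret A: graded_module R A by fact
  have KA: "graded_module ?K A" and KB: "graded_module ?K B"
    by (rule graded_module_degree_zero[OF A], rule graded_module_degree_zero[OF B])
  have "\<exists>s \<in> rpart ?K (- c). s \<otimes>\<^bsub>?K\<^esub> r = \<one>\<^bsub>?K\<^esub>" if "r \<in> rpart ?K c" "r \<noteq> \<zero>\<^bsub>?K\<^esub>" for c r
    using field that by (simp split: if_splits)
  then have inj: "graded_injective TYPE('a) TYPE('b) ?K A"
    by (rule graded_Baer_imp_injective[OF KA graded_field_Baer[OF KA]])
  have id: "?id \<in> graded_Hom R A A"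
    using A.M_parts.part_carrier by (auto simp: graded_Hom_def linear_maps_def)
  note K_Hom = graded_Hom_degree_zero[OF A.graded_ring_axioms]
  have "\<exists>s \<in> graded_Hom ?K B A. \<forall>x \<in> carrier A. s (f x) = ?id x"
    by (rule inj[unfolded graded_injective_def, THEN conjunct2, rule_format])
      (intro conjI KA KB f(2) K_Hom[OF f(1)] K_Hom[OF id])
  then show ?thesis by simp
qed

locale flat_cover = M: graded_module R M
  for R :: "('g::ab_group_add, 'r) graded_ring" and M :: "('g, 'r, 'm) graded_module"
begin

abbreviation "K \<equiv> degree_zero_ring R"
abbreviation "free_summand g \<equiv> graded_tensor K (shift g (regular_module R)) (component M g)"
abbreviation "F\<^sub>M \<equiv> associated_flat R M"

lemma component_group: "abelian_group (component M g)"
proof (rule abelian_groupI)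
  fix x assume "x \<in> carrier (component M g)"
  then have "\<ominus>\<^bsub>M\<^esub> x \<in> mpart M g" "\<ominus>\<^bsub>M\<^esub> x \<oplus>\<^bsub>M\<^esub> x = \<zero>\<^bsub>M\<^esub>"
    using M.M_parts.part_minus M.M_parts.part_carrier M.M.l_neg by auto
  then show "\<exists>y\<in>carrier (component M g). y \<oplus>\<^bsub>component M g\<^esub> x = \<zero>\<^bsub>component M g\<^esub>" by auto
qed (auto simp: M.M.a_ac M.M_parts.part_carrier[of _ g] intro: M.M_parts.part_add)

lemma tensor_factors_g: "graded_tensor_factors R K (shift g (regular_module R)) (component M g)"
proof (intro graded_tensor_factors.intro graded_tensor_factors_axioms.intro component_group)
  show "graded_module R (shift g (regular_module R))"
    by (rule graded_module_shift[OF M.graded_module_regular])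
  show "c \<odot>\<^bsub>component M g\<^esub> v \<in> carrier (component M g)"
    if "c \<in> carrier K" "v \<in> carrier (component M g)" for c v
    using M.smult_degree[of c 0 v g] that by simp
qed simp

sublocale tf: graded_tensor_factors R K "shift g (regular_module R)" "component M g" for g
  by (rule tensor_factors_g)

sublocale ds: direct_summands R free_summand
  by (rule direct_summands.intro) (rule tf.graded_module_tensor)

lemma F_eq: "F\<^sub>M = direct_sum free_summand"
  by (simp add: associated_flat_def)

lemma graded_module_flat: "graded_module R F\<^sub>M"
  unfolding F_eq by (rule ds.graded_module_direct_sum[OF M.graded_ring_axioms])

sublocale F: graded_module R F\<^sub>M by (rule graded_module_flat)

text \<open>The pure tensor \<open>r \<otimes> m\<close> in the summand with index \<open>g\<close>. These elements generate \<open>F\<^sub>M\<close> additively.\<close>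

definition gen :: "'g \<Rightarrow> 'r \<Rightarrow> 'm \<Rightarrow> 'g \<Rightarrow> ('r \<times> 'm \<Rightarrow>\<^sub>0 int) set" where
  "gen g r m = single free_summand g (tensor_factors.pure K (shift g (regular_module R)) (component M g) r m)"

lemma pure_carrier:
  "r \<in> carrier R \<Longrightarrow> m \<in> mpart M g \<Longrightarrow>
    tensor_factors.pure K (shift g (regular_module R)) (component M g) r m \<in> carrier (free_summand g)"
  using tf.pure_carrier[of r g m] by simp

lemma gen_carrier: "r \<in> carrier R \<Longrightarrow> m \<in> mpart M g \<Longrightarrow> gen g r m \<in> carrier F\<^sub>M"
  unfolding gen_def F_eq by (rule ds.single_carrier[OF pure_carrier])

lemma gen_induct [consumes 1, case_names gen add]:
  assumes x: "x \<in> carrier F\<^sub>M"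
    and gen: "\<And>g r m. r \<in> carrier R \<Longrightarrow> m \<in> mpart M g \<Longrightarrow> P (gen g r m)"
    and add: "\<And>x y. x \<in> carrier F\<^sub>M \<Longrightarrow> y \<in> carrier F\<^sub>M \<Longrightarrow> P x \<Longrightarrow> P y \<Longrightarrow> P (x \<oplus>\<^bsub>F\<^sub>M\<^esub> y)"
  shows "P x"
  using x unfolding F_eq
proof (induction x rule: ds.direct_sum_induct)
  case (single g X)
  then have "X \<in> carrier (tensor K (shift g (regular_module R)) (component M g))" by simp
  then show ?case
  proof (induction X rule: tf.tensor_induct)
    case (pure r m)
    then show ?case using gen[of r m g] by (simp add: gen_def)
  next
    case (add X Y)
    have "single free_summand g (X \<oplus>\<^bsub>free_summand g\<^esub> Y) =
        single free_summand g X \<oplus>\<^bsub>F\<^sub>M\<^esub> single free_summand g Y"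
      unfolding F_eq using add by (intro ds.single_add) simp_all
    moreover have "single free_summand g X \<in> carrier F\<^sub>M" "single free_summand g Y \<in> carrier F\<^sub>M"
      unfolding F_eq using add by (auto intro!: ds.single_carrier)
    ultimately show ?case using assms(3)[OF _ _ add.IH] by simp
  qed
next
  case (add x y)
  then show ?case using assms(3)[of x y] unfolding F_eq by blast
qed

lemma gen_add:
  assumes "r \<in> carrier R" "m \<in> mpart M g" "m' \<in> mpart M g"
  shows "gen g r (m \<oplus>\<^bsub>M\<^esub> m') = gen g r m \<oplus>\<^bsub>F\<^sub>M\<^esub> gen g r m'"
proof -
  let ?p = "tensor_factors.pure K (shift g (regular_module R)) (component M g)"
  have "?p r (m \<oplus>\<^bsub>M\<^esub> m') = ?p r m \<oplus>\<^bsub>free_summand g\<^esub> ?p r m'"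
    using tf.pure_add_right[of r g m m'] assms by simp
  then show ?thesis
    unfolding gen_def F_eq using ds.single_add[OF pure_carrier pure_carrier, of r m g r m'] assms by simp
qed

lemma smult_gen:
  assumes "s \<in> carrier R" "r \<in> carrier R" "m \<in> mpart M g"
  shows "s \<odot>\<^bsub>F\<^sub>M\<^esub> gen g r m = gen g (s \<otimes>\<^bsub>R\<^esub> r) m"
proof
  fix h
  let ?p = "tensor_factors.pure K (shift g (regular_module R)) (component M g)"
  have "s \<odot>\<^bsub>free_summand g\<^esub> ?p r m = ?p (s \<otimes>\<^bsub>R\<^esub> r) m"
    using tf.T_smult_pure[of s r g m] assms by simp
  moreover have "s \<odot>\<^bsub>free_summand h\<^esub> \<zero>\<^bsub>free_summand h\<^esub> = \<zero>\<^bsub>free_summand h\<^esub>"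
    by (rule module.smult_r_null[OF graded_module_module[OF ds.summand] assms(1)])
  ultimately show "(s \<odot>\<^bsub>F\<^sub>M\<^esub> gen g r m) h = gen g (s \<otimes>\<^bsub>R\<^esub> r) m h"
    unfolding F_eq gen_def single_def by simp
qed

lemma gen_balanced:
  assumes "c \<in> rpart R 0" "m \<in> mpart M g"
  shows "c \<odot>\<^bsub>F\<^sub>M\<^esub> gen g \<one>\<^bsub>R\<^esub> m = gen g \<one>\<^bsub>R\<^esub> (c \<odot>\<^bsub>M\<^esub> m)"
proof -
  let ?p = "tensor_factors.pure K (shift g (regular_module R)) (component M g)"
  have c: "c \<in> carrier R" using assms(1) M.R_parts.part_carrier by blast
  have "?p (c \<otimes>\<^bsub>R\<^esub> \<one>\<^bsub>R\<^esub>) m = ?p \<one>\<^bsub>R\<^esub> (c \<odot>\<^bsub>M\<^esub> m)"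
    using tf.pure_balanced[of c "\<one>\<^bsub>R\<^esub>" g m] assms by simp
  then show ?thesis using smult_gen[OF c M.one_closed assms(2)] by (simp add: gen_def)
qed

definition flat_map :: "('t, 'u) ring_scheme \<Rightarrow> ('g \<Rightarrow> 'r \<times> 'm \<Rightarrow> 't) \<Rightarrow> ('g \<Rightarrow> ('r \<times> 'm \<Rightarrow>\<^sub>0 int) set) \<Rightarrow> 't" where
  "flat_map T b = ds.sum_map T (\<lambda>g. tensor_lift T (b g))"

lemma flat_map:
  assumes T: "abelian_group T"
    and b: "\<And>g. tensor_factors.balanced_map K (shift g (regular_module R)) (component M g) T (b g)"
  shows flat_map_additive: "flat_map T b \<in> additive_maps F\<^sub>M T"
    and flat_map_gen: "\<And>g r m. r \<in> carrier R \<Longrightarrow> m \<in> mpart M g \<Longrightarrow> flat_map T b (gen g r m) = b g (r, m)"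
proof -
  have L: "tensor_lift T (b g) \<in> additive_maps (free_summand g) T" for g
    using tf.tensor_lift_additive[OF T b] by (auto simp: hom_def)
  show "flat_map T b \<in> additive_maps F\<^sub>M T"
    unfolding flat_map_def F_eq by (rule ds.sum_map_additive[OF T L])
  fix g r m assume rm: "r \<in> carrier R" "m \<in> mpart M g"
  have "flat_map T b (gen g r m) = tensor_lift T (b g) (tensor_factors.pure K (shift g (regular_module R)) (component M g) r m)"
    unfolding flat_map_def gen_def by (rule ds.sum_map_single[OF T L pure_carrier[OF rm]])
  also have "\<dots> = b g (r, m)" using tf.tensor_lift_pure[OF T b] rm by simp
  finally show "flat_map T b (gen g r m) = b g (r, m)" .
qed

text \<open>For an injection \<open>f\<close> with \<open>R\<^sub>0\<close>-linear left inverse \<open>s\<close>, a left inverse of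
  \<open>F\<^sub>M \<otimes> f\<close> is given by \<open>(r \<otimes> m) \<otimes> b \<mapsto> (1 \<otimes> m) \<otimes> s(r b)\<close>.\<close>

theorem graded_flat_associated_flat:
  assumes field: "\<And>c. c \<in> rpart R 0 \<Longrightarrow> c \<noteq> \<zero>\<^bsub>R\<^esub> \<Longrightarrow> \<exists>d \<in> rpart R 0. d \<otimes>\<^bsub>R\<^esub> c = \<one>\<^bsub>R\<^esub>"
  shows "graded_flat TYPE('a) TYPE('b) R F\<^sub>M"
  unfolding graded_flat_def
proof (intro conjI allI impI graded_module_flat, elim conjE)
  fix A :: "('g, 'r, 'a) graded_module" and B :: "('g, 'r, 'b) graded_module" and f
  assume A: "graded_module R A" and B: "graded_module R B" and f: "f \<in> graded_Hom R A B" "inj_on f (carrier A)"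
  interpret A: graded_module R A by fact
  interpret B: graded_module R B by fact
  interpret TA: tensor_factors R F\<^sub>M A by unfold_locales simp_all
  interpret TB: tensor_factors R F\<^sub>M B by unfold_locales simp_all
  obtain s where s: "s \<in> graded_Hom (degree_zero_graded R) B A" and sf: "\<And>x. x \<in> carrier A \<Longrightarrow> s (f x) = x"
    using degree_zero_left_inverse[OF field A B f] by blast
  have s_smult: "s (c \<odot>\<^bsub>B\<^esub> b) = c \<odot>\<^bsub>A\<^esub> s b" if "c \<in> rpart R 0" "b \<in> carrier B" for c b
    using graded_Hom_smult[OF s, of c b] that by simp
  note s_closed = graded_Hom_closed[OF s] and s_add = graded_Hom_add[OF s]
  define \<beta> where "\<beta> b g = (\<lambda>(r, m). TA.pure (gen g \<one>\<^bsub>R\<^esub> m) (s (r \<odot>\<^bsub>B\<^esub> b)))" for b g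
  have \<beta>_val: "\<beta> b g (r, m) = TA.pure (gen g \<one>\<^bsub>R\<^esub> m) (s (r \<odot>\<^bsub>B\<^esub> b))" for b g r m
    by (simp add: \<beta>_def)
  have \<beta>: "tensor_factors.balanced_map K (shift g (regular_module R)) (component M g) TA.T (\<beta> b g)"
    if b: "b \<in> carrier B" for b g
    unfolding tf.balanced_map_def
  proof (intro conjI ballI)
    fix r m assume "r \<in> carrier (shift g (regular_module R))" "m \<in> carrier (component M g)"
    then have rm: "r \<in> carrier R" "m \<in> mpart M g" by simp_all
    note gm = gen_carrier[OF M.one_closed rm(2)]
    show "\<beta> b g (r, m) \<in> carrier TA.T" using gm rm b s_closed by (simp add: \<beta>_def)
    show "\<beta> b g (r \<oplus>\<^bsub>shift g (regular_module R)\<^esub> r', m) = \<beta> b g (r, m) \<oplus>\<^bsub>TA.T\<^esub> \<beta> b g (r', m)"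
      if "r' \<in> carrier (shift g (regular_module R))" for r'
      using that gm rm b s_closed by (simp add: \<beta>_def B.smult_l_distr s_add TA.pure_add_right)
    show "\<beta> b g (r, m \<oplus>\<^bsub>component M g\<^esub> m') = \<beta> b g (r, m) \<oplus>\<^bsub>TA.T\<^esub> \<beta> b g (r, m')"
      if "m' \<in> carrier (component M g)" for m'
      using that gm gen_carrier[OF M.one_closed, of m' g] rm b s_closed
      by (simp add: \<beta>_def gen_add TA.pure_add_left)
    show "\<beta> b g (c \<odot>\<^bsub>shift g (regular_module R)\<^esub> r, m) = \<beta> b g (r, c \<odot>\<^bsub>component M g\<^esub> m)"
      if "c \<in> carrier K" for c
    proof -
      have c: "c \<in> rpart R 0" "c \<in> carrier R" using that M.R_parts.part_carrier by auto
      have "TA.pure (gen g \<one>\<^bsub>R\<^esub> m) (s ((c \<otimes>\<^bsub>R\<^esub> r) \<odot>\<^bsub>B\<^esub> b)) = TA.pure (gen g \<one>\<^bsub>R\<^esub> m) (c \<odot>\<^bsub>A\<^esub> s (r \<odot>\<^bsub>B\<^esub> b))"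
        using c rm b by (simp add: B.smult_assoc1 s_smult)
      also have "\<dots> = TA.pure (c \<odot>\<^bsub>F\<^sub>M\<^esub> gen g \<one>\<^bsub>R\<^esub> m) (s (r \<odot>\<^bsub>B\<^esub> b))"
        by (rule TA.pure_balanced[symmetric]) (use c gm rm b s_closed in auto)
      finally show ?thesis using gen_balanced[OF c(1) rm(2)] by (simp add: \<beta>_def)
    qed
  qed
  \<comment> \<open>The left inverse as a family of maps on \<open>F\<^sub>M\<close>, one for each element of \<open>B\<close>.\<close>
  define \<tau> where "\<tau> b = flat_map TA.T (\<beta> b)" for b
  have \<tau>_add: "\<tau> b \<in> additive_maps F\<^sub>M TA.T" if "b \<in> carrier B" for b
    unfolding \<tau>_def by (rule flat_map_additive[OF TA.tensor_abelian_group \<beta>[OF that]])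
  have \<tau>_gen: "\<tau> b (gen g r m) = TA.pure (gen g \<one>\<^bsub>R\<^esub> m) (s (r \<odot>\<^bsub>B\<^esub> b))"
    if "b \<in> carrier B" "r \<in> carrier R" "m \<in> mpart M g" for b g r m
    unfolding \<tau>_def using flat_map_gen[OF TA.tensor_abelian_group \<beta>[OF that(1)] that(2,3)] by (simp only: \<beta>_val)
  have \<tau>_closed: "\<tau> b x \<in> carrier TA.T" if "b \<in> carrier B" "x \<in> carrier F\<^sub>M" for b x
    by (rule additive_closed[OF \<tau>_add[OF that(1)] that(2)])
  have \<tau>_b: "\<tau> (b \<oplus>\<^bsub>B\<^esub> b') x = \<tau> b x \<oplus>\<^bsub>TA.T\<^esub> \<tau> b' x"
    if b: "b \<in> carrier B" "b' \<in> carrier B" and x: "x \<in> carrier F\<^sub>M" for b b' x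
    using x
  proof (induction x rule: gen_induct)
    case (gen g r m)
    then show ?case
      using b gen_carrier[OF M.one_closed gen(2)] s_closed
      by (simp add: \<tau>_gen B.smult_r_distr s_add TA.pure_add_right)
  next
    case (add x y)
    then show ?case
      using b \<tau>_closed by (simp add: additive_add[OF \<tau>_add] TA.T.a_ac del: direct_sum_simps)
  qed
  have \<tau>_r: "\<tau> b (r' \<odot>\<^bsub>F\<^sub>M\<^esub> x) = \<tau> (r' \<odot>\<^bsub>B\<^esub> b) x"
    if b: "b \<in> carrier B" and r': "r' \<in> carrier R" and x: "x \<in> carrier F\<^sub>M" for b r' x
    using x
  proof (induction x rule: gen_induct)
    case (gen g r m)
    have "(r' \<otimes>\<^bsub>R\<^esub> r) \<odot>\<^bsub>B\<^esub> b = r \<odot>\<^bsub>B\<^esub> (r' \<odot>\<^bsub>B\<^esub> b)"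
      using B.smult_assoc1[OF gen(1) r' b] M.m_comm[OF gen(1) r'] by simp
    then show ?case using b r' gen by (simp add: \<tau>_gen smult_gen)
  next
    case (add x y)
    then show ?case
      using b r' F.smult_closed by (simp add: additive_add[OF \<tau>_add] F.smult_r_distr)
  qed
  let ?\<theta> = "tensor_lift TA.T (\<lambda>(x, b). \<tau> b x)"
  have \<theta>_bal: "TB.balanced_map TA.T (\<lambda>(x, b). \<tau> b x)"
    unfolding TB.balanced_map_def using \<tau>_closed \<tau>_b \<tau>_r by (auto simp: additive_add[OF \<tau>_add])
  note \<theta> = TB.tensor_lift_additive[OF TA.tensor_abelian_group \<theta>_bal] TB.tensor_lift_pure[OF TA.tensor_abelian_group \<theta>_bal]
  have f_closed: "f a \<in> carrier B" if "a \<in> carrier A" for a by (rule graded_Hom_closed[OF f(1) that])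
  let ?t = "\<lambda>(x, a). TB.pure x (f a)"
  have t_bal: "TA.balanced_map TB.T ?t"
    unfolding TA.balanced_map_def
    by (auto simp: f_closed TB.pure_add_left TB.pure_add_right graded_Hom_add[OF f(1)]
        graded_Hom_smult[OF f(1)] TB.pure_balanced)
  have map_eq: "tensor_map R F\<^sub>M B f = tensor_lift TB.T ?t"
    by (simp add: tensor_map_def TB.pure_def)
  note t = TA.tensor_lift_additive[OF TB.tensor_abelian_group t_bal] TA.tensor_lift_pure[OF TB.tensor_abelian_group t_bal]
  have id: "(\<lambda>X. X) \<in> additive_maps TA.T TA.T" by (rule additive_mapsI) simp_all
  have pure: "\<tau> (f a) x = TA.pure x a" if a: "a \<in> carrier A" and x: "x \<in> carrier F\<^sub>M" for a x
    using x
  proof (induction x rule: gen_induct)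
    case (gen g r m)
    have "\<tau> (f a) (gen g r m) = TA.pure (gen g \<one>\<^bsub>R\<^esub> m) (s (f (r \<odot>\<^bsub>A\<^esub> a)))"
      using gen a by (simp add: \<tau>_gen f_closed graded_Hom_smult[OF f(1)])
    also have "\<dots> = TA.pure (r \<odot>\<^bsub>F\<^sub>M\<^esub> gen g \<one>\<^bsub>R\<^esub> m) a"
      using gen a gen_carrier[OF M.one_closed gen(2)] by (simp add: sf TA.pure_balanced)
    finally show ?case using smult_gen[OF gen(1) M.one_closed gen(2)] gen(1) by simp
  next
    case (add x y)
    then show ?case using a by (simp add: additive_add[OF \<tau>_add] f_closed TA.pure_add_left)
  qed
  have "?\<theta> (tensor_lift TB.T ?t X) = X" if "X \<in> carrier TA.T" for X
    by (rule TA.additive_eq_on_tensor[OF additive_comp[OF t(1) \<theta>(1)] id _ that])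
      (simp add: t(2) \<theta>(2) f_closed pure)
  then show "inj_on (tensor_map R F\<^sub>M B f) (carrier (tensor R F\<^sub>M A))"
    unfolding map_eq by (rule inj_on_inverseI)
qed

section \<open>The canonical projection onto a module\<close>

lemma phi_hat_balanced:
  "tensor_factors.balanced_map K (shift g (regular_module R)) (component M g) M (\<lambda>(r, m). r \<odot>\<^bsub>M\<^esub> m)"
  unfolding tf.balanced_map_def
proof (intro conjI ballI)
  fix r m c assume "r \<in> carrier (shift g (regular_module R))" "m \<in> carrier (component M g)" "c \<in> carrier K"
  then have rmc: "r \<in> carrier R" "m \<in> carrier M" "c \<in> carrier R"
    using M.M_parts.part_carrier M.R_parts.part_carrier by auto
  have "(c \<otimes>\<^bsub>R\<^esub> r) \<odot>\<^bsub>M\<^esub> m = r \<odot>\<^bsub>M\<^esub> (c \<odot>\<^bsub>M\<^esub> m)"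
    using M.smult_assoc1[of r c m] M.m_comm[of r c] rmc by simp
  then show "(case (c \<odot>\<^bsub>shift g (regular_module R)\<^esub> r, m) of (r, m) \<Rightarrow> r \<odot>\<^bsub>M\<^esub> m) =
      (case (r, c \<odot>\<^bsub>component M g\<^esub> m) of (r, m) \<Rightarrow> r \<odot>\<^bsub>M\<^esub> m)" by simp
qed (use M.M_parts.part_carrier in \<open>auto simp: M.smult_l_distr M.smult_r_distr\<close>)

lemma phi_hat_eq: "phi_hat R M = (\<lambda>x\<in>carrier F\<^sub>M. flat_map M (\<lambda>g (r, m). r \<odot>\<^bsub>M\<^esub> m) x)"
  unfolding phi_hat_def flat_map_def ds.sum_map_def by (simp add: F_eq)

lemma phi_hat_additive: "phi_hat R M \<in> additive_maps F\<^sub>M M"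
proof (rule additive_mapsI)
  note a = flat_map_additive[OF M.M.abelian_group_axioms phi_hat_balanced]
  show "phi_hat R M x \<in> carrier M" if "x \<in> carrier F\<^sub>M" for x
    using additive_closed[OF a that] that by (simp add: phi_hat_eq)
  show "phi_hat R M (x \<oplus>\<^bsub>F\<^sub>M\<^esub> y) = phi_hat R M x \<oplus>\<^bsub>M\<^esub> phi_hat R M y"
    if "x \<in> carrier F\<^sub>M" "y \<in> carrier F\<^sub>M" for x y
    using additive_add[OF a that] that F.M.a_closed[OF that] by (simp add: phi_hat_eq)
qed

lemma phi_hat_gen: "r \<in> carrier R \<Longrightarrow> m \<in> mpart M g \<Longrightarrow> phi_hat R M (gen g r m) = r \<odot>\<^bsub>M\<^esub> m"
  using flat_map_gen[OF M.M.abelian_group_axioms phi_hat_balanced] gen_carrier by (simp add: phi_hat_eq)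

lemma finsum_part:
  assumes "f \<in> A \<rightarrow> mpart M a" shows "finsum M f A \<in> mpart M a"
  using assms
proof (induction A rule: infinite_finite_induct)
  case (insert i A)
  then have "f i \<in> mpart M a" "f i \<in> carrier M" "f \<in> A \<rightarrow> carrier M" "f \<in> A \<rightarrow> mpart M a"
    using M.M_parts.part_carrier by blast+
  with insert show ?case by (simp add: M.M.finsum_insert M.M_parts.part_add)
qed simp_all

lemma phi_hat_part:
  assumes x: "x \<in> mpart F\<^sub>M a"
  shows "phi_hat R M x \<in> mpart M a"
proof -
  let ?L = "tensor_lift M (\<lambda>(r, m). r \<odot>\<^bsub>M\<^esub> m)"
  have L: "?L X \<in> mpart M a"
    if "X \<in> graded_tensor_factors.T_part K (shift g (regular_module R)) (component M g) a" for g X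
    using that
  proof (induction X rule: tf.T_part_induct)
    case (pure r m)
    then have r: "r \<in> rpart R (a - g)" and m: "m \<in> mpart M g" by simp_all
    have "?L (tensor_factors.pure K (shift g (regular_module R)) (component M g) r m) = r \<odot>\<^bsub>M\<^esub> m"
      using tf.tensor_lift_pure[OF M.M.abelian_group_axioms phi_hat_balanced, of r g m] r m
        M.R_parts.part_carrier by simp
    then show ?case using M.smult_degree[OF r m] by simp
  next
    case (add X Y)
    then show ?case
      using additive_add[OF tf.tensor_lift_additive[OF M.M.abelian_group_axioms phi_hat_balanced]]
        M.M_parts.part_add by simp
  qed
  have "flat_map M (\<lambda>g (r, m). r \<odot>\<^bsub>M\<^esub> m) x \<in> mpart M a"
    unfolding flat_map_def ds.sum_map_def
  proof (intro finsum_part funcsetI L)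
    fix g show "x g \<in> graded_tensor_factors.T_part K (shift g (regular_module R)) (component M g) a"
      using x unfolding F_eq direct_sum_part by simp
  qed
  then show ?thesis using F.M_parts.part_carrier[OF x] by (simp add: phi_hat_eq)
qed

lemma phi_hat_Hom: "phi_hat R M \<in> graded_Hom R F\<^sub>M M"
proof (rule graded_HomI[OF graded_module_flat M.graded_module_axioms phi_hat_additive])
  show "phi_hat R M \<in> extensional (carrier F\<^sub>M)" by (simp add: phi_hat_eq)
  show "phi_hat R M x \<in> mpart M a" if "x \<in> mpart F\<^sub>M a" for a x by (rule phi_hat_part[OF that])
  fix a b r x assume "r \<in> rpart R b" and "x \<in> mpart F\<^sub>M a"
  then have r: "r \<in> carrier R" and x: "x \<in> carrier F\<^sub>M"
    using M.R_parts.part_carrier F.M_parts.part_carrier by auto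
  show "phi_hat R M (r \<odot>\<^bsub>F\<^sub>M\<^esub> x) = r \<odot>\<^bsub>M\<^esub> phi_hat R M x"
    using x
  proof (induction x rule: gen_induct)
    case (gen g s m)
    then show ?case
      using r M.M_parts.part_carrier by (simp add: smult_gen phi_hat_gen M.smult_assoc1)
  next
    case (add x y)
    then show ?case
      using r additive_closed[OF phi_hat_additive]
      by (simp add: F.smult_r_distr additive_add[OF phi_hat_additive] M.smult_r_distr)
  qed
qed

text \<open>The element \<open>1 \<otimes> m\<close> has the degree of \<open>m\<close> if it is taken in the summand for that degree.\<close>

lemma phi_hat_surj:
  assumes m: "m \<in> mpart M a"
  shows "\<exists>x \<in> mpart F\<^sub>M a. phi_hat R M x = m"
proof
  let ?p = "tensor_factors.pure K (shift a (regular_module R)) (component M a)"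
  have "?p \<one>\<^bsub>R\<^esub> m \<in> mpart (free_summand a) a"
    using tf.T_part_pure[of "\<one>\<^bsub>R\<^esub>" a a m] m M.one_part by simp
  moreover have "\<zero>\<^bsub>free_summand h\<^esub> \<in> mpart (free_summand h) a" for h
  proof -
    interpret h: graded_module R "free_summand h" by (rule ds.summand)
    show ?thesis by (rule h.M_parts.part_zero)
  qed
  ultimately show "gen a \<one>\<^bsub>R\<^esub> m \<in> mpart F\<^sub>M a"
    unfolding F_eq direct_sum_part gen_def using single_support by (auto simp: single_def)
  show "phi_hat R M (gen a \<one>\<^bsub>R\<^esub> m) = m"
    using m M.M_parts.part_carrier by (simp add: phi_hat_gen)
qed

lemma phi_hat_surj_carrier:
  assumes "m \<in> carrier M"
  shows "\<exists>x \<in> carrier F\<^sub>M. phi_hat R M x = m"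
  using assms
proof (induction m rule: M.M_parts.homogeneous_induct)
  case (homogeneous a m)
  then show ?case using phi_hat_surj F.M_parts.part_carrier by blast
next
  case (add m m')
  then show ?case using additive_add[OF phi_hat_additive] F.M.a_closed by metis
qed

end

section \<open>Local graded rings with residue ring in degree zero\<close>

lemma (in graded_ring) hcomp_mult:
  assumes c: "c \<in> rpart R 0" and x: "x \<in> carrier R"
  shows "R_parts.hcomp (c \<otimes> x) = (\<lambda>a. c \<otimes> R_parts.hcomp x a)"
proof (rule R_parts.hcomp_unique)
  let ?A = "{a. R_parts.hcomp x a \<noteq> \<zero>}"
  have cc: "c \<in> carrier R" using c R_parts.part_carrier by blast
  show fin: "finite ?A" by (rule R_parts.hcomp_finite[OF x])
  show "c \<otimes> R_parts.hcomp x a \<in> rpart R a" for a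
    using mult_degree[OF c R_parts.hcomp_part[OF x, of a]] by simp
  show "c \<otimes> R_parts.hcomp x a = \<zero>" if "a \<notin> ?A" for a using that cc by simp
  show "c \<otimes> x = (\<Oplus>a\<in>?A. c \<otimes> R_parts.hcomp x a)"
    using finsum_rdistr[OF fin cc, of "R_parts.hcomp x"] R_parts.hcomp_sum[OF x] x by auto
qed

lemma (in graded_ring) homogeneous_ideal_iff:
  assumes I: "ideal I R"
  shows "homogeneous_ideal R I \<longleftrightarrow> (\<forall>x\<in>I. \<forall>a. R_parts.hcomp x a \<in> I)"
proof -
  interpret I: ideal I R by fact
  have sums: "finsum R f A \<in> I" if "finite A" "f \<in> A \<rightarrow> I" for f and A :: "'a set"
    using that
  proof (induction A)
    case (insert a A)
    then have "f \<in> A \<rightarrow> carrier R" "f a \<in> carrier R" using I.a_Hcarr by blast+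
    with insert show ?case by (simp add: finsum_insert I.a_closed)
  qed simp
  show ?thesis
  proof
    assume "homogeneous_ideal R I"
    then have eq: "I = part_sums R (\<lambda>a. I \<inter> rpart R a)" by (simp add: homogeneous_ideal_def)
    show "\<forall>x\<in>I. \<forall>a. R_parts.hcomp x a \<in> I"
    proof (intro ballI allI)
      fix x a assume "x \<in> I"
      with eq have "x \<in> part_sums R (\<lambda>a. I \<inter> rpart R a)" by (rule subst)
      then obtain f A where A: "finite A" "f \<in> (\<Pi> a\<in>A. I \<inter> rpart R a)" "x = finsum R f A"
        unfolding part_sums_def by auto
      let ?f = "\<lambda>a. if a \<in> A then f a else \<zero>"
      have f: "f \<in> A \<rightarrow> carrier R" using A(2) I.a_Hcarr by blast
      have "R_parts.hcomp x = ?f"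
      proof (rule R_parts.hcomp_unique[OF A(1)])
        show "x = finsum R ?f A" unfolding A(3) using f by (intro finsum_cong') auto
      qed (use A(2) in auto)
      then show "R_parts.hcomp x a \<in> I" using A(2) by auto
    qed
  next
    assume comp: "\<forall>x\<in>I. \<forall>a. R_parts.hcomp x a \<in> I"
    have "x \<in> part_sums R (\<lambda>a. I \<inter> rpart R a)" if x: "x \<in> I" for x
    proof -
      have xc: "x \<in> carrier R" using x I.a_Hcarr by blast
      have "finsum R (R_parts.hcomp x) {a. R_parts.hcomp x a \<noteq> \<zero>} \<in> part_sums R (\<lambda>a. I \<inter> rpart R a)"
        using comp x xc R_parts.hcomp_finite R_parts.hcomp_part by (intro part_sumsI) auto
      then show ?thesis using R_parts.hcomp_sum[OF xc] by simp
    qed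
    moreover have "x \<in> I" if "x \<in> part_sums R (\<lambda>a. I \<inter> rpart R a)" for x
    proof -
      from that obtain f A where A: "finite A" "f \<in> (\<Pi> a\<in>A. I \<inter> rpart R a)" "x = finsum R f A"
        unfolding part_sums_def by auto
      then have "f \<in> A \<rightarrow> I" by blast
      then show ?thesis using sums[OF A(1)] A(3) by blast
    qed
    ultimately show "homogeneous_ideal R I" using I unfolding homogeneous_ideal_def by blast
  qed
qed

locale split_local_ring = graded_ring R for R :: "('g::ab_group_add, 'r) graded_ring" and \<mm> :: "'r set" +
  assumes maximal: "maximal_homogeneous_ideal R \<mm>"
    and split: "(\<lambda>r. \<mm> +>\<^bsub>R\<^esub> r) \<in> ring_iso (degree_zero_ring R) (R Quot \<mm>)"
begin

sublocale \<mm>: ideal \<mm> R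
  using maximal by (simp add: maximal_homogeneous_ideal_def homogeneous_ideal_def)

lemma \<mm>_hcomp: "x \<in> \<mm> \<Longrightarrow> R_parts.hcomp x a \<in> \<mm>"
  using maximal homogeneous_ideal_iff[OF \<mm>.ideal_axioms] by (simp add: maximal_homogeneous_ideal_def)

lemma \<mm>_degree_zero:
  assumes "r \<in> rpart R 0" "r \<in> \<mm>" shows "r = \<zero>\<^bsub>R\<^esub>"
proof -
  have "inj_on (\<lambda>r. \<mm> +>\<^bsub>R\<^esub> r) (rpart R 0)"
    using split by (simp add: ring_iso_def bij_betw_def)
  moreover have "\<mm> +>\<^bsub>R\<^esub> r = \<mm> +>\<^bsub>R\<^esub> \<zero>\<^bsub>R\<^esub>"
    using \<mm>.a_rcos_const[OF assms(2)] \<mm>.a_rcos_const[OF \<mm>.zero_closed] by simp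
  ultimately show ?thesis using assms(1) R_parts.part_zero by (rule inj_onD)
qed

text \<open>The maximal ideal is the sum of the components of nonzero degree, since every element differs from
  an element of degree zero by one of the ideal.\<close>

lemma nonzero_degree_in_\<mm>:
  assumes r: "r \<in> rpart R a" and a: "a \<noteq> 0"
  shows "r \<in> \<mm>"
proof -
  have rc: "r \<in> carrier R" using r R_parts.part_carrier by blast
  have "\<mm> +>\<^bsub>R\<^esub> r \<in> carrier (R Quot \<mm>)"
    unfolding FactRing_def using rc by (auto simp: A_RCOSETS_def' )
  then obtain c where c: "c \<in> rpart R 0" "\<mm> +>\<^bsub>R\<^esub> r = \<mm> +>\<^bsub>R\<^esub> c"
    using split by (auto simp: ring_iso_def bij_betw_def)
  have cc: "c \<in> carrier R" using c R_parts.part_carrier by blast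
  have "r \<in> \<mm> +>\<^bsub>R\<^esub> c" using \<mm>.a_rcos_self[OF rc] c(2) by simp
  then obtain x where x: "x \<in> \<mm>" "r = x \<oplus>\<^bsub>R\<^esub> c" unfolding a_r_coset_def' by blast
  have xc: "x \<in> carrier R" using x(1) \<mm>.a_Hcarr by blast
  have "R_parts.hcomp r a = R_parts.hcomp x a \<oplus>\<^bsub>R\<^esub> R_parts.hcomp c a"
    using R_parts.hcomp_add[OF xc cc] x(2) by simp
  then have "r = R_parts.hcomp x a"
    using R_parts.hcomp_homogeneous[OF r] R_parts.hcomp_homogeneous[OF c(1)] a xc by simp
  then show ?thesis using \<mm>_hcomp[OF x(1)] by metis
qed

text \<open>\<open>R\<^sub>0\<close> is a field: for nonzero \<open>c\<close> in \<open>R\<^sub>0\<close> the homogeneous ideal \<open>\<mm> + R c\<close> is larger than \<open>\<mm>\<close> and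
  therefore contains one, and the degree-zero part of this relation inverts \<open>c\<close>.\<close>

lemma degree_zero_inverse:
  assumes c: "c \<in> rpart R 0" and c0: "c \<noteq> \<zero>\<^bsub>R\<^esub>"
  shows "\<exists>d \<in> rpart R 0. d \<otimes>\<^bsub>R\<^esub> c = \<one>\<^bsub>R\<^esub>"
proof -
  have cc: "c \<in> carrier R" using c R_parts.part_carrier by blast
  let ?J = "\<mm> <+>\<^bsub>R\<^esub> PIdl\<^bsub>R\<^esub> c"
  have J: "ideal ?J R" by (rule add_ideals[OF \<mm>.ideal_axioms cgenideal_ideal[OF cc]])
  have J_iff: "y \<in> ?J \<longleftrightarrow> (\<exists>x\<in>\<mm>. \<exists>r\<in>carrier R. y = x \<oplus>\<^bsub>R\<^esub> r \<otimes>\<^bsub>R\<^esub> c)" for y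
    by (auto simp: set_add_def' cgenideal_def)
  have "R_parts.hcomp y a \<in> ?J" if y: "y \<in> ?J" for y a
  proof -
    obtain x r where xr: "x \<in> \<mm>" "r \<in> carrier R" "y = x \<oplus>\<^bsub>R\<^esub> r \<otimes>\<^bsub>R\<^esub> c" using y J_iff by blast
    have xc: "x \<in> carrier R" using xr(1) \<mm>.a_Hcarr by blast
    have "R_parts.hcomp y a = R_parts.hcomp x a \<oplus>\<^bsub>R\<^esub> R_parts.hcomp r a \<otimes>\<^bsub>R\<^esub> c"
      using R_parts.hcomp_add[OF xc, of "r \<otimes>\<^bsub>R\<^esub> c"] hcomp_mult[OF c xr(2)] xr cc
      by (simp add: m_comm)
    then show ?thesis using J_iff \<mm>_hcomp[OF xr(1)] xr(2) R_parts.hcomp_carrier by blast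
  qed
  then have hom: "homogeneous_ideal R ?J" using homogeneous_ideal_iff[OF J] by blast
  have sub: "\<mm> \<subseteq> ?J"
  proof
    fix x assume x: "x \<in> \<mm>"
    then have "x = x \<oplus>\<^bsub>R\<^esub> \<zero>\<^bsub>R\<^esub> \<otimes>\<^bsub>R\<^esub> c" using \<mm>.a_Hcarr cc by simp
    then show "x \<in> ?J" using J_iff x zero_closed by blast
  qed
  have "c = \<zero>\<^bsub>R\<^esub> \<oplus>\<^bsub>R\<^esub> \<one>\<^bsub>R\<^esub> \<otimes>\<^bsub>R\<^esub> c" using cc by simp
  then have "c \<in> ?J" using J_iff \<mm>.zero_closed one_closed by blast
  then have "?J \<noteq> \<mm>" using \<mm>_degree_zero[OF c] c0 by blast
  then have "?J = carrier R" using maximal hom sub unfolding maximal_homogeneous_ideal_def by blast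
  then have "\<one>\<^bsub>R\<^esub> \<in> ?J" by simp
  then obtain x r where xr: "x \<in> \<mm>" "r \<in> carrier R" "\<one>\<^bsub>R\<^esub> = x \<oplus>\<^bsub>R\<^esub> r \<otimes>\<^bsub>R\<^esub> c" using J_iff by blast
  have xc: "x \<in> carrier R" using xr(1) \<mm>.a_Hcarr by blast
  have "R_parts.hcomp \<one>\<^bsub>R\<^esub> 0 = R_parts.hcomp x 0 \<oplus>\<^bsub>R\<^esub> R_parts.hcomp (c \<otimes>\<^bsub>R\<^esub> r) 0"
    using R_parts.hcomp_add[OF xc, of "c \<otimes>\<^bsub>R\<^esub> r"] xr cc by (simp add: m_comm)
  moreover have "R_parts.hcomp x 0 = \<zero>\<^bsub>R\<^esub>"
    by (rule \<mm>_degree_zero[OF R_parts.hcomp_part[OF xc] \<mm>_hcomp[OF xr(1)]])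
  ultimately have "\<one>\<^bsub>R\<^esub> = c \<otimes>\<^bsub>R\<^esub> R_parts.hcomp r 0"
    using R_parts.hcomp_homogeneous[OF one_part] hcomp_mult[OF c xr(2)] cc xr(2) by simp
  then show ?thesis using R_parts.hcomp_part[OF xr(2)] m_comm[OF cc R_parts.hcomp_carrier[OF xr(2)]] by metis
qed

text \<open>The image of the unit element of the residue field: a scalar multiplies it to the image of its own
  residue class.\<close>

lemma socle_element:
  assumes \<iota>: "\<iota> \<in> graded_Hom R (residue_module R \<mm>) E" "inj_on \<iota> (carrier (residue_module R \<mm>))"
    and E: "graded_module R E"
  shows "\<exists>e \<in> mpart E 0. e \<noteq> \<zero>\<^bsub>E\<^esub> \<and> (\<forall>a r. r \<in> rpart R a \<longrightarrow> a \<noteq> 0 \<longrightarrow> r \<odot>\<^bsub>E\<^esub> e = \<zero>\<^bsub>E\<^esub>)"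
proof -
  interpret E: graded_module R E by fact
  let ?k = "residue_module R \<mm>" and ?u = "\<mm> +>\<^bsub>R\<^esub> \<one>\<^bsub>R\<^esub>"
  have k_carrier: "\<mm> +>\<^bsub>R\<^esub> r \<in> carrier ?k" if "r \<in> carrier R" for r
    using that by (auto simp: residue_module_def FactRing_def A_RCOSETS_def')
  have k_smult: "r \<odot>\<^bsub>?k\<^esub> ?u = \<mm> +>\<^bsub>R\<^esub> r" if "r \<in> carrier R" for r
    using that \<mm>.rcoset_mult_add[OF that one_closed] by (simp add: residue_module_def FactRing_def)
  have u_part: "?u \<in> mpart ?k 0" using one_part by (simp add: residue_module_def)
  let ?e = "\<iota> ?u"
  have e: "?e \<in> mpart E 0" by (rule graded_Hom_part[OF \<iota>(1) u_part])
  have ec: "?e \<in> carrier E" using e E.M_parts.part_carrier by blast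
  have \<iota>_coset: "\<iota> (\<mm> +>\<^bsub>R\<^esub> r) = r \<odot>\<^bsub>E\<^esub> ?e" if "r \<in> carrier R" for r
    using graded_Hom_smult[OF \<iota>(1) that k_carrier[OF one_closed]] k_smult[OF that] by simp
  have kill: "r \<odot>\<^bsub>E\<^esub> ?e = \<zero>\<^bsub>E\<^esub>" if r: "r \<in> \<mm>" for r
  proof -
    have rc: "r \<in> carrier R" using r \<mm>.a_Hcarr by blast
    have "r \<odot>\<^bsub>E\<^esub> ?e = \<iota> (\<mm> +>\<^bsub>R\<^esub> r)" by (rule \<iota>_coset[OF rc, symmetric])
    also have "\<dots> = \<iota> (\<mm> +>\<^bsub>R\<^esub> \<zero>\<^bsub>R\<^esub>)"
      using \<mm>.a_rcos_const[OF r] \<mm>.a_rcos_const[OF \<mm>.zero_closed] by simp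
    also have "\<dots> = \<zero>\<^bsub>E\<^esub>" using \<iota>_coset[OF zero_closed] ec by simp
    finally show ?thesis .
  qed
  have "?e \<noteq> \<zero>\<^bsub>E\<^esub>"
  proof
    assume "?e = \<zero>\<^bsub>E\<^esub>"
    then have "\<iota> ?u = \<iota> (\<mm> +>\<^bsub>R\<^esub> \<zero>\<^bsub>R\<^esub>)" using \<iota>_coset[OF zero_closed] ec by simp
    then have "?u = \<mm> +>\<^bsub>R\<^esub> \<zero>\<^bsub>R\<^esub>" using k_carrier by (intro inj_onD[OF \<iota>(2)]) auto
    then have "\<one>\<^bsub>R\<^esub> \<in> \<mm>"
      using \<mm>.a_rcos_self[OF one_closed] \<mm>.a_rcos_const[OF \<mm>.zero_closed] by simp
    then have "\<mm> = carrier R" by (rule \<mm>.one_imp_carrier)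
    then show False using maximal by (simp add: maximal_homogeneous_ideal_def)
  qed
  with e kill nonzero_degree_in_\<mm> show ?thesis by blast
qed

end

section \<open>The embedding of a module into its associated injective module\<close>

lemma hcomp_graded_Hom:
  assumes M: "graded_module R M" and N: "graded_module R N" and f: "f \<in> graded_Hom R M N"
    and x: "x \<in> carrier M"
  shows "direct_decomposition.hcomp N (mpart N) (f x) a = f (direct_decomposition.hcomp M (mpart M) x a)"
proof -
  interpret M: graded_module R M by fact
  interpret N: graded_module R N by fact
  show ?thesis using x
  proof (induction x rule: M.M_parts.homogeneous_induct)
    case (homogeneous b x)
    then show ?case
      using N.M_parts.hcomp_homogeneous[OF graded_Hom_part[OF f homogeneous]]
        M.M_parts.hcomp_homogeneous[OF homogeneous]
        additive_zero[OF M.M.abelian_group_axioms N.M.abelian_group_axioms graded_Hom_additive[OF f]] by simp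
  next
    case (add x y)
    then show ?case
      using graded_Hom_add[OF f] graded_Hom_closed[OF f]
      by (simp add: M.M_parts.hcomp_add N.M_parts.hcomp_add)
  qed
qed

text \<open>The kernel of a graded homomorphism contains the components of its elements.\<close>

lemma graded_Hom_injI:
  assumes M: "graded_module R M" and N: "graded_module R N" and f: "f \<in> graded_Hom R M N"
    and inj: "\<And>a x. x \<in> mpart M a \<Longrightarrow> f x = \<zero>\<^bsub>N\<^esub> \<Longrightarrow> x = \<zero>\<^bsub>M\<^esub>"
  shows "inj_on f (carrier M)"
proof (rule inj_onI)
  interpret M: graded_module R M by fact
  interpret N: graded_module R N by fact
  fix x y assume x: "x \<in> carrier M" and y: "y \<in> carrier M" and eq: "f x = f y"
  let ?z = "x \<oplus>\<^bsub>M\<^esub> \<ominus>\<^bsub>M\<^esub> y"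
  have z: "?z \<in> carrier M" using x y by simp
  have fz: "f ?z = \<zero>\<^bsub>N\<^esub>"
    using x y eq graded_Hom_add[OF f] graded_Hom_closed[OF f]
      additive_minus[OF M.M.abelian_group_axioms N.M.abelian_group_axioms graded_Hom_additive[OF f] y]
    by (simp add: N.M.r_neg)
  have "M.M_parts.hcomp ?z a = \<zero>\<^bsub>M\<^esub>" for a
  proof (rule inj[OF M.M_parts.hcomp_part[OF z]])
    show "f (M.M_parts.hcomp ?z a) = \<zero>\<^bsub>N\<^esub>"
      using hcomp_graded_Hom[OF M N f z, of a] N.M_parts.hcomp_homogeneous[OF N.M_parts.part_zero, of a] fz
      by simp
  qed
  moreover have "M.M_parts.hcomp \<zero>\<^bsub>M\<^esub> a = \<zero>\<^bsub>M\<^esub>" for a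
    using M.M_parts.hcomp_homogeneous[OF M.M_parts.part_zero, of a] by simp
  ultimately have "?z = \<zero>\<^bsub>M\<^esub>"
    by (intro M.M_parts.hcomp_eqI[OF z M.M.zero_closed]) (simp only:)
  then show "x = y" using x y by (metis M.M.minus_equality M.M.minus_minus M.M.a_inv_closed)
qed

context matlis_pair
begin

text \<open>\<open>E\<close> is a cogenerator. The homogeneous scalars that annihilate \<open>n \<noteq> 0\<close> have nonzero degree or vanish, so
  they annihilate \<open>e\<close> as well; hence \<open>r n \<mapsto> r e\<close> is well defined and extends to \<open>M\<close>.\<close>

lemma dual_detects:
  assumes Baer: "graded_Baer R E"
    and field: "\<And>c. c \<in> rpart R 0 \<Longrightarrow> c \<noteq> \<zero>\<^bsub>R\<^esub> \<Longrightarrow> \<exists>d \<in> rpart R 0. d \<otimes>\<^bsub>R\<^esub> c = \<one>\<^bsub>R\<^esub>"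
    and e: "e \<in> mpart E 0" "e \<noteq> \<zero>\<^bsub>E\<^esub>" "\<And>a r. r \<in> rpart R a \<Longrightarrow> a \<noteq> 0 \<Longrightarrow> r \<odot>\<^bsub>E\<^esub> e = \<zero>\<^bsub>E\<^esub>"
    and n: "n \<in> mpart M a" "n \<noteq> \<zero>\<^bsub>M\<^esub>"
  shows "\<exists>v \<in> mpart dual (- a). v n \<noteq> \<zero>\<^bsub>E\<^esub>"
proof -
  interpret S: graded_module_pair R "shift (- a) M" E
    by (intro graded_module_pair.intro graded_module_shift B.graded_module_axioms E.graded_module_axioms)
  have nc: "n \<in> carrier M" and ec: "e \<in> carrier E"
    using n e B.M_parts.part_carrier E.M_parts.part_carrier by auto
  let ?\<Gamma> = "{(b, r \<odot>\<^bsub>M\<^esub> n, r \<odot>\<^bsub>E\<^esub> e) | b r. r \<in> rpart R b}"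
  have mem: "(b, r \<odot>\<^bsub>M\<^esub> n, r \<odot>\<^bsub>E\<^esub> e) \<in> ?\<Gamma>" if "r \<in> rpart R b" for b r using that by blast
  have rc: "r \<in> carrier R" if "r \<in> rpart R b" for r b using that B.R_parts.part_carrier by blast
  have rel: "homogeneous_relation R (shift (- a) M) E ?\<Gamma>"
    unfolding homogeneous_relation_def
  proof (intro conjI allI impI)
    fix b x f assume "(b, x, f) \<in> ?\<Gamma>"
    then obtain r where r: "r \<in> rpart R b" "x = r \<odot>\<^bsub>M\<^esub> n" "f = r \<odot>\<^bsub>E\<^esub> e" by blast
    show "x \<in> mpart (shift (- a) M) b" using B.smult_degree[OF r(1) n(1)] r(2) by simp
    show "f \<in> mpart E b" using E.smult_degree[OF r(1) e(1)] r(3) by simp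
  next
    fix b
    have "\<zero>\<^bsub>R\<^esub> \<odot>\<^bsub>M\<^esub> n = \<zero>\<^bsub>M\<^esub>" "\<zero>\<^bsub>R\<^esub> \<odot>\<^bsub>E\<^esub> e = \<zero>\<^bsub>E\<^esub>" using nc ec by simp_all
    with mem[OF B.R_parts.part_zero, of b]
    show "(b, \<zero>\<^bsub>shift (- a) M\<^esub>, \<zero>\<^bsub>E\<^esub>) \<in> ?\<Gamma>" by (simp only: shift_simps)
  next
    fix b x f x' f' assume "(b, x, f) \<in> ?\<Gamma>" "(b, x', f') \<in> ?\<Gamma>"
    then obtain r r' where r: "r \<in> rpart R b" "x = r \<odot>\<^bsub>M\<^esub> n" "f = r \<odot>\<^bsub>E\<^esub> e"
      "r' \<in> rpart R b" "x' = r' \<odot>\<^bsub>M\<^esub> n" "f' = r' \<odot>\<^bsub>E\<^esub> e" by blast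
    have "(r \<oplus>\<^bsub>R\<^esub> r') \<odot>\<^bsub>M\<^esub> n = x \<oplus>\<^bsub>M\<^esub> x'" "(r \<oplus>\<^bsub>R\<^esub> r') \<odot>\<^bsub>E\<^esub> e = f \<oplus>\<^bsub>E\<^esub> f'"
      using r rc nc ec by (simp_all add: B.smult_l_distr E.smult_l_distr)
    with mem[OF B.R_parts.part_add[OF r(1,4)]]
    show "(b, x \<oplus>\<^bsub>shift (- a) M\<^esub> x', f \<oplus>\<^bsub>E\<^esub> f') \<in> ?\<Gamma>" by (simp only: shift_simps)
  next
    fix c s b x f assume s: "s \<in> rpart R c" and "(b, x, f) \<in> ?\<Gamma>"
    then obtain r where r: "r \<in> rpart R b" "x = r \<odot>\<^bsub>M\<^esub> n" "f = r \<odot>\<^bsub>E\<^esub> e" by blast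
    have "(s \<otimes>\<^bsub>R\<^esub> r) \<odot>\<^bsub>M\<^esub> n = s \<odot>\<^bsub>M\<^esub> x" "(s \<otimes>\<^bsub>R\<^esub> r) \<odot>\<^bsub>E\<^esub> e = s \<odot>\<^bsub>E\<^esub> f"
      using r s rc nc ec by (simp_all add: B.smult_assoc1 E.smult_assoc1)
    with mem[OF B.mult_degree[OF s r(1)]]
    show "(c + b, s \<odot>\<^bsub>shift (- a) M\<^esub> x, s \<odot>\<^bsub>E\<^esub> f) \<in> ?\<Gamma>" by (simp only: shift_simps)
  qed
  have funct: "functional_relation (shift (- a) M) E ?\<Gamma>"
    unfolding functional_relation_def
  proof (intro allI impI)
    fix b f assume "(b, \<zero>\<^bsub>shift (- a) M\<^esub>, f) \<in> ?\<Gamma>"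
    then obtain r where r: "r \<in> rpart R b" "r \<odot>\<^bsub>M\<^esub> n = \<zero>\<^bsub>M\<^esub>" "f = r \<odot>\<^bsub>E\<^esub> e" by auto
    show "f = \<zero>\<^bsub>E\<^esub>"
    proof (cases "b = 0")
      case True
      have "r = \<zero>\<^bsub>R\<^esub>"
      proof (rule ccontr)
        assume "r \<noteq> \<zero>\<^bsub>R\<^esub>"
        then obtain d where d: "d \<in> rpart R 0" "d \<otimes>\<^bsub>R\<^esub> r = \<one>\<^bsub>R\<^esub>" using field r(1) True by blast
        have "n = (d \<otimes>\<^bsub>R\<^esub> r) \<odot>\<^bsub>M\<^esub> n" using nc d(2) by simp
        also have "\<dots> = d \<odot>\<^bsub>M\<^esub> (r \<odot>\<^bsub>M\<^esub> n)" by (rule B.smult_assoc1[OF rc[OF d(1)] rc[OF r(1)] nc])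
        also have "\<dots> = \<zero>\<^bsub>M\<^esub>" using r(2) rc[OF d(1)] by simp
        finally show False using n(2) by blast
      qed
      then show ?thesis using r(3) ec by simp
    qed (use r e(3) in simp)
  qed
  obtain v where v: "v \<in> graded_Hom R (shift (- a) M) E"
    and v2: "\<forall>b x f. (b, x, f) \<in> ?\<Gamma> \<longrightarrow> v x = f"
    using S.Baer_Hom_extension[OF Baer rel funct] by (rule bexE)
  have "v (\<one>\<^bsub>R\<^esub> \<odot>\<^bsub>M\<^esub> n) = \<one>\<^bsub>R\<^esub> \<odot>\<^bsub>E\<^esub> e" by (rule v2[rule_format, OF mem[OF B.one_part]])
  then have "v n = e" using nc ec by simp
  with v e(2) show ?thesis by auto
qed

abbreviation "double_dual \<equiv> matlis_dual R E dual"

lemma graded_module_double_dual: "graded_module R double_dual"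
  unfolding matlis_dual_def[of R E dual]
  by (rule graded_module_hom_module[OF graded_module_dual E.graded_module_axioms])

lemma dual_value: "v \<in> carrier dual \<Longrightarrow> m \<in> carrier M \<Longrightarrow> v m \<in> carrier E"
  using direct_parts.part_sums_carrier[OF hom_module_parts[OF B.graded_module_axioms E.graded_module_axioms], of v]
  by (auto simp: matlis_dual_def hom_module_def module_of_parts_def)

lemma evaluation_value: "m \<in> carrier M \<Longrightarrow> v \<in> carrier dual \<Longrightarrow> evaluation R E M m v = v m"
  by (simp add: evaluation_def)

lemma evaluation_carrier:
  assumes "m \<in> carrier M"
  shows "evaluation R E M m \<in> carrier double_dual"
proof -
  interpret DD: graded_module R double_dual by (rule graded_module_double_dual)
  show ?thesis using assms
  proof (induction m rule: B.M_parts.homogeneous_induct)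
    case (homogeneous a m)
    have m: "m \<in> carrier M" using homogeneous B.M_parts.part_carrier by blast
    let ?u = "evaluation R E M m"
    have "?u \<in> linear_maps R dual E"
    proof (intro linear_mapsI additive_mapsI)
      show "?u \<in> extensional (carrier dual)" using m by (simp add: evaluation_def)
      show "?u v \<in> carrier E" if "v \<in> carrier dual" for v
        using dual_value[OF that m] evaluation_value[OF m that] by simp
      show "?u (v \<oplus>\<^bsub>dual\<^esub> w) = ?u v \<oplus>\<^bsub>E\<^esub> ?u w" if "v \<in> carrier dual" "w \<in> carrier dual" for v w
        unfolding evaluation_value[OF m that(1)] evaluation_value[OF m that(2)]
          evaluation_value[OF m D.M.a_closed[OF that]] using m by simp
      show "?u (c \<odot>\<^bsub>dual\<^esub> v) = c \<odot>\<^bsub>E\<^esub> ?u v" if "c \<in> carrier R" "v \<in> carrier dual" for c v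
        unfolding evaluation_value[OF m that(2)] evaluation_value[OF m D.smult_closed[OF that]] using m by simp
    qed
    moreover have "?u v \<in> mpart E (a + b)" if v: "v \<in> mpart dual b" for v b
    proof -
      have "v m \<in> mpart E (b + a)" using v homogeneous by (simp add: graded_Hom_shift)
      then show ?thesis
        using evaluation_value[OF m D.M_parts.part_carrier[OF v]] by (simp add: add.commute)
    qed
    ultimately have "?u \<in> mpart double_dual a"
      unfolding matlis_dual_simps(4)[of R E dual] graded_Hom_shift by blast
    then show ?case by (rule DD.M_parts.part_carrier)
  next
    case (add m n)
    note mn = add(1,2)
    have "evaluation R E M (m \<oplus>\<^bsub>M\<^esub> n) = evaluation R E M m \<oplus>\<^bsub>double_dual\<^esub> evaluation R E M n"
    proof (rule extensionalityI[of _ "carrier dual"])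
      show "evaluation R E M (m \<oplus>\<^bsub>M\<^esub> n) \<in> extensional (carrier dual)"
        using add B.M.a_closed by (simp add: evaluation_def)
      show "evaluation R E M m \<oplus>\<^bsub>double_dual\<^esub> evaluation R E M n \<in> extensional (carrier dual)"
        unfolding matlis_dual_simps(2)[of R E dual] by (rule restrict_extensional)
      fix v assume v: "v \<in> carrier dual"
      have "v (m \<oplus>\<^bsub>M\<^esub> n) = v m \<oplus>\<^bsub>E\<^esub> v n"
        using v
      proof (induction v rule: D.M_parts.homogeneous_induct)
        case (homogeneous b v)
        then have "v \<in> linear_maps R M E" by (simp add: graded_Hom_shift)
        then show ?case using mn by (intro linear_maps_add)
      next
        case (add v w)
        then show ?case
          using mn dual_value by (simp add: E.M.a_ac)
      qed
      then show "evaluation R E M (m \<oplus>\<^bsub>M\<^esub> n) v = (evaluation R E M m \<oplus>\<^bsub>double_dual\<^esub> evaluation R E M n) v"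
        unfolding matlis_dual_simps(2)[of R E dual] using v add B.M.a_closed by (simp add: evaluation_value)
    qed
    then show ?case using DD.M.a_closed[OF add.IH] by (simp only:)
  qed
qed

text \<open>The composite of the evaluation homomorphism and the map from the double dual to \<open>E\<^sub>M\<close>.\<close>

definition embedding :: "'m \<Rightarrow> 'g \<Rightarrow> ('m \<Rightarrow> 'e) \<Rightarrow> 'r \<Rightarrow> 'e" where
  "embedding = (\<lambda>m\<in>carrier M. coinduced (\<lambda>v. v m))"

lemma phi_check_evaluation:
  assumes m: "m \<in> carrier M"
  shows "phi_check R E M (evaluation R E M m) = embedding m"
proof -
  have "phi_check R E M (evaluation R E M m) =
      (\<lambda>h. \<lambda>v\<in>mpart dual h. \<lambda>r\<in>carrier R. r \<odot>\<^bsub>E\<^esub> evaluation R E M m v)"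
    unfolding phi_check_def by (simp only: restrict_apply' evaluation_carrier[OF m])
  also have "\<dots> = coinduced (\<lambda>v. v m)"
    unfolding coinduced_def
    by (intro ext restrict_ext) (simp only: evaluation_value[OF m D.M_parts.part_carrier] restrict_def)
  finally show ?thesis using m by (simp add: embedding_def)
qed

lemma coinduced_cong:
  "(\<And>h v. v \<in> mpart dual h \<Longrightarrow> g v = g' v) \<Longrightarrow> coinduced g = coinduced g'"
  unfolding coinduced_def by (intro ext) (simp add: restrict_def del: matlis_dual_simps)

lemma dual_part_Hom: "v \<in> mpart dual h \<Longrightarrow> v \<in> linear_maps R M E"
  by (simp add: graded_Hom_shift)

lemma embedding_part:
  assumes m: "m \<in> mpart M a"
  shows "embedding m \<in> mpart I\<^sub>M a"
proof -
  have mc: "m \<in> carrier M" using m B.M_parts.part_carrier by blast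
  have "coinduced (\<lambda>v. v m) \<in> mpart I\<^sub>M a"
  proof (rule coinduced_part)
    show "v m \<in> mpart E (a + h)" if "v \<in> mpart dual h" for h v
      using that m by (simp add: graded_Hom_shift add.commute)
  qed (use mc in auto)
  then show ?thesis using mc by (simp add: embedding_def)
qed

lemma embedding_add:
  assumes "m \<in> carrier M" "n \<in> carrier M"
  shows "embedding (m \<oplus>\<^bsub>M\<^esub> n) = embedding m \<oplus>\<^bsub>I\<^sub>M\<^esub> embedding n"
proof -
  have "s \<odot>\<^bsub>E\<^esub> v (m \<oplus>\<^bsub>M\<^esub> n) = s \<odot>\<^bsub>E\<^esub> v m \<oplus>\<^bsub>E\<^esub> s \<odot>\<^bsub>E\<^esub> v n"
    if "v \<in> mpart dual h" "s \<in> carrier R" for v h s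
    using assms that(2) linear_maps_add[OF dual_part_Hom[OF that(1)]] linear_maps_closed[OF dual_part_Hom[OF that(1)]]
    by (simp add: E.smult_r_distr)
  then show ?thesis
    unfolding embedding_def coinduced_def associated_injective_simps
    using assms B.M.a_closed by (intro ext) (simp add: restrict_def del: matlis_dual_simps)
qed

lemma embedding_Hom: "embedding \<in> graded_Hom R M I\<^sub>M"
proof (rule graded_HomI[OF B.graded_module_axioms graded_module_associated_injective])
  show "embedding \<in> additive_maps M I\<^sub>M"
  proof (rule additive_mapsI[OF _ embedding_add])
    show "embedding m \<in> carrier I\<^sub>M" if "m \<in> carrier M" for m
      using that
    proof (induction m rule: B.M_parts.homogeneous_induct)
      case (homogeneous a m)
      then show ?case using I.M_parts.part_carrier[OF embedding_part] by blast
    next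
      case (add m n)
      then show ?case using I.M.a_closed[OF add.IH] embedding_add[OF add(1,2)] by (simp only:)
    qed
  qed
  show "embedding \<in> extensional (carrier M)" by (simp add: embedding_def)
  show "embedding m \<in> mpart I\<^sub>M a" if "m \<in> mpart M a" for a m by (rule embedding_part[OF that])
  fix a b r m assume rb: "r \<in> rpart R b" and ma: "m \<in> mpart M a"
  have r: "r \<in> carrier R" and m: "m \<in> carrier M"
    using rb ma B.R_parts.part_carrier B.M_parts.part_carrier by auto
  have "r \<odot>\<^bsub>I\<^sub>M\<^esub> coinduced (\<lambda>v. v m) = coinduced (\<lambda>v. r \<odot>\<^bsub>E\<^esub> v m)"
    by (rule coinduced_smult[OF _ r]) (rule linear_maps_closed[OF dual_part_Hom m])
  also have "\<dots> = coinduced (\<lambda>v. v (r \<odot>\<^bsub>M\<^esub> m))"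
    by (rule coinduced_cong) (rule linear_maps_smult[OF dual_part_Hom r m, symmetric])
  finally show "embedding (r \<odot>\<^bsub>M\<^esub> m) = r \<odot>\<^bsub>I\<^sub>M\<^esub> embedding m"
    using r m by (simp only: embedding_def restrict_apply' B.smult_closed)
qed

lemma embedding_inj:
  assumes detect: "\<And>a m. m \<in> mpart M a \<Longrightarrow> m \<noteq> \<zero>\<^bsub>M\<^esub> \<Longrightarrow> \<exists>v \<in> mpart dual (- a). v m \<noteq> \<zero>\<^bsub>E\<^esub>"
  shows "inj_on embedding (carrier M)"
proof (rule graded_Hom_injI[OF B.graded_module_axioms graded_module_associated_injective embedding_Hom])
  fix a m assume m: "m \<in> mpart M a" and zero: "embedding m = \<zero>\<^bsub>I\<^sub>M\<^esub>"
  have mc: "m \<in> carrier M" using m B.M_parts.part_carrier by blast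
  have "v m = \<zero>\<^bsub>E\<^esub>" if v: "v \<in> mpart dual (- a)" for v
  proof -
    have "embedding m (- a) v \<one>\<^bsub>R\<^esub> = \<zero>\<^bsub>I\<^sub>M\<^esub> (- a) v \<one>\<^bsub>R\<^esub>" using zero by simp
    moreover have "embedding m (- a) v \<one>\<^bsub>R\<^esub> = \<one>\<^bsub>R\<^esub> \<odot>\<^bsub>E\<^esub> v m"
      unfolding embedding_def coinduced_def by (simp only: restrict_apply' mc v B.one_closed)
    moreover have "\<zero>\<^bsub>I\<^sub>M\<^esub> (- a) v \<one>\<^bsub>R\<^esub> = \<zero>\<^bsub>E\<^esub>"
      unfolding associated_injective_simps by (simp only: restrict_apply' v B.one_closed)
    ultimately show ?thesis using linear_maps_closed[OF dual_part_Hom[OF v] mc] by simp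
  qed
  then show "m = \<zero>\<^bsub>M\<^esub>" using detect[OF m] by blast
qed

end

lemma graded_Hom_compose:
  assumes L: "graded_module R L" and f: "f \<in> graded_Hom R L M" and g: "g \<in> graded_Hom R M N"
  shows "compose (carrier L) g f \<in> graded_Hom R L N"
proof -
  interpret L: graded_module R L by fact
  have "compose (carrier L) g f \<in> linear_maps R L N"
    by (intro linear_mapsI additive_mapsI)
      (simp_all add: compose_def graded_Hom_add[OF f] graded_Hom_add[OF g] graded_Hom_smult[OF f]
        graded_Hom_smult[OF g] graded_Hom_closed[OF f] graded_Hom_closed[OF g])
  moreover have "compose (carrier L) g f x \<in> mpart N a" if "x \<in> mpart L a" for x a
    using graded_Hom_part[OF g graded_Hom_part[OF f that]] L.M_parts.part_carrier[OF that]
    by (simp add: compose_def)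
  ultimately show ?thesis by (auto simp: graded_Hom_def)
qed

text \<open>The injection \<open>i\<close> identifies \<open>M\<close> with the image, and does so in each degree since \<open>p\<close> is surjective
  in each degree.\<close>

lemma image_of_factorization:
  assumes L: "graded_module R L" and M: "graded_module R M" and N: "graded_module R N"
    and p: "p \<in> graded_Hom R L M" and i: "i \<in> graded_Hom R M N" "inj_on i (carrier M)"
    and surj: "\<And>m. m \<in> carrier M \<Longrightarrow> \<exists>x\<in>carrier L. p x = m"
    and surj_part: "\<And>m a. m \<in> mpart M a \<Longrightarrow> \<exists>x\<in>mpart L a. p x = m"
  shows "graded_isomorphic R (image_module L N (compose (carrier L) i p)) M"
proof -
  interpret L: graded_module R L by fact
  interpret M: graded_module R M by fact
  interpret N: graded_module R N by fact
  let ?\<phi> = "compose (carrier L) i p"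
  let ?I = "image_module L N ?\<phi>"
  have \<phi>: "?\<phi> x = i (p x)" if "x \<in> carrier L" for x using that by (simp add: compose_def)
  have p_closed: "p x \<in> carrier M" if "x \<in> carrier L" for x by (rule graded_Hom_closed[OF p that])
  have car: "carrier ?I = i ` carrier M"
  proof -
    have "?\<phi> ` carrier L = i ` carrier M"
    proof
      show "?\<phi> ` carrier L \<subseteq> i ` carrier M" using \<phi> p_closed by auto
      show "i ` carrier M \<subseteq> ?\<phi> ` carrier L"
      proof
        fix y assume "y \<in> i ` carrier M"
        then obtain m where m: "m \<in> carrier M" "y = i m" by blast
        then obtain x where x: "x \<in> carrier L" "p x = m" using surj by blast
        then have "y = ?\<phi> x" using \<phi> m by simp
        with x(1) show "y \<in> ?\<phi> ` carrier L" by blast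
      qed
    qed
    then show ?thesis by (simp add: image_module_def)
  qed
  have part: "mpart ?I a = i ` mpart M a" for a
  proof -
    have "?\<phi> ` mpart L a = i ` mpart M a"
    proof
      show "?\<phi> ` mpart L a \<subseteq> i ` mpart M a"
        using \<phi> L.M_parts.part_carrier graded_Hom_part[OF p] by auto
      show "i ` mpart M a \<subseteq> ?\<phi> ` mpart L a"
      proof
        fix y assume "y \<in> i ` mpart M a"
        then obtain m where m: "m \<in> mpart M a" "y = i m" by blast
        then obtain x where x: "x \<in> mpart L a" "p x = m" using surj_part by blast
        then have "y = ?\<phi> x" using \<phi>[OF L.M_parts.part_carrier[OF x(1)]] m by simp
        with x(1) show "y \<in> ?\<phi> ` mpart L a" by blast
      qed
    qed
    then show ?thesis by (simp add: image_module_def)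
  qed
  have ops [simp]: "x \<oplus>\<^bsub>?I\<^esub> y = x \<oplus>\<^bsub>N\<^esub> y" "r \<odot>\<^bsub>?I\<^esub> x = r \<odot>\<^bsub>N\<^esub> x" for x y r
    by (simp_all add: image_module_def)
  define q where "q = (\<lambda>y\<in>carrier ?I. the_inv_into (carrier M) i y)"
  have q: "q (i m) = m" if "m \<in> carrier M" for m
    using that car by (simp add: q_def the_inv_into_f_f[OF i(2)])
  have i_add: "i (m \<oplus>\<^bsub>M\<^esub> n) = i m \<oplus>\<^bsub>N\<^esub> i n" if "m \<in> carrier M" "n \<in> carrier M" for m n
    by (rule graded_Hom_add[OF i(1) that])
  have i_smult: "i (r \<odot>\<^bsub>M\<^esub> m) = r \<odot>\<^bsub>N\<^esub> i m" if "r \<in> carrier R" "m \<in> carrier M" for r m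
    by (rule graded_Hom_smult[OF i(1) that])
  have "q \<in> linear_maps R ?I M"
  proof (intro linear_mapsI additive_mapsI)
    show "q \<in> extensional (carrier ?I)" by (simp add: q_def)
    show "q y \<in> carrier M" if "y \<in> carrier ?I" for y
      using that q unfolding car by auto
    fix y assume "y \<in> carrier ?I"
    then obtain m where m: "m \<in> carrier M" "y = i m" unfolding car by blast
    show "q (r \<odot>\<^bsub>?I\<^esub> y) = r \<odot>\<^bsub>M\<^esub> q y" if "r \<in> carrier R" for r
      using m that q[of "r \<odot>\<^bsub>M\<^esub> m"] q[OF m(1)] by (simp add: i_smult)
    fix z assume "z \<in> carrier ?I"
    then obtain n where n: "n \<in> carrier M" "z = i n" unfolding car by blast
    show "q (y \<oplus>\<^bsub>?I\<^esub> z) = q y \<oplus>\<^bsub>M\<^esub> q z"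
      using m n q[of "m \<oplus>\<^bsub>M\<^esub> n"] q[OF m(1)] q[OF n(1)] by (simp add: i_add)
  qed
  moreover have "q ` mpart ?I a \<subseteq> mpart M a" for a
    unfolding part using q M.M_parts.part_carrier by force
  ultimately have q_Hom: "q \<in> graded_Hom R ?I M" by (simp add: graded_Hom_def)
  have "i \<in> linear_maps R M ?I"
  proof (intro linear_mapsI additive_mapsI)
    show "i \<in> extensional (carrier M)" by (rule graded_Hom_extensional[OF i(1)])
    show "i m \<in> carrier ?I" if "m \<in> carrier M" for m using that car by blast
  qed (simp_all add: i_add i_smult)
  then have i_Hom: "i \<in> graded_Hom R M ?I" using part by (auto simp: graded_Hom_def)
  show ?thesis
    unfolding graded_isomorphic_def
    by (rule bexI[OF bexI[OF _ i_Hom] q_Hom]) (use q in \<open>auto simp: car\<close>)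
qed

section \<open>The associated flat-injective presentation\<close>

theorem theorem3p8:
  fixes R :: "('g::ab_group_add, 'r) graded_ring" and \<mm> :: "'r set"
    and E :: "('g, 'r, 'e) graded_module" and M :: "('g, 'r, 'm) graded_module"
  assumes "local_graded_ring R \<mm>"
    and "(\<lambda>r. \<mm> +>\<^bsub>R\<^esub> r) \<in> ring_iso (degree_zero_ring R) (R Quot \<mm>)"
    and "graded_injective_hull R (residue_module R \<mm>) E"
    and "graded_module R M"
  shows "flat_injective_presentation TYPE('a) TYPE('b) R M
           (associated_flat R M) (associated_injective R E M) (associated_presentation R E M)"
proof -
  interpret local_graded_ring R \<mm> by fact
  interpret split_local_ring R \<mm>
    using assms(2) by (intro split_local_ring.intro split_local_ring_axioms.intro graded_ring_axioms maximal)
  have E_inj: "graded_injective TYPE('r) TYPE('r) R E" and E: "graded_module R E"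
    using assms(3) by (simp_all add: graded_injective_hull_def graded_injective_def)
  have Baer: "graded_Baer R E" by (rule graded_injective_imp_Baer[OF graded_ring_axioms E_inj])
  obtain \<iota> where "\<iota> \<in> graded_Hom R (residue_module R \<mm>) E" "inj_on \<iota> (carrier (residue_module R \<mm>))"
    using assms(3) unfolding graded_injective_hull_def by blast
  then obtain e where e: "e \<in> mpart E 0" "e \<noteq> \<zero>\<^bsub>E\<^esub>" "\<And>a r. r \<in> rpart R a \<Longrightarrow> a \<noteq> 0 \<Longrightarrow> r \<odot>\<^bsub>E\<^esub> e = \<zero>\<^bsub>E\<^esub>"
    using socle_element[OF _ _ E] by blast
  interpret F: flat_cover R M using assms(4) by (rule flat_cover.intro)
  interpret I: matlis_pair R M E
    using assms(4) E by (intro matlis_pair.intro graded_module_pair.intro)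
  let ?F = "associated_flat R M" and ?I = "associated_injective R E M"
  have inj: "inj_on I.embedding (carrier M)"
    by (rule I.embedding_inj) (rule I.dual_detects[OF Baer degree_zero_inverse e])
  have \<phi>: "associated_presentation R E M = compose (carrier ?F) I.embedding (phi_hat R M)"
    unfolding associated_presentation_def compose_def
    by (intro restrict_ext) (simp add: I.phi_check_evaluation additive_closed[OF F.phi_hat_additive])
  have "associated_presentation R E M \<in> graded_Hom R ?F ?I"
    unfolding \<phi> by (rule graded_Hom_compose[OF F.graded_module_flat F.phi_hat_Hom I.embedding_Hom])
  moreover have "graded_flat TYPE('a) TYPE('b) R ?F"
    by (rule F.graded_flat_associated_flat[OF degree_zero_inverse])
  moreover have "graded_injective TYPE('a) TYPE('b) R ?I"
    by (rule graded_Baer_imp_injective[OF I.graded_module_associated_injective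
        I.graded_Baer_associated_injective[OF Baer degree_zero_inverse]])
  moreover have "graded_isomorphic R (image_module ?F ?I (associated_presentation R E M)) M"
    unfolding \<phi>
    by (rule image_of_factorization[OF F.graded_module_flat assms(4) I.graded_module_associated_injective
        F.phi_hat_Hom I.embedding_Hom inj F.phi_hat_surj_carrier F.phi_hat_surj])
  ultimately show ?thesis unfolding flat_injective_presentation_def by blast
qed

end
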